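(* For $v\in V_h$ the following estimate holds for $0<h\le h_0$ with $h_0$ small enough: $$h^{-c}\|v-\lambda_{\Gamma_h}(v)\|_{\mathcal T_h}^2\lesssim\|\nabla_{\Gamma_h}v\|_{\Gamma_h}^2+h^{2-c}\|\nabla v\|_{\mathcal T_h}^2 .$$
   Context: Manifold: $\Gamma\subset\mathbb R^k$ is a smooth compact connected $d$-dimensional embedded submanifold without boundary, $c=k-d\ge1$. $\rho(x)=\mathrm{dist}(x,\Gamma)$, $U_\delta(\Gamma)=\{\rho<\delta\}$; $\delta_0>0$ is fixed so small that the closest point projection $p:U_{\delta_0}(\Gamma)\to\Gamma$ is well defined and smooth. $P_\Gamma(q)$ is the orthogonal projection onto $T_q\Gamma$, $P_\Gamma^e=P_\Gamma\circ p$. Discrete manifold: for $h\in(0,h_0]$, $\mathcal K_h$ is a conforming mesh without boundary of non-degenerate (not necessarily shape-regular) $d$-simplices, $\Gamma_h=\bigcup_{K\in\mathcal K_h}K$; $P_{\Gamma_h}$ is the piecewise constant orthogonal projection onto the linear space parallel to $K$, $\nabla_{\Gamma_h}v=P_{\Gamma_h}\nabla v$. Standing assumptions: $\Gamma_h\subset U_{\delta_0}(\Gamma)$, $p:\Gamma_h\to\Gamma$ is a bijection, $\|\rho\|_{L^\infty(\Gamma_h)}\lesssim h^2$, $\|P_\Gamma^e-P_{\Gamma_h}\|_{L^\infty(\Gamma_h)}\lesssim h$. Background mesh: $\widetilde{\mathcal T}_h$ is a quasi-uniform mesh (mesh parameter $h$) of shape-regular closed $k$-simplices covering a bounded open set containing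 $U_{\delta_0}(\Gamma)$; active mesh $\mathcal T_h=\{T:T\cap\Gamma_h\neq\emptyset\}$, $N_h=\bigcup_{T\in\mathcal T_h}T$, $\|\cdot\|_{\mathcal T_h}=\|\cdot\|_{L^2(N_h)}$. $\mathcal K_h$ is compatible with $\mathcal T_h$: $K\subset T$ whenever the relative interior of $K$ meets $T$. $V_h$: continuous functions on $N_h$, affine on each $T\in\mathcal T_h$. $\lambda_{\Gamma_h}(v)=|\Gamma_h|^{-1}\int_{\Gamma_h}v$ is the average. $a\lesssim b$ means $a\le Cb$ with $C>0$ independent of $h\in(0,h_0]$, of $v$, and of the position of $\Gamma_h$ in the mesh. *)

theory Defs
  imports "HOL-Analysis.Analysis"
begin

section \<open>Smooth maps and embedded submanifolds\<close>

text \<open>The two notions below are only meant for \<^emph>\<open>open\<close> sets \<open>S\<close>. A map is of class \<open>C^(n+1)\<close> iff it is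
  differentiable and all its directional derivatives are of class \<open>C^n\<close>.\<close>

primrec Ck_on :: "nat \<Rightarrow> 'a::real_normed_vector set \<Rightarrow> ('a \<Rightarrow> 'b::real_normed_vector) \<Rightarrow> bool" where
  "Ck_on 0 S f \<longleftrightarrow> continuous_on S f"
| "Ck_on (Suc n) S f \<longleftrightarrow>
     (\<forall>x\<in>S. f differentiable (at x)) \<and> (\<forall>w. Ck_on n S (\<lambda>x. frechet_derivative f (at x) w))"

definition smooth_on :: "'a::real_normed_vector set \<Rightarrow> ('a \<Rightarrow> 'b::real_normed_vector) \<Rightarrow> bool" where
  "smooth_on S f \<longleftrightarrow> (\<forall>n. Ck_on n S f)"

text \<open>Slice charts: near each of its points, \<open>M\<close> is mapped to a piece of a \<open>d\<close>-dimensional linear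
  subspace by a diffeomorphism between open subsets of the ambient space.\<close>

definition embedded_submanifold :: "nat \<Rightarrow> 'a::euclidean_space set \<Rightarrow> bool" where
  "embedded_submanifold d M \<longleftrightarrow>
     (\<forall>q\<in>M. \<exists>(U::'a set) (V::'a set) \<Phi> \<Psi> L.
        open U \<and> q \<in> U \<and> open V \<and> homeomorphism U V \<Phi> \<Psi> \<and> smooth_on U \<Phi> \<and> smooth_on V \<Psi> \<and>
        subspace L \<and> dim L = d \<and> \<Phi> ` (M \<inter> U) = L \<inter> V)"

definition tangent_space :: "'a::euclidean_space set \<Rightarrow> 'a \<Rightarrow> 'a set" where
  "tangent_space M q =
     {w. \<exists>\<gamma> \<epsilon>. 0 < \<epsilon> \<and> smooth_on {-\<epsilon><..<\<epsilon>} \<gamma> \<and> \<gamma> ` {-\<epsilon><..<\<epsilon>} \<subseteq> M \<and> \<gamma> 0 = q \<and>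
         (\<gamma> has_vector_derivative w) (at (0::real))}"

definition tube :: "'a::euclidean_space set \<Rightarrow> real \<Rightarrow> 'a set" where
  "tube M \<delta> = {x. infdist x M < \<delta>}"

text \<open>On \<open>tube M \<delta>\<close> the closest point exists, is unique, and depends smoothly on the point; the library
  function \<open>closest_point M\<close> then is the closest point projection.\<close>

definition smooth_closest_point_on_tube :: "'a::euclidean_space set \<Rightarrow> real \<Rightarrow> bool" where
  "smooth_closest_point_on_tube M \<delta> \<longleftrightarrow>
     (\<forall>x\<in>tube M \<delta>. \<exists>!y. y \<in> M \<and> dist x y = infdist x M) \<and> smooth_on (tube M \<delta>) (closest_point M)"

section \<open>Flat pieces: projection and surface measure\<close>

definition orth_proj :: "'a::euclidean_space set \<Rightarrow> 'a \<Rightarrow> 'a" where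
  "orth_proj L x = (THE y. y \<in> L \<and> (\<forall>z\<in>L. orthogonal (x - y) z))"

definition parallel_space :: "'a::euclidean_space set \<Rightarrow> 'a set" where
  "parallel_space K = span {x - y | x y. x \<in> K \<and> y \<in> K}"

definition orthonormal_basis_of :: "'a::euclidean_space set \<Rightarrow> 'a set \<Rightarrow> bool" where
  "orthonormal_basis_of B L \<longleftrightarrow>
     B \<subseteq> L \<and> pairwise orthogonal B \<and> (\<forall>b\<in>B. norm b = 1) \<and> span B = L"

text \<open>Lebesgue measure of dimension \<open>aff_dim K\<close> on the affine hull of \<open>K\<close>, transported from the coordinate
  space by an affine isometry (compare the definition of \<open>lborel\<close>). By invariance of Lebesgue
  measure under translations and orthogonal maps it does not depend on the chosen base point and
  orthonormal basis. In dimension 0 it is the point mass.\<close>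

definition flat_lborel :: "'a::euclidean_space set \<Rightarrow> 'a measure" where
  "flat_lborel K =
     (let B = (SOME B. orthonormal_basis_of B (parallel_space K)); a = (SOME a. a \<in> K)
      in distr (\<Pi>\<^sub>M b\<in>B. (lborel :: real measure)) borel (\<lambda>f. a + (\<Sum>b\<in>B. f b *\<^sub>R b)))"

section \<open>The discrete manifold\<close>

text \<open>A conforming mesh of non-degenerate \<open>d\<close>-simplices; it has no boundary, i.e. every
  \<open>(d-1)\<close>-dimensional face is shared by exactly two simplices.\<close>

definition closed_surface_mesh :: "nat \<Rightarrow> 'a::euclidean_space set set \<Rightarrow> bool" where
  "closed_surface_mesh d \<K> \<longleftrightarrow>
     triangulation \<K> \<and> (\<forall>K\<in>\<K>. int d simplex K) \<and>
     (\<forall>K\<in>\<K>. \<forall>F. F facet_of K \<longrightarrow> card {K'\<in>\<K>. F facet_of K'} = 2)"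

text \<open>Functions on the surface \<open>\<Union>\<K>\<close> that are only piecewise defined take the simplex as an additional
  argument. Distinct simplices of a mesh overlap in a null set only.\<close>

definition surface_integral :: "'a::euclidean_space set set \<Rightarrow> ('a set \<Rightarrow> 'a \<Rightarrow> real) \<Rightarrow> real" where
  "surface_integral \<K> f = (\<Sum>K\<in>\<K>. LINT x:K|flat_lborel K. f K x)"

definition surface_L2_norm ::
    "'a::euclidean_space set set \<Rightarrow> ('a set \<Rightarrow> 'a \<Rightarrow> 'b::real_normed_vector) \<Rightarrow> real" where
  "surface_L2_norm \<K> f = sqrt (surface_integral \<K> (\<lambda>K x. (norm (f K x))\<^sup>2))"

definition surface_average :: "'a::euclidean_space set set \<Rightarrow> ('a \<Rightarrow> real) \<Rightarrow> real" where
  "surface_average \<K> v = surface_integral \<K> (\<lambda>_. v) / surface_integral \<K> (\<lambda>_ _. 1)"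

text \<open>The \<open>L\<^sup>\<infinity>\<close> norm over \<open>\<Union>\<K>\<close> of a (piecewise defined) function is at most \<open>c\<close>.\<close>

definition surface_Linf_le :: "'a::euclidean_space set set \<Rightarrow> ('a set \<Rightarrow> 'a \<Rightarrow> real) \<Rightarrow> real \<Rightarrow> bool" where
  "surface_Linf_le \<K> f c \<longleftrightarrow> (\<forall>K\<in>\<K>. AE x\<in>K in flat_lborel K. \<bar>f K x\<bar> \<le> c)"

text \<open>\<open>C\<^sub>\<rho>\<close> and \<open>C\<^sub>P\<close> are the constants hidden in the two geometric approximation assumptions.
  The difference of the projections is measured in the operator norm.\<close>

definition approximating_surface ::
    "nat \<Rightarrow> 'a::euclidean_space set \<Rightarrow> real \<Rightarrow> real \<Rightarrow> real \<Rightarrow> real \<Rightarrow> 'a set set \<Rightarrow> bool" where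
  "approximating_surface d M \<delta> C\<^sub>\<rho> C\<^sub>P h \<K> \<longleftrightarrow>
     closed_surface_mesh d \<K> \<and>
     \<Union>\<K> \<subseteq> tube M \<delta> \<and>
     bij_betw (closest_point M) (\<Union>\<K>) M \<and>
     surface_Linf_le \<K> (\<lambda>_ x. infdist x M) (C\<^sub>\<rho> * h\<^sup>2) \<and>
     surface_Linf_le \<K>
       (\<lambda>K x. onorm (\<lambda>w. orth_proj (tangent_space M (closest_point M x)) w
                          - orth_proj (parallel_space K) w)) (C\<^sub>P * h)"

section \<open>The background mesh and the finite element space\<close>

text \<open>A mesh of full-dimensional closed simplices covering an open bounded neighbourhood of \<open>U\<close>.
  Shape regularity with constant \<open>\<sigma>\<close>: each simplex contains a ball of radius \<open>r\<close> comparable to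
  its diameter. Quasi-uniformity with constant \<open>\<tau>\<close>: all diameters are comparable to \<open>h\<close>.
  Of the mesh only non-overlapping is required, which every face-to-face mesh satisfies.\<close>

definition background_mesh :: "real \<Rightarrow> real \<Rightarrow> real \<Rightarrow> 'a::euclidean_space set \<Rightarrow> 'a set set \<Rightarrow> bool" where
  "background_mesh \<sigma> \<tau> h U \<T> \<longleftrightarrow>
     finite \<T> \<and> (\<forall>T\<in>\<T>. int DIM('a) simplex T) \<and>
     pairwise (\<lambda>T T'. interior T \<inter> interior T' = {}) \<T> \<and>
     (\<exists>\<Omega>. open \<Omega> \<and> bounded \<Omega> \<and> U \<subseteq> \<Omega> \<and> \<Omega> \<subseteq> \<Union>\<T>) \<and>
     (\<forall>T\<in>\<T>. \<exists>x r. 0 < r \<and> cball x r \<subseteq> T \<and> diameter T \<le> \<sigma> * r) \<and>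
     (\<forall>T\<in>\<T>. h \<le> \<tau> * diameter T \<and> diameter T \<le> \<tau> * h)"

definition active_mesh :: "'a::euclidean_space set set \<Rightarrow> 'a set set \<Rightarrow> 'a set set" where
  "active_mesh \<T> \<K> = {T\<in>\<T>. T \<inter> \<Union>\<K> \<noteq> {}}"

definition compatible :: "'a::euclidean_space set set \<Rightarrow> 'a set set \<Rightarrow> bool" where
  "compatible \<K> \<T> \<longleftrightarrow> (\<forall>K\<in>\<K>. \<forall>T\<in>\<T>. rel_interior K \<inter> T \<noteq> {} \<longrightarrow> K \<subseteq> T)"

text \<open>Continuous piecewise affine functions; their values outside \<open>\<Union>\<T>\<close> are irrelevant.\<close>

definition fe_space :: "'a::euclidean_space set set \<Rightarrow> ('a \<Rightarrow> real) set" where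
  "fe_space \<T> = {v. continuous_on (\<Union>\<T>) v \<and> (\<forall>T\<in>\<T>. \<exists>g b. \<forall>x\<in>T. v x = g \<bullet> x + b)}"

definition bulk_L2_norm :: "'a::euclidean_space set set \<Rightarrow> ('a \<Rightarrow> 'b::real_normed_vector) \<Rightarrow> real" where
  "bulk_L2_norm \<T> f = sqrt (LINT x:\<Union>\<T>|lebesgue. (norm (f x))\<^sup>2)"

definition gradient :: "('a::euclidean_space \<Rightarrow> real) \<Rightarrow> 'a filter \<Rightarrow> 'a" where
  "gradient v F = (\<Sum>b\<in>Basis. frechet_derivative v F b *\<^sub>R b)"

text \<open>A simplex \<open>K\<close> may lie in a common face of several elements, where the full gradient of
  \<open>v\<close> is multivalued. Its projection to \<open>K\<close> is not: it may be computed from the gradient of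
  the restriction of \<open>v\<close> to any element \<open>T\<close> containing \<open>K\<close>.\<close>

definition surface_gradient :: "'a::euclidean_space set set \<Rightarrow> ('a \<Rightarrow> real) \<Rightarrow> 'a set \<Rightarrow> 'a \<Rightarrow> 'a" where
  "surface_gradient \<T> v K x =
     orth_proj (parallel_space K) (gradient v (at x within (SOME T. T \<in> \<T> \<and> K \<subseteq> T)))"

end

theory Submission
  imports Defs
begin

text \<open>
  Let \<open>p\<close> be the closest point projection and \<open>\<pi> = (p|\<Gamma>\<^sub>h)\<inverse> \<circ> p\<close>, which maps a tube \<open>U\<close> around \<open>\<Gamma>\<close> onto
  \<open>\<Gamma>\<^sub>h\<close>. The function \<open>w = v \<circ> \<pi>\<close> lives on a connected open set, so its Poincare inequality follows from
  the one on balls by chaining, without charts of \<open>\<Gamma>\<close>. Along a segment in \<open>U\<close>, the function \<open>w\<close> is Lipschitz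
  on each of the finitely many pieces that \<open>\<pi>\<close> maps to one simplex \<open>K\<close>, with a constant proportional to
  the surface gradient on \<open>K\<close>; hence the surface gradient is an upper gradient of \<open>w\<close>. Over \<open>K\<close>, replacing
  \<open>x - p x\<close> by its component normal to \<open>K\<close> straightens the fibres of \<open>p\<close> by a bi-Lipschitz map, with
  constants that depend on \<open>\<Gamma>\<close> only (thin simplices do no harm). So the volume of \<open>\<pi>\<inverse>(A)\<close> is comparable with
  the area of \<open>A \<subseteq> K\<close>, and the inequality descends to \<open>\<Gamma>\<^sub>h\<close>.

  For the bulk norm choose \<open>y \<in> T \<inter> \<Gamma>\<^sub>h\<close> in every active element \<open>T\<close>. The points of \<open>U\<close> that \<open>p\<close> maps to within
  \<open>h\<close> of \<open>p y\<close> fill a volume of order \<open>h^d\<close>. Such a point \<open>x\<close> is joined to \<open>y\<close> by lifting a segment to a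
  path in \<open>\<Gamma>\<^sub>h\<close>, which stays in boundedly many elements near \<open>T\<close>; thus \<open>v y\<close> differs from \<open>w x\<close> by
  \<open>h |\<nabla>v|\<close> on these elements, and \<open>v y - \<lambda>\<close> is controlled by averaging \<open>w - \<lambda>\<close> over \<open>x\<close>.
\<close>

section \<open>Lipschitz images\<close>

text \<open>The simplices of \<open>\<K>\<close> may be arbitrarily thin and the lift may bend where
  two of them meet, so neither scaling to a reference simplex nor a global Lipschitz bound for the
  lift is at hand. Lifting to the tube trades the varying surface for one fixed domain, whose
  Poincare constant is chosen before \<open>h\<close>, the meshes and \<open>v\<close>. The price is
  that the lifted function is known to be Lipschitz only simplex by simplex. An upper gradient suits
  this: the increment along a segment is bounded by the lengths of the images of the pieces, however
  irregular these are. Volumes are likewise compared through Lipschitz images; no Jacobian is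
  computed, and factors such as \<open>(2 * DIM('a)) ^ DIM('a)\<close> are simply paid. Smallness of
  \<open>h\<close> is used in three fixed ways: the surface lies in the tube, its planes are within
  1/4 of the tangent planes in operator norm, and \<open>h\<close> is small against
  \<open>r\<close>. The factor \<open>h ^ (DIM('a) - d)\<close> is the volume of an element, of
  order \<open>h ^ DIM('a)\<close>, over the volume of the tube above a piece of
  \<open>\<Gamma>\<close> of size \<open>h\<close>, which is of order \<open>h ^ d\<close> because
  the width of the tube is fixed.\<close>

lemma lipschitz_image_cover:
  fixes f :: "'a::euclidean_space \<Rightarrow> 'a"
  assumes S: "S \<in> sets borel" "bounded S" and S0: "S0 \<subseteq> S"
    and lip: "\<And>x y. x \<in> S0 \<Longrightarrow> y \<in> S0 \<Longrightarrow> norm (f x - f y) \<le> M * norm (x - y)"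
    and M: "0 \<le> M" and e: "0 < (e::real)"
  obtains W where "W \<in> sets borel" "f ` S0 \<subseteq> W"
    "emeasure lborel W \<le> ennreal ((2 * M * DIM('a)) ^ DIM('a)) * (emeasure lborel S + ennreal e)"
proof -
  obtain T where T: "open T" "S \<subseteq> T" "emeasure lborel (T - S) < e"
    using outer_regular_lborel[OF S(1) e] by blast
  have Sf: "emeasure lborel S < \<infinity>" using S(2) emeasure_bounded_finite by blast
  have "emeasure lborel T = emeasure lborel S + emeasure lborel (T - S)"
    using T S by (subst plus_emeasure) (auto simp: Un_absorb1)
  also have "\<dots> \<le> emeasure lborel S + ennreal e"
    using T(3) by (intro add_left_mono) auto
  finally have Tle: "emeasure lborel T \<le> emeasure lborel S + ennreal e" .
  have Tfin: "emeasure lborel T < \<infinity>" 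
    using Tle Sf by (metis ennreal_add_less_top ennreal_less_top infinity_ennreal_def order_le_less_trans)
  have Tm: "T \<in> lmeasurable" using T(1) Tfin by (simp add: fmeasurable_def)
  define m where "m = measure lebesgue T"
  have mT: "emeasure lborel T = ennreal m"
    using emeasure_eq_measure2[OF Tm] T(1) by (simp add: m_def)
  \<comment> \<open>The gauge keeps every cell that is tagged in \<open>S0\<close> inside
    \<open>T\<close>. The radius 1 elsewhere is a dummy value, since all tags lie in
    \<open>S0\<close>.\<close>
  have gauge: "gauge (\<lambda>x. if x \<in> S0 then T else ball x 1)"
    using T S0 by (auto simp: gauge_def)
  \<comment> \<open>A cube rather than a general box: all dyadic cells are then cubes, and the
    diameter of a cube is controlled by its volume.\<close>
  obtain c where c: "S0 \<subseteq> cbox (-c *\<^sub>R One) (c *\<^sub>R One)" "box (-c *\<^sub>R One:: 'a) (c *\<^sub>R One) \<noteq> {}"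
  proof -
    obtain B where B: "\<And>x. x \<in> S0 \<Longrightarrow> norm x \<le> B"
      using bounded_subset[OF S(2) S0] bounded_iff by blast
    show ?thesis
    proof (rule_tac c = "abs B + 1" in that)
      show "S0 \<subseteq> cbox (- (\<bar>B\<bar> + 1) *\<^sub>R One) ((\<bar>B\<bar> + 1) *\<^sub>R One)"
        using norm_bound_Basis_le Basis_le_norm
        by (fastforce simp: mem_box dest!: B intro: order_trans)
      show "box (- (\<bar>B\<bar> + 1) *\<^sub>R One) ((\<bar>B\<bar> + 1) *\<^sub>R One) \<noteq> {}"
        by (simp add: box_eq_empty(1))
    qed
  qed
  obtain \<D> where "countable \<D>"
     and cbox: "\<And>K. K \<in> \<D> \<Longrightarrow> interior K \<noteq> {} \<and> (\<exists>c d. K = cbox c d)"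
     and pw: "pairwise (\<lambda>A B. interior A \<inter> interior B = {}) \<D>"
     and Ksub: "\<And>K. K \<in> \<D> \<Longrightarrow> \<exists>x \<in> S0 \<inter> K. K \<subseteq> (if x \<in> S0 then T else ball x 1)"
     and exN:  "\<And>u v. cbox u v \<in> \<D> \<Longrightarrow> \<exists>n. \<forall>i \<in> Basis. v \<bullet> i - u \<bullet> i = (2*c) / 2^n"
     and SD: "S0 \<subseteq> \<Union>\<D>"
    using covering_lemma [OF c gauge] by force
  have KT: "K \<subseteq> T" if "K \<in> \<D>" for K
    using Ksub[OF that] by auto
  have "\<exists>(s::real) z. z \<in> S0 \<inter> K \<and> 0 \<le> s \<and> measure lebesgue K = s ^ DIM('a) \<and>
           (\<forall>x\<in>K. norm (x - z) \<le> DIM('a) * s)" if KD: "K \<in> \<D>" for K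
  proof -
    obtain u v where K1: "K = cbox u v" using cbox[OF KD] by blast
    then have K: "K = cbox u v" "box u v \<noteq> {}" using cbox[OF KD] by auto
    obtain z where z: "z \<in> S0 \<inter> K" using Ksub[OF KD] by blast
    obtain n where n: "\<And>i. i \<in> Basis \<Longrightarrow> v \<bullet> i - u \<bullet> i = (2*c) / 2^n"
      using exN KD K by blast
    define s where "s = (2*c) / 2^n"
    have uv: "u \<bullet> i < v \<bullet> i" if "i \<in> Basis" for i using K(2) that by (simp add: box_ne_empty)
    have s0: "0 \<le> s" using n uv nonempty_Basis unfolding s_def by (metis diff_gt_0_iff_gt ex_in_conv less_eq_real_def)
    have "measure lebesgue K = (\<Prod>i\<in>(Basis::'a set). v \<bullet> i - u \<bullet> i)"
      using uv by (simp add: K content_cbox less_imp_le inner_diff_left)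
    also have "\<dots> = s ^ DIM('a)" using n by (simp add: s_def)
    finally have 1: "measure lebesgue K = s ^ DIM('a)" .
    have "norm (x - z) \<le> DIM('a) * s" if "x \<in> K" for x
    proof -
      have "norm (x - z) \<le> (\<Sum>i\<in>Basis. \<bar>(x - z) \<bullet> i\<bar>)" by (rule norm_le_l1)
      also have "\<dots> \<le> (\<Sum>i\<in>(Basis::'a set). s)"
      proof (rule sum_mono)
        fix i :: 'a assume i: "i \<in> Basis"
        have "u \<bullet> i \<le> x \<bullet> i" "x \<bullet> i \<le> v \<bullet> i" "u \<bullet> i \<le> z \<bullet> i" "z \<bullet> i \<le> v \<bullet> i"
          using that z i K by (auto simp: mem_box)
        then show "\<bar>(x - z) \<bullet> i\<bar> \<le> s"
          using n[OF i] by (simp add: s_def inner_diff_left)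
      qed
      finally show ?thesis by simp
    qed
    then show ?thesis using z s0 1 by blast
  qed
  then obtain s :: "'a set \<Rightarrow> real" and z where sz: "\<And>K. K \<in> \<D> \<Longrightarrow> z K \<in> S0 \<inter> K \<and> 0 \<le> s K \<and>
      measure lebesgue K = s K ^ DIM('a) \<and> (\<forall>x\<in>K. norm (x - z K) \<le> DIM('a) * s K)"
    by metis
  \<comment> \<open>A cell of side \<open>s K\<close> has diameter at most
    \<open>DIM('a) * s K\<close>, so the image of its tagged part fits into a cube of half side
    \<open>M * DIM('a) * s K\<close>. This is the origin of the factor
    \<open>(2 * M * DIM('a)) ^ DIM('a)\<close>.\<close>
  define B where "B K = cbox (f (z K) - (M * DIM('a) * s K) *\<^sub>R One) (f (z K) + (M * DIM('a) * s K) *\<^sub>R One)" for K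
  define W where "W = (\<Union>K\<in>\<D>. B K)"
  let ?c = "(2 * M * DIM('a)) ^ DIM('a)"
  have mB: "measure lebesgue (B K) = ?c * measure lebesgue K" if "K \<in> \<D>" for K
  proof -
    have "0 \<le> M * DIM('a) * s K" using sz[OF that] M by auto
    then have "measure lebesgue (B K) = (\<Prod>i\<in>(Basis::'a set). (2 * (M * DIM('a) * s K)))"
      unfolding B_def by (simp add: content_cbox inner_diff_left inner_add_left mult_ac)
    also have "\<dots> = ?c * s K ^ DIM('a)"
      by (simp add: power_mult_distrib)
    finally show ?thesis using sz[OF that] by simp
  qed
  \<comment> \<open>A bound that is uniform over finite subfamilies passes to the countable union.
    Disjoint interiors make the volumes of the cells add up inside \<open>T\<close>.\<close>
  have bound: "measure lebesgue (\<Union>K\<in>\<D>'. B K) \<le> ?c * m" if D': "\<D>' \<subseteq> \<D>" "finite \<D>'" for \<D>'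
  proof -
    have "measure lebesgue (\<Union>K\<in>\<D>'. B K) \<le> (\<Sum>K\<in>\<D>'. measure lebesgue (B K))"
      by (rule measure_UNION_le) (use D' in \<open>auto simp: B_def\<close>)
    also have "\<dots> = ?c * (\<Sum>K\<in>\<D>'. measure lebesgue K)"
      unfolding sum_distrib_left by (rule sum.cong) (use mB D' in auto)
    also have "(\<Sum>K\<in>\<D>'. measure lebesgue K) = measure lebesgue (\<Union>\<D>')"
    proof (rule measure_negligible_finite_Union[symmetric])
      show "finite \<D>'" by fact
      show "K \<in> lmeasurable" if "K \<in> \<D>'" for K using cbox D' that by blast
      show "pairwise (\<lambda>S T. negligible (S \<inter> T)) \<D>'"
      proof (rule pairwiseI)
        fix A B assume AB: "A \<in> \<D>'" "B \<in> \<D>'" "A \<noteq> B"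
        then have i: "interior (A \<inter> B) = {}" using pw D' by (auto simp: pairwise_def)
        obtain a b a' b' where "A = cbox a b" "B = cbox a' b'" using cbox AB D' by (metis subsetD)
        then have "convex (A \<inter> B)" by (simp add: convex_Int)
        with i show "negligible (A \<inter> B)" using negligible_convex_interior by blast
      qed
    qed
    also have "\<dots> \<le> m" unfolding m_def
    proof (rule measure_mono_fmeasurable)
      show "\<Union>\<D>' \<subseteq> T" using KT D' by blast
      have "K \<in> sets lebesgue" if "K \<in> \<D>'" for K using cbox D' that lmeasurable_cbox by blast
      then show "\<Union>\<D>' \<in> sets lebesgue" using D' by (intro sets.finite_Union) auto
    qed (fact Tm)
    finally show ?thesis using M by (simp add: mult_left_mono)
  qed
  have Bm: "B K \<in> lmeasurable" for K by (simp add: B_def)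
  have Wm: "W \<in> lmeasurable" "measure lebesgue W \<le> ?c * m"
    unfolding W_def
    by (rule fmeasurable_UN_bound[OF \<open>countable \<D>\<close> Bm bound], assumption+)
       (rule measure_UN_bound[OF \<open>countable \<D>\<close> Bm bound], assumption+)
  have Wb: "W \<in> sets borel"
    unfolding W_def using \<open>countable \<D>\<close> by (auto intro!: sets.countable_UN' simp: B_def)
  have "f ` S0 \<subseteq> W"
  proof
    fix y assume "y \<in> f ` S0"
    then obtain x K where x: "x \<in> S0" "y = f x" "x \<in> K" "K \<in> \<D>" using SD by blast
    have "norm (f x - f (z K)) \<le> M * norm (x - z K)" using lip x sz[OF x(4)] by auto
    also have "\<dots> \<le> M * (DIM('a) * s K)" using sz[OF x(4)] x M by (intro mult_left_mono) auto
    finally have "norm (f x - f (z K)) \<le> M * DIM('a) * s K" by simp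
    then have "\<bar>(f x - f (z K)) \<bullet> i\<bar> \<le> M * DIM('a) * s K" if "i \<in> Basis" for i
      using Basis_le_norm[OF that] order_trans by blast
    then have "f x \<in> B K" 
      unfolding B_def mem_box by (auto simp: inner_diff_left inner_add_left abs_le_iff algebra_simps)
    then show "y \<in> W" using x by (auto simp: W_def)
  qed
  moreover have "emeasure lborel W \<le> ennreal ?c * (emeasure lborel S + ennreal e)"
  proof -
    have "emeasure lborel W = ennreal (measure lebesgue W)"
      using emeasure_eq_measure2[OF Wm(1)] Wb by simp
    also have "\<dots> \<le> ennreal (?c * m)" using Wm(2) by (rule ennreal_leI)
    also have "\<dots> = ennreal ?c * ennreal m" using M by (intro ennreal_mult) (auto simp: m_def)
    also have "\<dots> \<le> ennreal ?c * (emeasure lborel S + ennreal e)"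
      using Tle mT by (intro mult_left_mono) auto
    finally show ?thesis .
  qed
  ultimately show ?thesis by (rule that[OF Wb])
qed

text \<open>Only inclusions enter: \<open>S0\<close> is any subset of a Borel set \<open>S\<close>,
  and \<open>A\<close> has to lie inside the image. Images under the straightening map and its
  inverse can therefore be used without a measurability proof of their own.\<close>

lemma lipschitz_image_emeasure_le:
  fixes f :: "'a::euclidean_space \<Rightarrow> 'a"
  assumes S: "S \<in> sets borel" "bounded S" and S0: "S0 \<subseteq> S"
    and lip: "\<And>x y. x \<in> S0 \<Longrightarrow> y \<in> S0 \<Longrightarrow> norm (f x - f y) \<le> M * norm (x - y)"
    and M: "0 \<le> M" and A: "A \<in> sets borel" "A \<subseteq> f ` S0"
  shows "emeasure lborel A \<le> ennreal ((2 * M * DIM('a)) ^ DIM('a)) * emeasure lborel S"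
proof -
  define c where "c = (2 * M * DIM('a)) ^ DIM('a)"
  have c0: "0 \<le> c" using M by (simp add: c_def)
  show ?thesis unfolding c_def[symmetric]
  proof (rule ennreal_le_epsilon)
    fix e :: real assume e: "0 < e"
    \<comment> \<open>The added 1 covers the case \<open>c = 0\<close>.\<close>
    have e': "0 < e / (c + 1)" using e c0 by simp
    obtain W where W: "W \<in> sets borel" "f ` S0 \<subseteq> W"
      "emeasure lborel W \<le> ennreal c * (emeasure lborel S + ennreal (e / (c + 1)))"
      using lipschitz_image_cover[OF S S0 lip M e', folded c_def] by metis
    have "emeasure lborel A \<le> emeasure lborel W" using W A by (intro emeasure_mono) auto
    also have "\<dots> \<le> ennreal c * emeasure lborel S + ennreal c * ennreal (e / (c + 1))"
      using W(3) by (simp add: distrib_left)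
    also have "\<dots> \<le> ennreal c * emeasure lborel S + ennreal e"
    proof (rule add_left_mono)
      have "ennreal c * ennreal (e / (c + 1)) = ennreal (c * (e / (c + 1)))"
        using c0 e by (intro ennreal_mult[symmetric]) auto
      also have "\<dots> \<le> ennreal e" proof (rule ennreal_leI)
        have "c / (c + 1) * e \<le> 1 * e" using c0 e by (intro mult_right_mono) auto
        then show "c * (e / (c + 1)) \<le> e" by simp
      qed
      finally show "ennreal c * ennreal (e / (c + 1)) \<le> ennreal e" .
    qed
    finally show "emeasure lborel A \<le> ennreal c * emeasure lborel S + ennreal e" .
  qed
qed

section \<open>Orthogonal projections and frames\<close>

definition orthonormal :: "'a::euclidean_space set \<Rightarrow> bool" where
  "orthonormal B \<longleftrightarrow> pairwise orthogonal B \<and> (\<forall>b\<in>B. norm b = 1)"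

lemma orthonormal_inner:
  "orthonormal B \<Longrightarrow> b \<in> B \<Longrightarrow> b' \<in> B \<Longrightarrow> b \<bullet> b' = (if b = b' then 1 else 0)"
  by (auto simp: orthonormal_def pairwise_def orthogonal_def norm_eq_1)

lemma orthonormal_finite: "orthonormal B \<Longrightarrow> finite B"
  by (simp add: orthonormal_def pairwise_orthogonal_imp_finite)

lemma orthonormal_independent: "orthonormal B \<Longrightarrow> independent B"
  unfolding orthonormal_def by (rule pairwise_orthogonal_independent) auto

lemma orthonormal_inner_sum:
  assumes "orthonormal B" "A \<subseteq> B" "b \<in> B"
  shows "(\<Sum>c\<in>A. f c *\<^sub>R c) \<bullet> b = (if b \<in> A then f b else 0)"
proof -
  have "(\<Sum>c\<in>A. f c *\<^sub>R c) \<bullet> b = (\<Sum>c\<in>A. if c = b then f b else 0)"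
    unfolding inner_sum_left
  proof (rule sum.cong)
    fix c assume "c \<in> A"
    then show "(f c *\<^sub>R c) \<bullet> b = (if c = b then f b else 0)"
      using orthonormal_inner[OF assms(1), of c b] assms by auto
  qed simp
  also have "\<dots> = (if b \<in> A then f b else 0)"
    using finite_subset[OF assms(2) orthonormal_finite[OF assms(1)]] by simp
  finally show ?thesis .
qed

lemma orthonormal_expand:
  assumes "orthonormal B" "x \<in> span B"
  shows "(\<Sum>b\<in>B. (x \<bullet> b) *\<^sub>R b) = x"
  using assms orthonormal_basis_expand[of B x] orthonormal_finite[of B]
  by (auto simp: orthonormal_def)

text \<open>Orthogonal projectors are treated as symmetric idempotent maps, because the projector
  onto a tangent space first appears as a derivative and its range is identified afterwards.\<close>

definition is_projector :: "('a::euclidean_space \<Rightarrow> 'a) \<Rightarrow> bool" where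
  "is_projector P \<longleftrightarrow> linear P \<and> (\<forall>x. P (P x) = P x) \<and> (\<forall>x y. P x \<bullet> y = x \<bullet> P y)"

lemma
  assumes "is_projector P"
  shows projector_linear: "linear P"
    and projector_idem [simp]: "P (P x) = P x"
    and projector_sym: "P x \<bullet> y = x \<bullet> P y"
  using assms by (auto simp: is_projector_def)

lemma projector_pythagoras:
  assumes "is_projector P"
  shows "(norm x)\<^sup>2 = (norm (P x))\<^sup>2 + (norm (x - P x))\<^sup>2"
proof -
  have "orthogonal (P x) (x - P x)"
    using projector_idem[OF assms, of x] projector_sym[OF assms, of x x] projector_sym[OF assms, of x "P x"]
    by (simp add: orthogonal_def inner_diff_right)
  from norm_add_Pythagorean[OF this] show ?thesis by simp
qed

lemma projector_norm_le:
  assumes "is_projector P"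
  shows "norm (P x) \<le> norm x" and "norm (x - P x) \<le> norm x"
proof -
  have "(norm (P x))\<^sup>2 \<le> (norm x)\<^sup>2" "(norm (x - P x))\<^sup>2 \<le> (norm x)\<^sup>2"
    using projector_pythagoras[OF assms, of x] by simp_all
  then show "norm (P x) \<le> norm x" "norm (x - P x) \<le> norm x"
    by (auto intro: power2_le_imp_le)
qed

lemma subspace_orthonormal_basis:
  assumes "subspace L"
  obtains B where "orthonormal B" "card B = dim L" "span B = L"
  using orthonormal_basis_subspace[OF assms] by (metis orthonormal_def)

lemma orthogonal_complement_basis:
  fixes L :: "'a::euclidean_space set"
  assumes "subspace L"
  obtains B where "orthonormal B" "card B = DIM('a) - dim L" "span B = {x. \<forall>y\<in>L. orthogonal y x}"
proof -
  have s: "subspace {x. \<forall>y\<in>L. orthogonal y x}" by (rule subspace_orthogonal_to_vectors)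
  obtain B where B: "orthonormal B" "card B = dim {x. \<forall>y\<in>L. orthogonal y x}"
    "span B = {x. \<forall>y\<in>L. orthogonal y x}"
    by (rule subspace_orthonormal_basis[OF s])
  have "dim {y \<in> UNIV. \<forall>x \<in> L. orthogonal x y} + dim L = dim (UNIV::'a set)"
    by (rule dim_subspace_orthogonal_to_vectors[OF assms]) auto
  then show ?thesis using B by (intro that[of B]) auto
qed

lemma orth_proj_eqI:
  assumes "subspace L" "y \<in> L" "\<And>z. z \<in> L \<Longrightarrow> orthogonal (x - y) z"
  shows "orth_proj L x = y"
  unfolding orth_proj_def
proof (rule the_equality)
  show "y \<in> L \<and> (\<forall>z\<in>L. orthogonal (x - y) z)" using assms by auto
  fix y' assume y': "y' \<in> L \<and> (\<forall>z\<in>L. orthogonal (x - y') z)"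
  then have "y' - y \<in> L" using assms by (simp add: subspace_diff)
  then have "(x - y) \<bullet> (y' - y) = 0" "(x - y') \<bullet> (y' - y) = 0"
    using y' assms by (auto simp: orthogonal_def)
  then have "(y' - y) \<bullet> (y' - y) = 0" by (simp add: inner_diff_left)
  then show "y' = y" by simp
qed

lemma orth_proj_eq_sum:
  assumes "orthonormal B"
  shows "orth_proj (span B) x = (\<Sum>b\<in>B. (x \<bullet> b) *\<^sub>R b)"
proof (rule orth_proj_eqI)
  show "(\<Sum>b\<in>B. (x \<bullet> b) *\<^sub>R b) \<in> span B"
    by (intro span_sum span_scale span_base)
  fix z assume z: "z \<in> span B"
  have "(x - (\<Sum>b\<in>B. (x \<bullet> b) *\<^sub>R b)) \<bullet> b = 0" if "b \<in> B" for b
    using orthonormal_inner_sum[OF assms subset_refl that, of "\<lambda>b. x \<bullet> b"] that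
    by (simp add: inner_diff_left)
  then have "(x - (\<Sum>b\<in>B. (x \<bullet> b) *\<^sub>R b)) \<bullet> (\<Sum>b\<in>B. (z \<bullet> b) *\<^sub>R b) = 0"
    unfolding inner_sum_right by simp
  then show "orthogonal (x - (\<Sum>b\<in>B. (x \<bullet> b) *\<^sub>R b)) z"
    using orthonormal_expand[OF assms z] by (simp add: orthogonal_def)
qed (rule subspace_span)

lemma is_projector_orth_proj:
  assumes "subspace L"
  shows "is_projector (orth_proj L)"
proof -
  obtain B where B: "orthonormal B" "span B = L"
    using subspace_orthonormal_basis[OF assms] by metis
  have eq: "orth_proj L x = (\<Sum>b\<in>B. (x \<bullet> b) *\<^sub>R b)" for x
    using orth_proj_eq_sum[OF B(1)] B(2) by simp
  have lin: "linear (orth_proj L)"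
    unfolding eq by (intro linear_compose_sum ballI) (auto intro!: linearI simp: algebra_simps)
  have sym: "orth_proj L x \<bullet> y = x \<bullet> orth_proj L y" for x y
    unfolding eq by (simp add: inner_sum_left inner_sum_right mult_ac inner_commute)
  have mem: "orth_proj L x \<in> L" for x
  proof -
    have "(\<Sum>b\<in>B. (x \<bullet> b) *\<^sub>R b) \<in> span B" by (intro span_sum span_scale span_base)
    then show ?thesis using eq[of x] B(2) by simp
  qed
  have "orth_proj L (orth_proj L x) = orth_proj L x" for x
    by (rule orth_proj_eqI[OF assms mem]) (simp add: orthogonal_def)
  then show ?thesis using lin sym by (simp add: is_projector_def)
qed

lemma orth_proj_mem: "subspace L \<Longrightarrow> orth_proj L x \<in> L"
proof -
  assume L: "subspace L"
  obtain B where B: "orthonormal B" "span B = L"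
    using subspace_orthonormal_basis[OF L] by metis
  have "(\<Sum>b\<in>B. (x \<bullet> b) *\<^sub>R b) \<in> span B" by (intro span_sum span_scale span_base)
  then show ?thesis using orth_proj_eq_sum[OF B(1), of x] B(2) by simp
qed

lemma orth_proj_id: "subspace L \<Longrightarrow> x \<in> L \<Longrightarrow> orth_proj L x = x"
  by (rule orth_proj_eqI) (auto simp: orthogonal_def)

lemma orth_proj_zero_iff:
  assumes "subspace L" shows "orth_proj L x = 0 \<longleftrightarrow> (\<forall>y\<in>L. orthogonal y x)"
proof
  assume "orth_proj L x = 0"
  then show "\<forall>y\<in>L. orthogonal y x"
    using projector_sym[OF is_projector_orth_proj[OF assms], of _ x] orth_proj_id[OF assms]
    by (metis inner_zero_right orthogonal_def)
next
  assume "\<forall>y\<in>L. orthogonal y x"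
  then show "orth_proj L x = 0"
    by (intro orth_proj_eqI assms) (auto simp: subspace_0[OF assms] orthogonal_commute)
qed

lemma orth_proj_residual:
  assumes "subspace L" shows "x - orth_proj L x \<in> {x. \<forall>y\<in>L. orthogonal y x}"
proof -
  note P = is_projector_orth_proj[OF assms]
  have "orth_proj L (x - orth_proj L x) = 0"
    using projector_linear[OF P] projector_idem[OF P] by (simp add: linear_diff)
  then show ?thesis using orth_proj_zero_iff[OF assms] by simp
qed

lemma orthonormal_complement_Un:
  assumes B: "orthonormal B" and B': "orthonormal B'" "span B' = {x. \<forall>y\<in>span B. orthogonal y x}"
  shows "B \<inter> B' = {}" "orthonormal (B \<union> B')" "span (B \<union> B') = UNIV"
proof -
  have inner0: "b \<bullet> b' = 0" if "b \<in> B" "b' \<in> B'" for b b'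
    using that B' span_base[OF that(1)] span_base[OF that(2)] by (auto simp: orthogonal_def)
  have "b \<notin> B'" if "b \<in> B" for b
  proof
    assume "b \<in> B'"
    then have "b \<bullet> b = 0" using inner0 that by blast
    then show False using B that by (auto simp: orthonormal_def)
  qed
  then show "B \<inter> B' = {}" by blast
  show "orthonormal (B \<union> B')"
    using B B'(1) inner0 inner0[THEN trans[OF inner_commute]] unfolding orthonormal_def pairwise_def orthogonal_def
    by auto
  have "orth_proj (span B) x + (x - orth_proj (span B) x) \<in> span (B \<union> B')" for x
    using orth_proj_mem[OF subspace_span, of B x] orth_proj_residual[OF subspace_span, of x B] B'(2)
    by (intro span_add) (auto intro: span_mono[THEN subsetD, rotated])
  then show "span (B \<union> B') = UNIV" by auto
qed

lemma orthonormal_sum_norm_le: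
  assumes "orthonormal B" "\<And>b. b \<in> B \<Longrightarrow> \<bar>c b\<bar> \<le> \<rho> b"
  shows "norm (\<Sum>b\<in>B. c b *\<^sub>R b) \<le> (\<Sum>b\<in>B. \<rho> b)"
  using assms by (intro sum_norm_le) (simp add: orthonormal_def)

lemma subspace_parallel_space [simp]: "subspace (parallel_space K)"
  by (simp add: parallel_space_def)

section \<open>Coordinates along an orthonormal frame\<close>

definition frame_map :: "('a::euclidean_space \<Rightarrow> 'a) \<Rightarrow> 'a \<Rightarrow> 'a" where
  "frame_map \<beta> z = (\<Sum>e\<in>Basis. (z \<bullet> e) *\<^sub>R \<beta> e)"

locale orthonormal_frame =
  fixes B :: "'a::euclidean_space set" and \<beta> :: "'a \<Rightarrow> 'a"
  assumes ortho: "orthonormal B" and span_UNIV: "span B = UNIV" and bij: "bij_betw \<beta> Basis B"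
begin

lemma frame_map_linear: "linear (frame_map \<beta>)"
  unfolding frame_map_def
  by (intro linear_compose_sum ballI) (auto intro!: linearI simp: algebra_simps)

lemma frame_map_eq: "frame_map \<beta> z = (\<Sum>b\<in>B. (z \<bullet> inv_into Basis \<beta> b) *\<^sub>R b)"
  unfolding frame_map_def using bij
  by (subst sum.reindex_bij_betw[OF bij, symmetric]) (auto intro!: sum.cong simp: bij_betw_def inv_into_f_f)

lemma frame_map_inner: "e \<in> Basis \<Longrightarrow> frame_map \<beta> z \<bullet> \<beta> e = z \<bullet> e"
  using orthonormal_inner_sum[OF ortho subset_refl, of "\<beta> e" "\<lambda>b. z \<bullet> inv_into Basis \<beta> b"] bij
  by (auto simp: frame_map_eq bij_betw_def inv_into_f_f)

lemma frame_map_norm: "norm (frame_map \<beta> z) = norm z"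
proof -
  have "frame_map \<beta> z \<bullet> frame_map \<beta> z = (\<Sum>e\<in>Basis. (z \<bullet> e) * (frame_map \<beta> z \<bullet> \<beta> e))"
    by (subst (2) frame_map_def) (simp add: inner_sum_right)
  also have "\<dots> = z \<bullet> z"
    by (subst (2) euclidean_inner) (auto simp: frame_map_inner intro!: sum.cong)
  finally show ?thesis by (simp add: norm_eq_sqrt_inner)
qed

lemma frame_map_surj: "\<exists>z. frame_map \<beta> z = x"
proof -
  define z where "z = (\<Sum>e\<in>Basis. (x \<bullet> \<beta> e) *\<^sub>R e)"
  have "frame_map \<beta> z = (\<Sum>e\<in>Basis. (x \<bullet> \<beta> e) *\<^sub>R \<beta> e)"
    unfolding frame_map_def z_def by (intro sum.cong) simp_all
  also have "\<dots> = (\<Sum>b\<in>B. (x \<bullet> b) *\<^sub>R b)" by (rule sum.reindex_bij_betw[OF bij])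
  also have "\<dots> = x" using orthonormal_expand[OF ortho, of x] span_UNIV by simp
  finally show ?thesis by blast
qed

lemma frame_map_continuous: "continuous_on UNIV (frame_map \<beta>)"
  using frame_map_linear by (simp add: linear_continuous_on linear_conv_bounded_linear)

lemma frame_measurable [measurable]: "(\<lambda>z. q + frame_map \<beta> z) \<in> borel_measurable borel"
  by (intro borel_measurable_continuous_onI continuous_intros frame_map_continuous)

lemma frame_diff: "norm ((q + frame_map \<beta> z) - (q + frame_map \<beta> z')) = norm (z - z')"
  using frame_map_norm[of "z - z'"] frame_map_linear by (simp add: linear_diff)

lemma frame_preimage_bounded:
  assumes "bounded S" shows "bounded ((\<lambda>z. q + frame_map \<beta> z) -` S)"
proof -
  obtain r where r: "\<And>x. x \<in> S \<Longrightarrow> norm x \<le> r" using assms bounded_iff by metis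
  have "norm z \<le> r + norm q" if "q + frame_map \<beta> z \<in> S" for z
  proof -
    have "norm z = norm ((q + frame_map \<beta> z) - q)" by (simp add: frame_map_norm)
    also have "\<dots> \<le> norm (q + frame_map \<beta> z) + norm q" by (rule norm_triangle_ineq4)
    finally show ?thesis using r[OF that] by simp
  qed
  then show ?thesis by (auto simp: bounded_iff)
qed

text \<open>Rotation invariance of volume up to a factor: the frame map is an isometry, so the
  Lipschitz image bound applies with constant 1, and the factor is its covering loss. The reverse
  inequality applies the same bound to the inverse map.\<close>

lemma frame_measure_le:
  assumes S: "S \<in> sets borel" "bounded S"
  shows "emeasure lborel S \<le> ennreal ((2 * real DIM('a)) ^ DIM('a)) * emeasure lborel ((\<lambda>z. q + frame_map \<beta> z) -` S)"
proof -
  have "emeasure lborel S \<le> ennreal ((2 * 1 * real DIM('a)) ^ DIM('a)) * emeasure lborel ((\<lambda>z. q + frame_map \<beta> z) -` S)"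
  proof (rule lipschitz_image_emeasure_le[OF _ _ subset_refl])
    show "(\<lambda>z. q + frame_map \<beta> z) -` S \<in> sets borel" 
      using measurable_sets[OF frame_measurable[of q] S(1)] by simp
    show "bounded ((\<lambda>z. q + frame_map \<beta> z) -` S)" by (rule frame_preimage_bounded[OF S(2)])
    show "S \<subseteq> (\<lambda>z. q + frame_map \<beta> z) ` ((\<lambda>z. q + frame_map \<beta> z) -` S)"
    proof
      fix x assume x: "x \<in> S"
      obtain z where "frame_map \<beta> z = x - q" using frame_map_surj by blast
      then show "x \<in> (\<lambda>z. q + frame_map \<beta> z) ` ((\<lambda>z. q + frame_map \<beta> z) -` S)"
        using x by (intro image_eqI[of _ _ z]) auto
    qed
  qed (use S frame_diff in auto)
  then show ?thesis by simp
qed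

lemma frame_measure_ge:
  assumes S: "S \<in> sets borel" "bounded S"
  shows "emeasure lborel ((\<lambda>z. q + frame_map \<beta> z) -` S) \<le> ennreal ((2 * real DIM('a)) ^ DIM('a)) * emeasure lborel S"
proof -
  let ?f = "\<lambda>z. q + frame_map \<beta> z"
  define g where "g x = (SOME z. ?f z = x)" for x
  have fg: "?f (g x) = x" for x
  proof -
    obtain z where "frame_map \<beta> z = x - q" using frame_map_surj by blast
    then have "?f z = x" by simp
    then show ?thesis unfolding g_def by (rule someI)
  qed
  have inj: "?f z = ?f z' \<Longrightarrow> z = z'" for z z' using frame_diff[of q z z'] by simp
  have "emeasure lborel (?f -` S) \<le> ennreal ((2 * 1 * real DIM('a)) ^ DIM('a)) * emeasure lborel S"
  proof (rule lipschitz_image_emeasure_le[OF _ _ subset_refl])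
    show "?f -` S \<in> sets borel" 
      using measurable_sets[OF frame_measurable[of q] S(1)] by simp
    show "norm (g x - g y) \<le> 1 * norm (x - y)" for x y
      using frame_diff[of q "g x" "g y"] by (simp add: fg)
    show "?f -` S \<subseteq> g ` S" 
      using inj fg by (metis image_eqI subsetI vimageE)
  qed (use S in auto)
  then show ?thesis by simp
qed

text \<open>Coordinates are indexed by the frame itself, as in the definition of \<open>flat_lborel\<close>.\<close>

lemma distr_PiM_frame:
  "distr (\<Pi>\<^sub>M b\<in>B. (lborel :: real measure)) borel (\<lambda>f. \<Sum>e\<in>Basis. f (\<beta> e) *\<^sub>R e) = lborel"
proof (rule lborel_eqI[symmetric])
  interpret product_sigma_finite "\<lambda>b::'a. lborel :: real measure" ..
  have fin: "finite B" using ortho by (rule orthonormal_finite)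
  have \<beta>: "\<And>e. e \<in> Basis \<Longrightarrow> \<beta> e \<in> B" using bij by (auto simp: bij_betw_def)
  have meas: "(\<lambda>f. \<Sum>e\<in>Basis. f (\<beta> e) *\<^sub>R e) \<in> measurable (\<Pi>\<^sub>M b\<in>B. (lborel :: real measure)) borel"
    using \<beta> by (intro borel_measurable_sum borel_measurable_scaleR borel_measurable_const) 
       (auto intro!: measurable_component_singleton[where M="\<lambda>_. lborel", unfolded measurable_lborel2])
  fix l u :: 'a assume lu: "\<And>b. b \<in> Basis \<Longrightarrow> l \<bullet> b \<le> u \<bullet> b"
  let ?i = "inv_into Basis \<beta>"
  have i: "?i b \<in> Basis" "\<beta> (?i b) = b" if "b \<in> B" for b
    using bij that by (auto simp: bij_betw_def f_inv_into_f inv_into_into)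
  have i': "?i (\<beta> e) = e" if "e \<in> Basis" for e
    using bij that by (auto simp: bij_betw_def inv_into_f_f)
  have "(\<lambda>f. \<Sum>e\<in>Basis. f (\<beta> e) *\<^sub>R e) -` box l u \<inter> space (\<Pi>\<^sub>M b\<in>B. (lborel :: real measure))
     = (\<Pi>\<^sub>E b\<in>B. {l \<bullet> ?i b <..< u \<bullet> ?i b})"
  proof -
    have "(\<Sum>e\<in>Basis. f (\<beta> e) *\<^sub>R e) \<in> box l u \<longleftrightarrow> (\<forall>b\<in>B. f b \<in> {l \<bullet> ?i b <..< u \<bullet> ?i b})" for f :: "'a \<Rightarrow> real"
    proof -
      have "(\<Sum>e\<in>Basis. f (\<beta> e) *\<^sub>R e) \<in> box l u \<longleftrightarrow> (\<forall>e\<in>Basis. l \<bullet> e < f (\<beta> e) \<and> f (\<beta> e) < u \<bullet> e)"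
        by (simp add: mem_box)
      also have "\<dots> \<longleftrightarrow> (\<forall>b\<in>B. f b \<in> {l \<bullet> ?i b <..< u \<bullet> ?i b})"
        using i i' \<beta> by (metis greaterThanLessThan_iff)
      finally show ?thesis .
    qed
    then show ?thesis by (auto simp: space_PiM PiE_iff)
  qed
  then have "emeasure (distr (\<Pi>\<^sub>M b\<in>B. (lborel :: real measure)) borel (\<lambda>f. \<Sum>e\<in>Basis. f (\<beta> e) *\<^sub>R e)) (box l u)
     = (\<Prod>b\<in>B. emeasure lborel {l \<bullet> ?i b <..< u \<bullet> ?i b})"
    using fin meas by (simp add: emeasure_distr emeasure_PiM)
  also have "\<dots> = (\<Prod>b\<in>B. ennreal ((u - l) \<bullet> ?i b))"
    using lu i by (intro prod.cong) (auto simp: inner_diff_left)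
  also have "\<dots> = (\<Prod>e\<in>Basis. ennreal ((u - l) \<bullet> e))"
    by (subst prod.reindex_bij_betw[OF bij, symmetric]) (auto simp: i' intro!: prod.cong)
  also have "\<dots> = ennreal (\<Prod>e\<in>Basis. (u - l) \<bullet> e)"
    using lu by (intro prod_ennreal) (auto simp: inner_diff_left)
  finally show "emeasure (distr (\<Pi>\<^sub>M b\<in>B. (lborel :: real measure)) borel (\<lambda>f. \<Sum>e\<in>Basis. f (\<beta> e) *\<^sub>R e)) (box l u)
     = (\<Prod>e\<in>Basis. (u - l) \<bullet> e)" by simp
qed simp

text \<open>Serves boxes that are short in some frame directions and long in others, as needed in
  \<open>section_measure\<close>.\<close>

lemma frame_box_measure:
  assumes "\<And>b. b \<in> B \<Longrightarrow> 0 \<le> \<rho> b"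
  shows "ennreal (\<Prod>b\<in>B. 2 * \<rho> b) \<le> ennreal ((2 * real DIM('a)) ^ DIM('a)) * emeasure lborel {x. \<forall>b\<in>B. \<bar>(x - q) \<bullet> b\<bar> < \<rho> b}"
proof -
  let ?S = "{x. \<forall>b\<in>B. \<bar>(x - q) \<bullet> b\<bar> < \<rho> b}"
  have fin: "finite B" using ortho by (rule orthonormal_finite)
  have "?S = (\<Inter>b\<in>B. {x. \<bar>(x - q) \<bullet> b\<bar> < \<rho> b})" by auto
  moreover have "open (\<Inter>b\<in>B. {x. \<bar>(x - q) \<bullet> b\<bar> < \<rho> b})"
    using fin by (intro open_INT ballI open_Collect_less continuous_intros)
  ultimately have "open ?S" by simp
  then have S: "?S \<in> sets borel" by simp
  have "norm x \<le> (\<Sum>b\<in>B. \<rho> b) + norm q" if x: "x \<in> ?S" for x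
  proof -
    have "x - q = (\<Sum>b\<in>B. ((x - q) \<bullet> b) *\<^sub>R b)"
      using orthonormal_expand[OF ortho, of "x - q"] span_UNIV by simp
    also have "norm \<dots> \<le> (\<Sum>b\<in>B. \<rho> b)"
      using x by (intro orthonormal_sum_norm_le[OF ortho]) (auto simp: less_imp_le)
    finally show ?thesis using norm_triangle_sub[of x q] by linarith
  qed
  then have bd: "bounded ?S" by (meson bounded_iff)
  have "(\<lambda>z. q + frame_map \<beta> z) -` ?S = box (- (\<Sum>e\<in>Basis. \<rho> (\<beta> e) *\<^sub>R e)) (\<Sum>e\<in>Basis. \<rho> (\<beta> e) *\<^sub>R e)"
  proof -
    have "(\<forall>b\<in>B. \<bar>frame_map \<beta> z \<bullet> b\<bar> < \<rho> b) \<longleftrightarrow> (\<forall>e\<in>Basis. \<bar>z \<bullet> e\<bar> < \<rho> (\<beta> e))" for z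
      using bij frame_map_inner[of _ z] unfolding bij_betw_def by (metis (no_types, lifting) image_iff)
    then show ?thesis by (fastforce simp: mem_box abs_less_iff)
  qed
  moreover have "emeasure lborel (box (- (\<Sum>e\<in>Basis. \<rho> (\<beta> e) *\<^sub>R e)) (\<Sum>e\<in>Basis. \<rho> (\<beta> e) *\<^sub>R e))
     = ennreal (\<Prod>e\<in>Basis. 2 * \<rho> (\<beta> e))"
    using bij assms by (subst emeasure_lborel_box) (auto simp: inner_add_left bij_betw_def intro!: prod.cong)
  moreover have "(\<Prod>e\<in>Basis. 2 * \<rho> (\<beta> e)) = (\<Prod>b\<in>B. 2 * \<rho> b)" by (rule prod.reindex_bij_betw[OF bij])
  ultimately show ?thesis using frame_measure_ge[OF S bd, of q] by simp
qed

end

lemma orthonormal_frame_exists: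
  assumes "orthonormal B" "span B = UNIV"
  obtains \<beta> where "orthonormal_frame B \<beta>"
proof -
  have "card B = DIM('a)"
    using assms orthonormal_independent[OF assms(1)] by (metis dim_eq_card dim_UNIV span_UNIV)
  then obtain \<beta> :: "'a \<Rightarrow> 'a" where "bij_betw \<beta> Basis B"
    using finite_same_card_bij[OF finite_Basis orthonormal_finite[OF assms(1)]] by auto
  then show ?thesis using assms by (intro that[of \<beta>]) (auto simp: orthonormal_frame_def)
qed

section \<open>The surface measure on a flat piece\<close>

lemma flat_lborel_frame:
  fixes K :: "'a::euclidean_space set"
  assumes "K \<noteq> {}"
  obtains B a where "orthonormal B" "span B = parallel_space K" "a \<in> K"
    "flat_lborel K = distr (\<Pi>\<^sub>M b\<in>B. (lborel :: real measure)) borel (\<lambda>f. a + (\<Sum>b\<in>B. f b *\<^sub>R b))"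
proof -
  define B where "B = (SOME B. orthonormal_basis_of B (parallel_space K))"
  define a where "a = (SOME a. a \<in> K)"
  obtain B0 where "orthonormal B0" "span B0 = parallel_space K"
    by (rule subspace_orthonormal_basis[OF subspace_parallel_space])
  then have "orthonormal_basis_of B0 (parallel_space K)"
    using span_superset[of B0] by (auto simp: orthonormal_basis_of_def orthonormal_def)
  then have "orthonormal_basis_of B (parallel_space K)" unfolding B_def by (rule someI)
  moreover have "a \<in> K" unfolding a_def using assms by (simp add: some_in_eq)
  moreover have "flat_lborel K = distr (\<Pi>\<^sub>M b\<in>B. (lborel :: real measure)) borel (\<lambda>f. a + (\<Sum>b\<in>B. f b *\<^sub>R b))"
    by (simp only: flat_lborel_def Let_def B_def a_def)
  ultimately show ?thesis
    by (intro that[of B a]) (auto simp only: orthonormal_basis_of_def orthonormal_def)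
qed

lemma sets_flat_lborel [measurable_cong, simp]: "sets (flat_lborel K) = sets borel"
  by (simp add: flat_lborel_def Let_def)

lemma space_flat_lborel [simp]: "space (flat_lborel K) = UNIV"
  by (simp add: flat_lborel_def Let_def)

text \<open>Sets in a flat piece are compared with full-dimensional sets by thickening them in the normal
  directions, where \<open>B\<close> is an orthonormal basis of the normal space.\<close>

definition normal_box :: "'a::euclidean_space set \<Rightarrow> real \<Rightarrow> 'a set \<Rightarrow> 'a set" where
  "normal_box B \<rho> A = {x. \<exists>y\<in>A. x - y \<in> span B \<and> (\<forall>b\<in>B. \<bar>(x - y) \<bullet> b\<bar> < \<rho>)}"

lemma parallel_space_diff: "x \<in> K \<Longrightarrow> y \<in> K \<Longrightarrow> x - y \<in> parallel_space K"
  unfolding parallel_space_def by (rule span_base) auto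

text \<open>The witness \<open>y\<close> is unique: it is the orthogonal projection of
  \<open>x\<close> onto the plane through \<open>a\<close> parallel to \<open>K\<close>. With it the
  existential becomes a preimage under a continuous map, which yields measurability.\<close>

lemma normal_box_eq:
  fixes K :: "'a::euclidean_space set"
  assumes B: "span B = {x. \<forall>y\<in>parallel_space K. orthogonal y x}" and a: "a \<in> K" and A: "A \<subseteq> K"
  shows "normal_box B \<rho> A = {x. a + orth_proj (parallel_space K) (x - a) \<in> A \<and> (\<forall>b\<in>B. \<bar>(x - a) \<bullet> b\<bar> < \<rho>)}"
proof -
  let ?L = "parallel_space K"
  have inner: "b \<bullet> l = 0" if "b \<in> B" "l \<in> ?L" for b l
    using that B span_base[OF that(1)] by (auto simp: orthogonal_def inner_commute)
  have 1: "a + orth_proj ?L (x - a) = y" if "y \<in> A" "x - y \<in> span B" for x y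
  proof -
    have "orth_proj ?L (x - a) = y - a"
      using that A a B by (intro orth_proj_eqI) (auto simp: parallel_space_diff orthogonal_commute)
    then show ?thesis by simp
  qed
  have 2: "(x - a) \<bullet> b = (x - y) \<bullet> b" if "y \<in> A" "b \<in> B" for x y b
    using inner[OF that(2), of "y - a"] that A a parallel_space_diff[of y K a] 
    by (auto simp: inner_diff_left inner_diff_right inner_commute)
  have 3: "x - (a + orth_proj ?L (x - a)) \<in> span B" for x
    unfolding B using orth_proj_residual[of ?L "x - a"] by (simp add: algebra_simps)
  show ?thesis
  proof (intro set_eqI iffI)
    fix x assume "x \<in> normal_box B \<rho> A"
    then obtain y where y: "y \<in> A" "x - y \<in> span B" "\<forall>b\<in>B. \<bar>(x - y) \<bullet> b\<bar> < \<rho>"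
      by (auto simp: normal_box_def)
    then show "x \<in> {x. a + orth_proj ?L (x - a) \<in> A \<and> (\<forall>b\<in>B. \<bar>(x - a) \<bullet> b\<bar> < \<rho>)}"
      using 1[OF y(1,2)] 2[OF y(1)] by simp
  next
    fix x assume "x \<in> {x. a + orth_proj ?L (x - a) \<in> A \<and> (\<forall>b\<in>B. \<bar>(x - a) \<bullet> b\<bar> < \<rho>)}"
    then show "x \<in> normal_box B \<rho> A"
      unfolding normal_box_def using 2[of "a + orth_proj ?L (x - a)" _ x] 3[of x]
      by (intro CollectI bexI[of _ "a + orth_proj ?L (x - a)"]) auto
  qed
qed

text \<open>The half-width \<open>\<rho>\<close> is a free parameter: qualitative facts about the
  flat measure take it to be 1, comparisons with the tube tie it to the radius of the tube.\<close>

locale flat_piece =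
  fixes K B' :: "'a::euclidean_space set" and \<rho> :: real
  assumes bounded_K: "bounded K" and ortho': "orthonormal B'"
    and span_B': "span B' = {x. \<forall>y\<in>parallel_space K. orthogonal y x}" and \<rho>_pos: "0 < \<rho>"
begin

text \<open>In coordinates along a frame that extends a basis of \<open>parallel_space K\<close> by
  \<open>B'\<close>, the thickened set is a product, so its volume is exactly the flat measure times
  \<open>(2 * \<rho>) ^ card B'\<close>. Only the passage between these coordinates and the ambient
  space costs \<open>(2 * DIM('a)) ^ DIM('a)\<close>, in either direction.\<close>

lemma
  assumes A: "A \<in> sets borel" "A \<subseteq> K"
  shows normal_box_borel: "normal_box B' \<rho> A \<in> sets borel" (is ?t1)
    and normal_box_bounded: "bounded (normal_box B' \<rho> A)" (is ?t2)
    and flat_lborel_le_normal_box: 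
      "emeasure (flat_lborel K) A * ennreal ((2 * \<rho>) ^ card B') \<le> ennreal ((2 * real DIM('a)) ^ DIM('a)) * emeasure lborel (normal_box B' \<rho> A)" (is ?t3)
    and normal_box_le_flat_lborel: 
      "emeasure lborel (normal_box B' \<rho> A) \<le> ennreal ((2 * real DIM('a)) ^ DIM('a)) * (emeasure (flat_lborel K) A * ennreal ((2 * \<rho>) ^ card B'))" (is ?t4)
proof -
  have "?t1 \<and> ?t2 \<and> ?t3 \<and> ?t4" if "K = {}"
    using that A by (simp add: normal_box_def)
  moreover have "?t1 \<and> ?t2 \<and> ?t3 \<and> ?t4" if K: "K \<noteq> {}"
  proof -
    obtain B a where B: "orthonormal B" "span B = parallel_space K" and a: "a \<in> K"
      and fl: "flat_lborel K = distr (\<Pi>\<^sub>M b\<in>B. (lborel :: real measure)) borel (\<lambda>f. a + (\<Sum>b\<in>B. f b *\<^sub>R b))"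
      by (rule flat_lborel_frame[OF K])
    let ?L = "parallel_space K"
    have fin: "finite B" "finite B'" using B ortho' orthonormal_finite by auto
    note BB = orthonormal_complement_Un[OF B(1) ortho' span_B'[folded B(2)]]
    note disj = BB(1) and oBB = BB(2)
    obtain \<beta> where "orthonormal_frame (B \<union> B') \<beta>"
      using orthonormal_frame_exists[OF oBB BB(3)] by blast
    then interpret F: orthonormal_frame "B \<union> B'" \<beta> .
    have PL: "orth_proj ?L x = (\<Sum>b\<in>B. (x \<bullet> b) *\<^sub>R b)" for x
      using orth_proj_eq_sum[OF B(1), of x] B(2) by simp
    let ?N = "normal_box B' \<rho> A"
    have N: "?N = {x. a + orth_proj ?L (x - a) \<in> A \<and> (\<forall>b\<in>B'. \<bar>(x - a) \<bullet> b\<bar> < \<rho>)}"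
      by (rule normal_box_eq[OF span_B' a A(2)])
    have contP: "continuous_on UNIV (\<lambda>x. a + orth_proj ?L (x - a))"
      unfolding PL by (intro continuous_intros)
    have meas_N: "?N \<in> sets borel"
    proof -
      have "(\<lambda>x. a + orth_proj ?L (x - a)) -` A \<in> sets borel"
        using measurable_sets[OF borel_measurable_continuous_onI[OF contP] A(1)] by simp
      moreover have "(\<Inter>b\<in>B'. {x. \<bar>(x - a) \<bullet> b\<bar> < \<rho>}) \<in> sets borel"
        using fin by (intro borel_open open_INT ballI open_Collect_less continuous_intros)
      moreover have "?N = (\<lambda>x. a + orth_proj ?L (x - a)) -` A \<inter> (\<Inter>b\<in>B'. {x. \<bar>(x - a) \<bullet> b\<bar> < \<rho>})"
        unfolding N by auto
      ultimately show ?thesis by simp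
    qed
    obtain r where r: "\<And>x. x \<in> K \<Longrightarrow> norm x \<le> r" using bounded_K bounded_iff by metis
    have "norm x \<le> r + (\<Sum>b\<in>B'. \<rho>)" if "x \<in> ?N" for x
    proof -
      obtain y where y: "y \<in> A" "x - y \<in> span B'" "\<forall>b\<in>B'. \<bar>(x - y) \<bullet> b\<bar> < \<rho>"
        using \<open>x \<in> ?N\<close> by (auto simp: normal_box_def)
      have "norm (x - y) = norm (\<Sum>b\<in>B'. ((x - y) \<bullet> b) *\<^sub>R b)"
        using orthonormal_expand[OF ortho' y(2)] by simp
      also have "\<dots> \<le> (\<Sum>b\<in>B'. \<rho>)"
        using y(3) by (intro orthonormal_sum_norm_le[OF ortho']) (auto simp: less_imp_le)
      finally show ?thesis using r[of y] y(1) A(2) norm_triangle_sub[of x y] by force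
    qed
    then have bd_N: "bounded ?N" by (meson bounded_iff)
    let ?Z = "(\<lambda>z. a + frame_map \<beta> z) -` ?N"
    have "emeasure lborel ?Z = emeasure (flat_lborel K) A * ennreal ((2 * \<rho>) ^ card B')"
    proof -
      interpret product_sigma_finite "\<lambda>b::'a. lborel :: real measure" ..
      let ?g = "\<lambda>f::'a \<Rightarrow> real. \<Sum>e\<in>Basis. f (\<beta> e) *\<^sub>R e"
      let ?M = "\<lambda>B. \<Pi>\<^sub>M b\<in>(B::'a set). (lborel :: real measure)"
      have g: "?g \<in> measurable (?M (B \<union> B')) borel"
      proof -
        have "\<beta> e \<in> B \<union> B'" if "e \<in> Basis" for e using F.bij that by (auto simp: bij_betw_def)
        then show ?thesis
          by (intro borel_measurable_sum borel_measurable_scaleR borel_measurable_const) 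
            (auto intro!: measurable_component_singleton[where M="\<lambda>_. lborel", unfolded measurable_lborel2])
      qed
      have Zm: "?Z \<in> sets borel" using measurable_sets[OF F.frame_measurable meas_N] by simp
      define S where "S = {f \<in> space (?M (B \<union> B')). a + (\<Sum>b\<in>B. f b *\<^sub>R b) \<in> A \<and> (\<forall>b\<in>B'. \<bar>f b\<bar> < \<rho>)}"
      have fg: "frame_map \<beta> (?g f) = (\<Sum>b\<in>B \<union> B'. f b *\<^sub>R b)" for f
      proof -
        have "frame_map \<beta> (?g f) = (\<Sum>e\<in>Basis. f (\<beta> e) *\<^sub>R \<beta> e)"
          unfolding frame_map_def by (intro sum.cong) simp_all
        also have "\<dots> = (\<Sum>b\<in>B \<union> B'. f b *\<^sub>R b)" by (rule sum.reindex_bij_betw[OF F.bij])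
        finally show ?thesis .
      qed
      have fgb: "frame_map \<beta> (?g f) \<bullet> b = f b" if "b \<in> B \<union> B'" for f b
        unfolding fg using orthonormal_inner_sum[OF oBB subset_refl that] that by simp
      have "?g -` ?Z \<inter> space (?M (B \<union> B')) = S"
        unfolding N S_def PL using fgb by auto
      then have "emeasure lborel ?Z = emeasure (?M (B \<union> B')) S"
        using emeasure_distr[OF g Zm] F.distr_PiM_frame by simp
      also have "\<dots> = emeasure (distr (?M B \<Otimes>\<^sub>M ?M B') (?M (B \<union> B')) (merge B B')) S"
        using distr_merge[OF disj fin] by simp
      also have "\<dots> = emeasure (?M B \<Otimes>\<^sub>M ?M B') (merge B B' -` S \<inter> space (?M B \<Otimes>\<^sub>M ?M B'))"
      proof (rule emeasure_distr)
        show "S \<in> sets (?M (B \<union> B'))"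
          using measurable_sets[OF g Zm] \<open>?g -` ?Z \<inter> space (?M (B \<union> B')) = S\<close> by simp
      qed simp
      \<comment> \<open>The set splits because its first condition reads only the coordinates in
        \<open>B\<close> and its second only those in \<open>B'\<close>.\<close>
      also have "merge B B' -` S \<inter> space (?M B \<Otimes>\<^sub>M ?M B')
          = ((\<lambda>f. a + (\<Sum>b\<in>B. f b *\<^sub>R b)) -` A \<inter> space (?M B)) \<times> (\<Pi>\<^sub>E b\<in>B'. {-\<rho><..<\<rho>})" (is "?l = ?r")
      proof (rule set_eqI)
        fix p :: "('a \<Rightarrow> real) \<times> ('a \<Rightarrow> real)"
        obtain f f' where p: "p = (f, f')" by force
        have "(\<Sum>b\<in>B. merge B B' (f, f') b *\<^sub>R b) = (\<Sum>b\<in>B. f b *\<^sub>R b)"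
          by (intro sum.cong) (auto simp: merge_def)
        moreover have "(\<forall>b\<in>B'. \<bar>merge B B' (f, f') b\<bar> < \<rho>) \<longleftrightarrow> (\<forall>b\<in>B'. \<bar>f' b\<bar> < \<rho>)"
          using disj by (auto simp: merge_def)
        moreover have "(\<forall>b\<in>B'. f' b \<in> {-\<rho><..<\<rho>}) \<longleftrightarrow> (\<forall>b\<in>B'. \<bar>f' b\<bar> < \<rho>)"
          by (intro ball_cong) auto
        ultimately show "p \<in> ?l \<longleftrightarrow> p \<in> ?r"
          unfolding p S_def by (auto simp: space_pair_measure space_PiM PiE_iff simp del: greaterThanLessThan_iff abs_less_iff)
      qed
      also have "emeasure (?M B \<Otimes>\<^sub>M ?M B') \<dots>
          = emeasure (?M B) ((\<lambda>f. a + (\<Sum>b\<in>B. f b *\<^sub>R b)) -` A \<inter> space (?M B)) * emeasure (?M B') (\<Pi>\<^sub>E b\<in>B'. {-\<rho><..<\<rho>})"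
      proof -
        interpret B'f: finite_product_sigma_finite "\<lambda>b::'a. lborel :: real measure" B' by standard (rule fin)
        have "(\<lambda>f. a + (\<Sum>b\<in>B. f b *\<^sub>R b)) \<in> measurable (?M B) borel"
          by (intro borel_measurable_add borel_measurable_sum borel_measurable_scaleR borel_measurable_const) 
            (auto intro!: measurable_component_singleton[where M="\<lambda>_. lborel", unfolded measurable_lborel2])
        then have "(\<lambda>f. a + (\<Sum>b\<in>B. f b *\<^sub>R b)) -` A \<inter> space (?M B) \<in> sets (?M B)"
          using A(1) by (rule measurable_sets)
        moreover have "(\<Pi>\<^sub>E b\<in>B'. {-\<rho><..<\<rho>}) \<in> sets (?M B')"
          using fin by (intro sets_PiM_I_finite) auto
        ultimately show ?thesis by (rule B'f.emeasure_pair_measure_Times)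
      qed
      also have "emeasure (?M B) ((\<lambda>f. a + (\<Sum>b\<in>B. f b *\<^sub>R b)) -` A \<inter> space (?M B)) = emeasure (flat_lborel K) A"
        unfolding fl 
        by (intro emeasure_distr[symmetric] borel_measurable_add borel_measurable_sum borel_measurable_scaleR borel_measurable_const A) 
          (auto intro!: measurable_component_singleton[where M="\<lambda>_. lborel", unfolded measurable_lborel2])
      also have "emeasure (?M B') (\<Pi>\<^sub>E b\<in>B'. {-\<rho><..<\<rho>}) = ennreal ((2 * \<rho>) ^ card B')"
        using fin \<rho>_pos by (subst emeasure_PiM) (auto simp: ennreal_power)
      finally show ?thesis .
    qed
    then show ?thesis
      using meas_N bd_N F.frame_measure_le[OF meas_N bd_N, of a] F.frame_measure_ge[OF meas_N bd_N, of a]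
      by simp
  qed
  ultimately have "?t1 \<and> ?t2 \<and> ?t3 \<and> ?t4" by blast
  then show ?t1 ?t2 ?t3 ?t4 by blast+
qed

lemma flat_lborel_finite: "A \<in> sets borel \<Longrightarrow> A \<subseteq> K \<Longrightarrow> emeasure (flat_lborel K) A < \<infinity>"
proof -
  assume A: "A \<in> sets borel" "A \<subseteq> K"
  have "emeasure (flat_lborel K) A * ennreal ((2 * \<rho>) ^ card B') < \<infinity>"
    by (rule le_less_trans[OF flat_lborel_le_normal_box[OF A]])
      (use emeasure_bounded_finite[OF normal_box_bounded[OF A]] in \<open>simp add: ennreal_mult_less_top\<close>)
  moreover have "0 < ennreal ((2 * \<rho>) ^ card B')" using \<rho>_pos by simp
  ultimately show ?thesis
    by (metis ennreal_mult_eq_top_iff infinity_ennreal_def less_top not_gr_zero)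
qed

text \<open>Thickening takes place orthogonally to \<open>parallel_space K\<close>, hence
  orthogonally to \<open>u\<close>, so the thickened set stays in the hyperplane and has volume
  zero.\<close>

lemma flat_lborel_hyperplane_null:
  assumes A: "A \<in> sets borel" "A \<subseteq> K" and u: "u \<in> parallel_space K" "u \<noteq> 0" "A \<subseteq> {x. u \<bullet> x = t}"
  shows "emeasure (flat_lborel K) A = 0"
proof -
  have "normal_box B' \<rho> A \<subseteq> {x. u \<bullet> x = t}"
  proof
    fix x assume "x \<in> normal_box B' \<rho> A"
    then obtain y where y: "y \<in> A" "x - y \<in> span B'" by (auto simp: normal_box_def)
    then have "u \<bullet> (x - y) = 0" using u span_B' by (auto simp: orthogonal_def)
    then show "x \<in> {x. u \<bullet> x = t}" using y u by (auto simp: inner_diff_right)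
  qed
  moreover have "negligible {x. u \<bullet> x = t}" using u by (intro negligible_hyperplane) auto
  ultimately have "negligible (normal_box B' \<rho> A)" by (rule negligible_subset[rotated])
  then have "emeasure lborel (normal_box B' \<rho> A) = 0"
    using normal_box_borel[OF A] by (auto simp: negligible_iff_null_sets null_sets_def)
  then have "emeasure (flat_lborel K) A * ennreal ((2 * \<rho>) ^ card B') = 0"
    using flat_lborel_le_normal_box[OF A] by simp
  then show ?thesis using \<rho>_pos by simp
qed

text \<open>The point \<open>y\<close> may lie on the relative boundary of \<open>K\<close>. A
  nearby point \<open>z\<close> of the relative interior has a full ambient ball inside the
  thickened set, and the positive volume of that ball carries over to the flat measure.\<close>

lemma flat_lborel_ball_pos:
  assumes K: "convex K" "closed K" and y: "y \<in> K" and e: "0 < e"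
  shows "0 < emeasure (flat_lborel K) (K \<inter> ball y e)"
proof -
  let ?L = "parallel_space K"
  note P = is_projector_orth_proj[of ?L, simplified]
  let ?A = "K \<inter> ball y e"
  have A: "?A \<in> sets borel" "?A \<subseteq> K" using K by auto
  have "y \<in> closure (rel_interior K)"
    using y K convex_closure_rel_interior closure_subset by blast
  then obtain z where z: "z \<in> rel_interior K" "dist z y < e"
    using e closure_approachable by blast
  then obtain e' where e': "0 < e'" "ball z e' \<inter> affine hull K \<subseteq> K" and zK: "z \<in> K"
    using mem_rel_interior_ball by blast
  \<comment> \<open>The three bounds keep the foot of a point of the ball inside \<open>K\<close>,
    its normal offset below \<open>\<rho>\<close>, and the foot within \<open>e\<close> of
    \<open>y\<close>.\<close>
  define s where "s = min (min e' \<rho>) (e - dist z y)"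
  have s: "0 < s" "s \<le> e'" "s \<le> \<rho>" "s \<le> e - dist z y" using e' \<rho>_pos z by (auto simp: s_def)
  have sub: "ball z s \<subseteq> normal_box B' \<rho> ?A"
  proof
    fix x assume x: "x \<in> ball z s"
    let ?y = "z + orth_proj ?L (x - z)"
    have nle: "norm (orth_proj ?L (x - z)) \<le> norm (x - z)" by (rule projector_norm_le[OF P])
    have "?L \<subseteq> span ((\<lambda>x. x - z) ` (K - {z}))"
      unfolding parallel_space_def
    proof (rule span_minimal)
      show "{x - y |x y. x \<in> K \<and> y \<in> K} \<subseteq> span ((\<lambda>x. x - z) ` (K - {z}))"
      proof clarify
        fix x y assume xy: "x \<in> K" "y \<in> K"
        have *: "x - z \<in> span ((\<lambda>x. x - z) ` (K - {z}))" if "x \<in> K" for x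
          using that by (cases "x = z") (auto simp: span_zero intro: span_base)
        have "x - y = (x - z) - (y - z)" by simp
        then show "x - y \<in> span ((\<lambda>x. x - z) ` (K - {z}))" using xy * by (metis span_diff)
      qed
    qed simp
    then have "?y \<in> affine hull K"
      unfolding affine_hull_span[OF zK] Setcompr_eq_image using orth_proj_mem[OF subspace_parallel_space, of K "x - z"] by blast
    moreover have "dist z ?y < s" using nle x by (simp add: dist_norm norm_minus_commute)
    ultimately have "?y \<in> K" using e' s by (auto intro!: subsetD[OF e'(2)])
    moreover have "dist y ?y < e" using \<open>dist z ?y < s\<close> s dist_triangle[of y ?y z] by (simp add: dist_commute)
    ultimately have "?y \<in> ?A" by simp
    moreover have "x - ?y \<in> span B'"
      unfolding span_B' using orth_proj_residual[of ?L "x - z"] by (simp add: algebra_simps)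
    moreover have "\<bar>(x - ?y) \<bullet> b\<bar> < \<rho>" if "b \<in> B'" for b
    proof -
      have "\<bar>(x - ?y) \<bullet> b\<bar> \<le> norm (x - ?y) * norm b" by (rule Cauchy_Schwarz_ineq2)
      also have "\<dots> = norm ((x - z) - orth_proj ?L (x - z))" using ortho' that by (simp add: orthonormal_def algebra_simps)
      also have "\<dots> \<le> norm (x - z)" by (rule projector_norm_le[OF P])
      also have "\<dots> < \<rho>" using x s by (simp add: dist_norm norm_minus_commute)
      finally show ?thesis .
    qed
    ultimately show "x \<in> normal_box B' \<rho> ?A" unfolding normal_box_def by blast
  qed
  have "0 < emeasure lborel (ball z s)"
    using content_ball_pos[OF s(1), of z] by (auto simp: measure_def intro: gr_zeroI)
  also have "\<dots> \<le> emeasure lborel (normal_box B' \<rho> ?A)"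
    using sub normal_box_borel[OF A] by (intro emeasure_mono) auto
  also note normal_box_le_flat_lborel[OF A]
  finally show ?thesis by (auto simp: zero_less_iff_neq_zero)
qed

text \<open>Every nonempty relatively open part of \<open>K\<close> has positive measure, so a
  closed condition that holds almost everywhere cannot fail anywhere. This turns the
  \<open>L\<^sup>\<infinity>\<close> assumptions on the surface into bounds at every point.\<close>

lemma flat_lborel_AE_closed:
  assumes K: "convex K" "closed K" and Q: "closed {x\<in>K. Q x}" and ae: "AE x\<in>K in flat_lborel K. Q x" and y: "y \<in> K"
  shows "Q y"
proof (rule ccontr)
  assume "\<not> Q y"
  then have "y \<in> - {x\<in>K. Q x}" by simp
  moreover have "open (- {x\<in>K. Q x})" by (rule open_Compl[OF Q])
  ultimately obtain e where e: "0 < e" "ball y e \<subseteq> - {x\<in>K. Q x}" using openE by metis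
  obtain N where N: "{x \<in> space (flat_lborel K). \<not> (x \<in> K \<longrightarrow> Q x)} \<subseteq> N" "emeasure (flat_lborel K) N = 0" "N \<in> sets (flat_lborel K)"
    using ae by (rule AE_E)
  have "emeasure (flat_lborel K) (K \<inter> ball y e) \<le> emeasure (flat_lborel K) N"
    using N e by (intro emeasure_mono) auto
  then show False using flat_lborel_ball_pos[OF K y e(1)] N(2) by simp
qed

end


lemma dim_parallel_space:
  assumes "K \<noteq> {}" shows "int (dim (parallel_space K)) = aff_dim K"
proof -
  obtain a where a: "a \<in> K" using assms by blast
  have "span ((+) (-a) ` K) = parallel_space K"
  proof
    show "span ((+) (-a) ` K) \<subseteq> parallel_space K"
      using parallel_space_diff[of _ K a] a by (intro span_minimal) auto
    show "parallel_space K \<subseteq> span ((+) (-a) ` K)"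
      unfolding parallel_space_def
    proof (rule span_minimal)
      show "{x - y |x y. x \<in> K \<and> y \<in> K} \<subseteq> span ((+) (-a) ` K)"
      proof clarify
        fix x y assume xy: "x \<in> K" "y \<in> K"
        have "x - y = (-a + x) - (-a + y)" by simp
        then show "x - y \<in> span ((+) (-a) ` K)" using xy by (metis span_diff span_base imageI)
      qed
    qed simp
  qed
  then show ?thesis using aff_dim_eq_dim[of a K] a by (metis dim_span hull_inc)
qed

text \<open>A set of smaller affine dimension misses some direction of \<open>K\<close>; a vector of
  \<open>parallel_space K\<close> orthogonal to all directions of \<open>F\<close> is the normal
  \<open>u\<close>. Applied to common faces of two simplices.\<close>

lemma lower_dim_in_hyperplane:
  fixes K F :: "'a::euclidean_space set"
  assumes "F \<subseteq> K" "F \<noteq> {}" "aff_dim F < aff_dim K"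
  obtains u t where "u \<in> parallel_space K" "u \<noteq> 0" "F \<subseteq> {x. u \<bullet> x = t}"
proof -
  have "parallel_space F \<subseteq> parallel_space K"
    unfolding parallel_space_def using assms by (intro span_mono) auto
  moreover have "parallel_space F \<noteq> parallel_space K"
    using dim_parallel_space[of F] dim_parallel_space[of K] assms by (metis less_irrefl subset_empty)
  ultimately have "span (parallel_space F) \<subset> span (parallel_space K)"
    by (metis psubsetI span_eq_iff subspace_parallel_space)
  then obtain u where u: "u \<noteq> 0" "u \<in> span (parallel_space K)" "\<And>y. y \<in> span (parallel_space F) \<Longrightarrow> orthogonal u y"
    using orthogonal_to_subspace_exists_gen by blast
  obtain f where f: "f \<in> F" using assms by blast
  have "u \<bullet> x = u \<bullet> f" if "x \<in> F" for x
    using u(3)[of "x - f"] parallel_space_diff[OF that f] span_base[of "x - f" "parallel_space F"] 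
    by (simp add: orthogonal_def inner_diff_right)
  then show ?thesis using u by (intro that[of u "u \<bullet> f"]) (auto simp: span_eq_iff[THEN iffD2])
qed

section \<open>The closest point projection\<close>

lemma frechet_derivative_cong_open:
  assumes "open S" "x \<in> S" "\<And>y. y \<in> S \<Longrightarrow> f y = g y"
  shows "frechet_derivative f (at x) = frechet_derivative g (at x)"
proof -
  have "(f has_derivative f') (at x) \<longleftrightarrow> (g has_derivative f') (at x)" for f'
    using has_derivative_transform_within_open[OF _ assms(1,2)] assms(3) by metis
  then show ?thesis by (simp add: frechet_derivative_def)
qed

lemma differentiable_cong_open:
  assumes "open S" "x \<in> S" "\<And>y. y \<in> S \<Longrightarrow> f y = g y" "f differentiable (at x)"
  shows "g differentiable (at x)"
  using assms has_derivative_transform_within_open[OF _ assms(1,2)] unfolding differentiable_def by metis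

lemma Ck_on_cong:
  assumes "open S" "\<And>x. x \<in> S \<Longrightarrow> f x = g x" "Ck_on n S f"
  shows "Ck_on n S g"
  using assms(2,3)
proof (induction n arbitrary: f g)
  case 0
  then show ?case using continuous_on_cong[of S S f g] by simp
next
  case (Suc n)
  have "g differentiable (at x)" if "x \<in> S" for x
    using differentiable_cong_open[OF assms(1) that Suc.prems(1)] Suc.prems(2) that by simp
  moreover have "Ck_on n S (\<lambda>x. frechet_derivative g (at x) w)" for w
  proof (rule Suc.IH)
    show "frechet_derivative f (at x) w = frechet_derivative g (at x) w" if "x \<in> S" for x
      using frechet_derivative_cong_open[OF assms(1) that Suc.prems(1)] by simp
  qed (use Suc.prems in simp)
  ultimately show ?case by simp
qed

text \<open>Provides the smooth curve \<open>p (q + t *\<^sub>R u)\<close> that realises a tangent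
  vector in the definition of \<open>tangent_space\<close>.\<close>

lemma Ck_on_line:
  fixes f :: "'a::real_normed_vector \<Rightarrow> 'b::real_normed_vector" and I :: "real set"
  assumes I: "open I" "\<And>t. t \<in> I \<Longrightarrow> q + t *\<^sub>R u \<in> S" and f: "Ck_on n S f"
  shows "Ck_on n I (\<lambda>t. f (q + t *\<^sub>R u))"
  using f
proof (induction n arbitrary: f)
  case 0
  then show ?case using I by (auto intro!: continuous_on_compose2[of S f] continuous_intros)
next
  case (Suc n)
  have der: "((\<lambda>t. f (q + t *\<^sub>R u)) has_derivative (\<lambda>s. frechet_derivative f (at (q + t *\<^sub>R u)) (s *\<^sub>R u))) (at t)"
    if "t \<in> I" for t
  proof -
    have "(f has_derivative frechet_derivative f (at (q + t *\<^sub>R u))) (at (q + t *\<^sub>R u))"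
      using Suc.prems I(2)[OF that] frechet_derivative_works by auto
    moreover have "((\<lambda>t. q + t *\<^sub>R u) has_derivative (\<lambda>s. s *\<^sub>R u)) (at t)"
      by (auto intro!: derivative_eq_intros)
    ultimately show ?thesis using has_derivative_compose[of "\<lambda>t. q + t *\<^sub>R u"] by blast
  qed
  have "Ck_on n I (\<lambda>t. frechet_derivative (\<lambda>t. f (q + t *\<^sub>R u)) (at t) s)" for s
  proof (rule Ck_on_cong[OF I(1)])
    show "Ck_on n I (\<lambda>t. frechet_derivative f (at (q + t *\<^sub>R u)) (s *\<^sub>R u))"
      using Suc.IH[of "\<lambda>x. frechet_derivative f (at x) (s *\<^sub>R u)"] Suc.prems by simp
    show "frechet_derivative f (at (q + t *\<^sub>R u)) (s *\<^sub>R u) = frechet_derivative (\<lambda>t. f (q + t *\<^sub>R u)) (at t) s"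
      if "t \<in> I" for t using frechet_derivative_at[OF der[OF that]] by metis
  qed
  moreover have "(\<lambda>t. f (q + t *\<^sub>R u)) differentiable (at t)" if "t \<in> I" for t
    using der[OF that] by (auto simp: differentiable_def)
  ultimately show ?case by simp
qed

lemma open_tube: "open (tube M \<delta>)"
  unfolding tube_def by (intro open_Collect_less continuous_intros)

lemma linear_norm_le_sum_Basis:
  fixes f :: "'a::euclidean_space \<Rightarrow> 'b::real_normed_vector"
  assumes "linear f" shows "norm (f w) \<le> (\<Sum>b\<in>Basis. norm (f b)) * norm w"
proof -
  have "f w = f (\<Sum>b\<in>Basis. (w \<bullet> b) *\<^sub>R b)" by (simp add: euclidean_representation)
  also have "\<dots> = (\<Sum>b\<in>Basis. (w \<bullet> b) *\<^sub>R f b)" using assms by (simp add: linear_sum linear_cmul)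
  also have "norm \<dots> \<le> (\<Sum>b\<in>Basis. norm ((w \<bullet> b) *\<^sub>R f b))" by (rule norm_sum)
  also have "\<dots> \<le> (\<Sum>b\<in>Basis. norm (f b) * norm w)"
    by (intro sum_mono) (auto simp: mult.commute[of _ "norm (f _)"] intro!: mult_left_mono Basis_le_norm)
  finally show ?thesis by (simp add: sum_distrib_right)
qed

text \<open>For \<open>q \<in> \<Gamma>\<close>, the map \<open>D q\<close> is the orthogonal projection onto the tangent space at \<open>q\<close>; the last
  assumption says that the normal fibres of length \<open>r\<close> are fibres of \<open>p\<close>.\<close>

locale tubular =
  fixes \<Gamma> :: "'a::euclidean_space set" and p :: "'a \<Rightarrow> 'a" and D :: "'a \<Rightarrow> 'a \<Rightarrow> 'a" and r \<Lambda> :: real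
  assumes r_pos: "0 < r" and \<Lambda>_ge1: "1 \<le> \<Lambda>"
    and compact_\<Gamma>: "compact \<Gamma>" and connected_\<Gamma>: "connected \<Gamma>" and nonempty_\<Gamma>: "\<Gamma> \<noteq> {}"
    and p_mem: "p x \<in> \<Gamma>"
    and p_id: "q \<in> \<Gamma> \<Longrightarrow> p q = q"
    and p_dist: "norm (x - p x) = infdist x \<Gamma>"
    and p_lip: "x \<in> tube \<Gamma> r \<Longrightarrow> y \<in> tube \<Gamma> r \<Longrightarrow> norm (p x - p y) \<le> \<Lambda> * norm (x - y)"
    and p_deriv: "x \<in> tube \<Gamma> r \<Longrightarrow> (p has_derivative D x) (at x)"
    and D_near: "x \<in> tube \<Gamma> r \<Longrightarrow> norm (D x u - D (p x) u) \<le> \<Lambda> * norm (x - p x) * norm u"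
    and D_lip: "q \<in> \<Gamma> \<Longrightarrow> q' \<in> \<Gamma> \<Longrightarrow> norm (D q u - D q' u) \<le> \<Lambda> * norm (q - q') * norm u"
    and D_proj: "q \<in> \<Gamma> \<Longrightarrow> is_projector (D q)"
    and D_normal: "x \<in> tube \<Gamma> r \<Longrightarrow> D (p x) (x - p x) = 0"
    and fibre: "q \<in> \<Gamma> \<Longrightarrow> D q n = 0 \<Longrightarrow> norm n < r \<Longrightarrow> p (q + n) = q"

text \<open>Two derivatives of the projection, bounded on a compact neighbourhood, supply all the
  constants. The projector property stems from minimality of the distance: its first-order
  condition, differentiated once more at points of \<open>\<Gamma>\<close>, makes the derivative
  there symmetric and idempotent. Straight fibres follow from the second-order tangency of
  chords.\<close>

lemma tubular_exists:
  fixes \<Gamma> :: "'a::euclidean_space set"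
  assumes cG: "compact \<Gamma>" "connected \<Gamma>" "\<Gamma> \<noteq> {}" and d0: "0 < \<delta>\<^sub>0" "smooth_closest_point_on_tube \<Gamma> \<delta>\<^sub>0"
  obtains r \<Lambda> where "tubular \<Gamma> (closest_point \<Gamma>) (\<lambda>x. frechet_derivative (closest_point \<Gamma>) (at x)) r \<Lambda>"
    "\<And>q. q \<in> \<Gamma> \<Longrightarrow> orth_proj (tangent_space \<Gamma> q) = frechet_derivative (closest_point \<Gamma>) (at q)"
proof -
  define p where "p = closest_point \<Gamma>"
  define D where "D x = frechet_derivative p (at x)" for x
  let ?S = "tube \<Gamma> \<delta>\<^sub>0"
  have clG: "closed \<Gamma>" using cG compact_imp_closed by blast
  have pmem: "p x \<in> \<Gamma>" for x unfolding p_def using closest_point_in_set clG cG by blast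
  have pid: "p q = q" if "q \<in> \<Gamma>" for q unfolding p_def using closest_point_self that by blast
  have pmin: "dist x (p x) \<le> dist x y" if "y \<in> \<Gamma>" for x y unfolding p_def using closest_point_le clG that by blast
  have pdist: "norm (x - p x) = infdist x \<Gamma>" for x
  proof -
    obtain y where "y \<in> \<Gamma>" "infdist x \<Gamma> = dist x y" using infdist_attains_inf[OF clG cG(3)] by blast
    then show ?thesis using pmin[of y x] infdist_le[OF pmem, of x x] by (simp add: dist_norm)
  qed
  have GS: "q \<in> ?S" if "q \<in> \<Gamma>" for q using that d0 by (simp add: tube_def)
  have smooth: "Ck_on n ?S p" for n using d0(2) by (simp add: smooth_closest_point_on_tube_def smooth_on_def p_def)
  have pder: "(p has_derivative D x) (at x)" if "x \<in> ?S" for x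
    using smooth[of "Suc 0"] that frechet_derivative_works unfolding D_def by auto
  have Ddiff: "(\<lambda>x. D x w) differentiable (at x)" if "x \<in> ?S" for x w
    using smooth[of "Suc (Suc 0)"] that unfolding D_def by auto
  define D2 where "D2 w x = frechet_derivative (\<lambda>x. D x w) (at x)" for w x
  have D2: "((\<lambda>x. D x w) has_derivative D2 w x) (at x)" if "x \<in> ?S" for x w
    using Ddiff[OF that] frechet_derivative_works unfolding D2_def by blast
  have D2cont: "continuous_on ?S (\<lambda>x. D2 w x u)" for w u
    using smooth[of "Suc (Suc 0)"] unfolding D2_def D_def by auto
  have Dlin: "linear (D x)" if "x \<in> ?S" for x using pder[OF that] by (rule has_derivative_linear)
  \<comment> \<open>With a quarter of the radius, the closed \<open>2 * \<rho>\<close>-neighbourhood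
    \<open>N\<close> is compact inside the open tube, and it contains every ball of radius
    \<open>\<rho>\<close> about a point of the tube of radius \<open>\<rho>\<close>.\<close>
  define \<rho> where "\<rho> = \<delta>\<^sub>0 / 4"
  have \<rho>: "0 < \<rho>" using d0 by (simp add: \<rho>_def)
  define N where "N = {x. infdist x \<Gamma> \<le> 2 * \<rho>}"
  have cN: "compact N" unfolding N_def using \<rho> cG by (intro compact_infdist_le) auto
  have NS: "N \<subseteq> ?S" using d0 by (auto simp: N_def tube_def \<rho>_def)
  have bdd: "\<exists>M\<ge>0. \<forall>x\<in>N. norm (f x) \<le> M" if "continuous_on ?S f" for f :: "'a \<Rightarrow> 'a"
  proof -
    have "bounded (f ` N)"
      using compact_continuous_image[OF continuous_on_subset[OF that NS] cN] compact_imp_bounded by blast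
    then obtain M where "0 < M" "\<forall>y\<in>f ` N. norm y \<le> M" using bounded_pos by metis
    then show ?thesis by (intro exI[of _ M]) auto
  qed
  have "\<exists>M\<ge>0. \<forall>x\<in>N. norm (D x w) \<le> M" for w
  proof (rule bdd)
    have "(\<lambda>x. D x w) differentiable_on ?S"
      using Ddiff by (simp add: differentiable_on_eq_differentiable_at open_tube)
    then show "continuous_on ?S (\<lambda>x. D x w)" by (rule differentiable_imp_continuous_on)
  qed
  then obtain M1 where M1: "\<And>w. 0 \<le> M1 w" "\<And>w x. x \<in> N \<Longrightarrow> norm (D x w) \<le> M1 w" by metis
  have "\<exists>M\<ge>0. \<forall>x\<in>N. norm (D2 w x u) \<le> M" for w u by (rule bdd[OF D2cont])
  then obtain M2 where M2: "\<And>w u. 0 \<le> M2 w u" "\<And>w u x. x \<in> N \<Longrightarrow> norm (D2 w x u) \<le> M2 w u" by metis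
  define C1 where "C1 = (\<Sum>b\<in>(Basis::'a set). M1 b)"
  define C2 where "C2 = (\<Sum>w\<in>(Basis::'a set). \<Sum>u\<in>(Basis::'a set). M2 w u)"
  have C0: "0 \<le> C1" "0 \<le> C2" unfolding C1_def C2_def using M1 M2 by (auto intro!: sum_nonneg)
  have Dle: "norm (D x w) \<le> C1 * norm w" if "x \<in> N" for x w
  proof -
    have "norm (D x w) \<le> (\<Sum>b\<in>Basis. norm (D x b)) * norm w"
      using Dlin that NS by (intro linear_norm_le_sum_Basis) auto
    also have "\<dots> \<le> C1 * norm w" unfolding C1_def using M1 that by (intro mult_right_mono sum_mono) auto
    finally show ?thesis .
  qed
  have ballN: "ball x \<rho> \<subseteq> N" if "x \<in> tube \<Gamma> \<rho>" for x
  proof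
    fix y assume "y \<in> ball x \<rho>"
    then show "y \<in> N" using that infdist_triangle[of y \<Gamma> x] by (simp add: N_def tube_def dist_commute)
  qed
  \<comment> \<open>The tube is not convex in general, so the mean value theorem is confined to
    balls of radius \<open>\<rho>\<close>.\<close>
  have ploc: "norm (p x - p y) \<le> C1 * norm (x - y)" if "x \<in> tube \<Gamma> \<rho>" "y \<in> ball x \<rho>" for x y
  proof (rule differentiable_bound[of "ball x \<rho>" p D])
    fix z assume z: "z \<in> ball x \<rho>"
    then have zN: "z \<in> N" using ballN[OF that(1)] by blast
    show "(p has_derivative D z) (at z within ball x \<rho>)"
      using pder zN NS has_derivative_at_withinI by blast
    show "onorm (D z) \<le> C1" by (rule onorm_le) (rule Dle[OF zN])
  qed (use that \<rho> in auto)
  have Dloc: "norm (D x w - D y w) \<le> C2 * norm (x - y) * norm w" if "x \<in> tube \<Gamma> \<rho>" "y \<in> ball x \<rho>" for x y w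
  proof -
    have b: "norm (D x b - D y b) \<le> (\<Sum>u\<in>Basis. M2 b u) * norm (x - y)" for b
    proof (rule differentiable_bound[of "ball x \<rho>" "\<lambda>x. D x b" "D2 b"])
      fix z assume z: "z \<in> ball x \<rho>"
      then have zN: "z \<in> N" using ballN[OF that(1)] by blast
      then have zS: "z \<in> ?S" using NS by blast
      show "((\<lambda>x. D x b) has_derivative D2 b z) (at z within ball x \<rho>)"
        using D2[OF zS] has_derivative_at_withinI by blast
      show "onorm (D2 b z) \<le> (\<Sum>u\<in>Basis. M2 b u)"
      proof (rule onorm_le)
        fix u
        have "norm (D2 b z u) \<le> (\<Sum>c\<in>Basis. norm (D2 b z c)) * norm u"
          using D2[OF zS] by (intro linear_norm_le_sum_Basis has_derivative_linear)
        also have "\<dots> \<le> (\<Sum>c\<in>Basis. M2 b c) * norm u"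
          using M2 zN by (intro mult_right_mono sum_mono) auto
        finally show "norm (D2 b z u) \<le> (\<Sum>c\<in>Basis. M2 b c) * norm u" .
      qed
    qed (use that \<rho> in auto)
    have xy: "x \<in> ?S" "y \<in> ?S" using that ballN[OF that(1)] NS \<rho> centre_in_ball[of x \<rho>] by blast+
    have "linear (\<lambda>w. D x w - D y w)" using Dlin xy by (simp add: linear_compose_sub)
    then have "norm (D x w - D y w) \<le> (\<Sum>b\<in>Basis. norm (D x b - D y b)) * norm w"
      by (rule linear_norm_le_sum_Basis)
    also have "\<dots> \<le> (\<Sum>b\<in>Basis. (\<Sum>u\<in>Basis. M2 b u) * norm (x - y)) * norm w"
      using b by (intro mult_right_mono sum_mono) auto
    finally show ?thesis by (simp add: C2_def sum_distrib_right)
  qed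
  obtain R where R: "0 < R" "\<And>q. q \<in> \<Gamma> \<Longrightarrow> norm q \<le> R"
    using compact_imp_bounded[OF cG(1)] bounded_pos by metis
  \<comment> \<open>\<open>C1\<close> and \<open>C2\<close> are the Lipschitz constants at distances
    below \<open>\<rho>\<close>. The quotients by \<open>\<rho>\<close> serve points farther apart,
    where the differences are at most \<open>2 * R\<close> and
    \<open>2 * C1 * norm u\<close>.\<close>
  define \<Lambda> where "\<Lambda> = 1 + C1 + C2 + 2 * R / \<rho> + 2 * C1 / \<rho>"
  have \<Lambda>: "1 \<le> \<Lambda>" "C1 \<le> \<Lambda>" "C2 \<le> \<Lambda>" "2 * R / \<rho> \<le> \<Lambda>" "2 * C1 / \<rho> \<le> \<Lambda>"
    using C0 R \<rho> by (auto simp: \<Lambda>_def add_nonneg_nonneg)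
  \<comment> \<open>The second entry makes \<open>2 * \<Lambda> * r\<close> less than 1, which is
    the absorption that ends \<open>fib\<close>. The first keeps the chord between \<open>q\<close>
    and a competing projection shorter than \<open>\<rho>\<close>.\<close>
  define r where "r = min (\<rho> / 2) (1 / (4 * \<Lambda>))"
  have r: "0 < r" "2 * r \<le> \<rho>" "2 * \<Lambda> * r < 1"
  proof -
    show "0 < r" "2 * r \<le> \<rho>" using \<rho> \<Lambda> by (auto simp: r_def)
    have "2 * \<Lambda> * r \<le> 2 * \<Lambda> * (1 / (4 * \<Lambda>))" using \<Lambda> by (intro mult_left_mono) (auto simp: r_def)
    also have "\<dots> < 1" using \<Lambda> by simp
    finally show "2 * \<Lambda> * r < 1" .
  qed
  have rS: "x \<in> ?S" if "x \<in> tube \<Gamma> r" for x using that r \<rho> by (auto simp: tube_def \<rho>_def)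
  have r\<rho>: "x \<in> tube \<Gamma> \<rho>" if "x \<in> tube \<Gamma> r" for x using that r by (auto simp: tube_def)
  \<comment> \<open>Composing with \<open>p\<close> turns the minimisation over
    \<open>\<Gamma>\<close> into an unconstrained one: the squared distance from \<open>x\<close> to
    \<open>p y\<close>, as a function of \<open>y\<close>, is minimal at \<open>y = p x\<close>, so
    its derivative vanishes there.\<close>
  have normal: "(x - p x) \<bullet> D (p x) u = 0" if x: "x \<in> ?S" for x u
  proof -
    have "((\<lambda>y. (x - p y) \<bullet> (x - p y)) has_derivative (\<lambda>h. (x - p (p x)) \<bullet> (0 - D (p x) h) + (0 - D (p x) h) \<bullet> (x - p (p x)))) (at (p x))"
      by (intro has_derivative_inner has_derivative_diff has_derivative_const pder GS pmem)
    moreover have "(x - p (p x)) \<bullet> (x - p (p x)) \<le> (x - p y) \<bullet> (x - p y)" for y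
      using pmin[OF pmem, of x y] pid[OF pmem, of x] by (simp add: dist_norm norm_le)
    ultimately have "(\<lambda>h. (x - p (p x)) \<bullet> (0 - D (p x) h) + (0 - D (p x) h) \<bullet> (x - p (p x))) = (\<lambda>h. 0)"
      by (intro has_derivative_local_min) auto
    from fun_cong[OF this, of u] show ?thesis using pid[OF pmem, of x] by (simp add: inner_commute)
  qed
  (* differentiate (y - p y) . D (p y) u = 0 at y = q *)
  have orth: "(w - D q w) \<bullet> D q u = 0" if q: "q \<in> \<Gamma>" for q w u
  proof -
    have pq: "p q = q" using pid q by blast
    have 1: "((\<lambda>y. y - p y) has_derivative (\<lambda>h. h - D q h)) (at q)"
      by (intro has_derivative_diff has_derivative_ident pder GS q)
    have "((\<lambda>y. D (p y) u) has_derivative (\<lambda>h. D2 u (p q) (D q h))) (at q)"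
      using D2[OF GS[OF q], of u] pq by (intro has_derivative_compose[OF pder[OF GS[OF q]]]) simp
    from has_derivative_inner[OF 1 this]
    have 2: "((\<lambda>y. (y - p y) \<bullet> D (p y) u) has_derivative (\<lambda>h. (q - p q) \<bullet> D2 u (p q) (D q h) + (h - D q h) \<bullet> D (p q) u)) (at q)" .
    have 3: "((\<lambda>y. (y - p y) \<bullet> D (p y) u) has_derivative (\<lambda>h. 0)) (at q)"
      by (rule has_derivative_transform_within_open[OF has_derivative_const[of 0] open_tube GS[OF q]]) (use normal in auto)
    from fun_cong[OF has_derivative_unique[OF 2 3], of w] show ?thesis using pq by simp
  qed
  have proj: "is_projector (D q)" if q: "q \<in> \<Gamma>" for q
  proof -
    have sym1: "D q w \<bullet> u = D q w \<bullet> D q u" for w u using orth[OF q, of u w] by (simp add: inner_diff_left inner_diff_right inner_commute)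
    have sym: "D q w \<bullet> u = w \<bullet> D q u" for w u using sym1[of w u] sym1[of u w] by (simp add: inner_commute)
    have "D q (D q w) \<bullet> u = D q w \<bullet> u" for w u using sym[of "D q w" u] sym1[of w u] by simp
    then have "D q (D q w) = D q w" for w using vector_eq_rdot by blast
    then show ?thesis using sym Dlin GS q by (simp add: is_projector_def)
  qed
  have normal0: "D (p x) (x - p x) = 0" if "x \<in> ?S" for x
    using projector_sym[OF proj[OF pmem], of x "x - p x"] normal[OF that]
    by (metis inner_zero_left vector_eq_rdot)
  \<comment> \<open>Since \<open>p\<close> fixes both points, this is the Taylor remainder of
    \<open>p\<close> at \<open>y\<close>: chords of \<open>\<Gamma>\<close> are tangential up to
    second order.\<close>
  have near: "norm ((q - y) - D y (q - y)) \<le> \<Lambda> * (norm (q - y))\<^sup>2" if q: "q \<in> \<Gamma>" "y \<in> \<Gamma>" and l: "norm (q - y) < \<rho>" for q y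
  proof -
    have yt: "y \<in> tube \<Gamma> \<rho>" using q \<rho> by (simp add: tube_def)
    have "norm (p q - p y - D y (q - y)) \<le> norm (q - y) * (C2 * norm (q - y))"
    proof (rule differentiable_bound_linearization[of y q "closed_segment y q" p D y])
      show "y + t *\<^sub>R (q - y) \<in> closed_segment y q" if "t \<in> {0..1}" for t
        using that by (auto simp: in_segment algebra_simps intro!: exI[of _ t])
      fix x assume x: "x \<in> closed_segment y q"
      then have xl: "norm (x - y) \<le> norm (q - y)" using segment_bound1[of x y q] by (simp add: norm_minus_commute)
      then have xb: "x \<in> ball y \<rho>" using l by (simp add: dist_norm norm_minus_commute)
      then show "(p has_derivative D x) (at x within closed_segment y q)"
        using pder ballN[OF yt] NS has_derivative_at_withinI by blast
      show "onorm (D x - D y) \<le> C2 * norm (q - y)" 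
        unfolding fun_diff_def
      proof (rule onorm_le)
        fix u
        have "norm (D x u - D y u) \<le> C2 * norm (y - x) * norm u"
          using Dloc[OF yt xb, of u] by (simp add: norm_minus_commute)
        also have "\<dots> \<le> C2 * norm (q - y) * norm u"
          using xl C0 by (intro mult_right_mono mult_left_mono) (auto simp: norm_minus_commute)
        finally show "norm (D x u - D y u) \<le> C2 * norm (q - y) * norm u" .
      qed
    qed simp
    also have "\<dots> \<le> \<Lambda> * (norm (q - y))\<^sup>2" 
      using \<Lambda>(3) by (simp add: power2_eq_square mult_right_mono mult.left_commute)
    finally show ?thesis using pid q by simp
  qed
  (* q - p (q + n) is a second-order small perturbation of tangent vectors at both end points, hence almost
     orthogonal to both normals, whose difference it is *)
  have fib: "p (q + n) = q" if q: "q \<in> \<Gamma>" and n: "D q n = 0" "norm n < r" for q n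
  proof (rule ccontr)
    assume ne: "p (q + n) \<noteq> q"
    define x where "x = q + n"
    define y where "y = p x"
    define e where "e = q - y"
    have "infdist x \<Gamma> < r" using infdist_le[OF q, of x] n by (simp add: x_def dist_norm)
    then have xr: "x \<in> tube \<Gamma> r" by (simp add: tube_def)
    have nxy: "norm (x - y) \<le> norm n" using pmin[OF q, of x] by (simp add: y_def x_def dist_norm)
    have er: "norm e \<le> norm (x - y) + norm n" using norm_triangle_ineq[of "q - x" "x - y"] by (simp add: e_def x_def)
    have yG: "y \<in> \<Gamma>" using pmem by (simp add: y_def)
    have e\<rho>: "norm (q - y) < \<rho>" "norm (y - q) < \<rho>" 
      using er nxy n r by (auto simp: e_def norm_minus_commute)
    have bound: "\<bar>(e - D z e) \<bullet> v\<bar> \<le> \<Lambda> * (norm e)\<^sup>2 * r" 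
      if "norm (e - D z e) \<le> \<Lambda> * (norm e)\<^sup>2" "norm v \<le> r" for z v
    proof -
      have "\<bar>(e - D z e) \<bullet> v\<bar> \<le> norm (e - D z e) * norm v" by (rule Cauchy_Schwarz_ineq2)
      also have "\<dots> \<le> \<Lambda> * (norm e)\<^sup>2 * r" using that \<Lambda> by (intro mult_mono) auto
      finally show ?thesis .
    qed
    have 1: "\<bar>(e - D y e) \<bullet> (x - y)\<bar> \<le> \<Lambda> * (norm e)\<^sup>2 * r"
      using near[OF q yG e\<rho>(1)] nxy n by (intro bound) (auto simp: e_def)
    have 2: "\<bar>(e - D q e) \<bullet> n\<bar> \<le> \<Lambda> * (norm e)\<^sup>2 * r"
    proof (rule bound)
      have "D q (y - q) = - D q e" using Dlin[OF GS[OF q]] by (simp add: e_def linear_diff)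
      then have "norm ((y - q) - D q (y - q)) = norm (e - D q e)"
        by (metis e_def minus_diff_eq norm_minus_cancel minus_diff_minus)
      then show "norm (e - D q e) \<le> \<Lambda> * (norm e)\<^sup>2"
        using near[OF yG q e\<rho>(2)] by (simp add: e_def norm_minus_commute)
    qed (use n in simp)
    have 3: "D y e \<bullet> (x - y) = 0" using normal[OF rS[OF xr], of e] by (simp add: y_def inner_commute)
    have 4: "D q e \<bullet> n = 0" using projector_sym[OF proj[OF q], of e n] n by simp
    have "(norm e)\<^sup>2 = e \<bullet> ((x - y) - n)" by (simp add: power2_norm_eq_inner e_def x_def)
    also have "\<dots> = (e - D y e) \<bullet> (x - y) - (e - D q e) \<bullet> n" using 3 4 by (simp add: inner_diff_left inner_diff_right)
    also have "\<dots> \<le> (2 * \<Lambda> * r) * (norm e)\<^sup>2" using 1 2 by (simp add: algebra_simps)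
    finally have "(norm e)\<^sup>2 \<le> (2 * \<Lambda> * r) * (norm e)\<^sup>2" .
    moreover have "e \<noteq> 0" using ne by (simp add: e_def y_def x_def)
    ultimately show False using r(3) by simp
  qed
  have tub: "tubular \<Gamma> p D r \<Lambda>"
  proof
    show "norm (p x - p y) \<le> \<Lambda> * norm (x - y)" if xy: "x \<in> tube \<Gamma> r" "y \<in> tube \<Gamma> r" for x y
    proof (cases "y \<in> ball x \<rho>")
      case True
      have "norm (p x - p y) \<le> C1 * norm (x - y)" by (rule ploc[OF r\<rho>[OF xy(1)] True])
      also have "\<dots> \<le> \<Lambda> * norm (x - y)" using \<Lambda> by (intro mult_right_mono) auto
      finally show ?thesis .
    next
      case False
      have "norm (p x - p y) \<le> 2 * R" using norm_triangle_ineq4[of "p x" "p y"] R(2)[OF pmem, of x] R(2)[OF pmem, of y] by linarith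
      also have "\<dots> = (2 * R / \<rho>) * \<rho>" using \<rho> by simp
      also have "\<dots> \<le> \<Lambda> * norm (x - y)" using False \<Lambda> \<rho> R by (intro mult_mono) (auto simp: dist_norm)
      finally show ?thesis .
    qed
    show "norm (D q u - D q' u) \<le> \<Lambda> * norm (q - q') * norm u" if q: "q \<in> \<Gamma>" "q' \<in> \<Gamma>" for q q' u
    proof (cases "q' \<in> ball q \<rho>")
      case True
      have "norm (D q u - D q' u) \<le> C2 * norm (q - q') * norm u" 
        by (rule Dloc[OF _ True]) (use q \<rho> in \<open>simp add: tube_def\<close>)
      also have "\<dots> \<le> \<Lambda> * norm (q - q') * norm u" using \<Lambda> by (intro mult_right_mono) auto
      finally show ?thesis .
    next
      case False
      have qN: "q \<in> N" "q' \<in> N" using q \<rho> by (auto simp: N_def)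
      have "norm (D q u - D q' u) \<le> 2 * C1 * norm u" 
        using norm_triangle_ineq4[of "D q u" "D q' u"] Dle[OF qN(1), of u] Dle[OF qN(2), of u] by linarith
      also have "\<dots> = (2 * C1 / \<rho>) * \<rho> * norm u" using \<rho> by simp
      also have "\<dots> \<le> \<Lambda> * norm (q - q') * norm u" using False \<Lambda> \<rho> C0 by (intro mult_mono mult_right_mono) (auto simp: dist_norm)
      finally show ?thesis .
    qed
    show "norm (D x u - D (p x) u) \<le> \<Lambda> * norm (x - p x) * norm u" if x: "x \<in> tube \<Gamma> r" for x u
    proof -
      have "p x \<in> ball x \<rho>" using pdist[of x] x r by (simp add: dist_norm tube_def)
      then have "norm (D x u - D (p x) u) \<le> C2 * norm (x - p x) * norm u" by (rule Dloc[OF r\<rho>[OF x]])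
      also have "\<dots> \<le> \<Lambda> * norm (x - p x) * norm u" using \<Lambda> by (intro mult_right_mono) auto
      finally show ?thesis .
    qed
  qed (use r(1) \<Lambda>(1) cG pmem pid pdist pder rS proj normal0 fib in auto)
  have tan: "orth_proj (tangent_space \<Gamma> q) = D q" if q: "q \<in> \<Gamma>" for q
  proof -
    have "tangent_space \<Gamma> q = range (D q)"
    proof (intro set_eqI iffI)
      fix w assume "w \<in> tangent_space \<Gamma> q"
      then obtain \<gamma> \<epsilon> where g: "0 < \<epsilon>" "\<gamma> ` {-\<epsilon><..<\<epsilon>} \<subseteq> \<Gamma>" "\<gamma> 0 = q" "(\<gamma> has_vector_derivative w) (at (0::real))"
        by (auto simp: tangent_space_def)
      \<comment> \<open>The curve lies in \<open>\<Gamma>\<close>, hence coincides with its own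
        projection; differentiating this identity gives \<open>D q w = w\<close>.\<close>
      have "((\<lambda>t. p (\<gamma> t)) has_derivative (\<lambda>s. D q (s *\<^sub>R w))) (at 0)"
        using g pder[OF GS[OF q]] has_derivative_compose[of \<gamma> "\<lambda>s. s *\<^sub>R w" 0 UNIV p "D q"]
        by (simp add: has_vector_derivative_def)
      then have "(\<gamma> has_derivative (\<lambda>s. D q (s *\<^sub>R w))) (at 0)"
        by (rule has_derivative_transform_within_open[of _ _ _ _ "{-\<epsilon><..<\<epsilon>}"]) (use g in \<open>auto intro!: pid\<close>)
      moreover have "(\<gamma> has_derivative (\<lambda>s. s *\<^sub>R w)) (at 0)" using g by (simp add: has_vector_derivative_def)
      ultimately have "(\<lambda>s. D q (s *\<^sub>R w)) = (\<lambda>s. s *\<^sub>R w)" by (rule has_derivative_unique)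
      from fun_cong[OF this, of 1] have "D q w = w" by simp
      then show "w \<in> range (D q)" by (metis rangeI)
    next
      fix w assume "w \<in> range (D q)"
      then obtain u where u: "w = D q u" by blast
      \<comment> \<open>Keeps the segment inside the tube; the added 1 covers
        \<open>u = 0\<close>.\<close>
      define \<epsilon> where "\<epsilon> = \<delta>\<^sub>0 / (norm u + 1)"
      have e: "0 < \<epsilon>" using d0 by (simp add: \<epsilon>_def add_nonneg_pos)
      have seg: "q + t *\<^sub>R u \<in> ?S" if "t \<in> {-\<epsilon><..<\<epsilon>}" for t
      proof -
        have "\<bar>t\<bar> * norm u \<le> \<bar>t\<bar> * (norm u + 1)" by (intro mult_left_mono) auto
        also have "\<dots> < \<epsilon> * (norm u + 1)" using that by (intro mult_strict_right_mono) (auto simp: add_nonneg_pos)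
        also have "\<dots> = \<delta>\<^sub>0" by (simp add: \<epsilon>_def add_nonneg_eq_0_iff)
        finally have "norm (t *\<^sub>R u) < \<delta>\<^sub>0" by simp
        then show ?thesis using infdist_le[OF q, of "q + t *\<^sub>R u"] by (simp add: tube_def dist_norm)
      qed
      have "smooth_on {-\<epsilon><..<\<epsilon>} (\<lambda>t. p (q + t *\<^sub>R u))"
        unfolding smooth_on_def using seg smooth by (intro allI Ck_on_line[of _ q u ?S]) auto
      moreover have "((\<lambda>t. p (q + t *\<^sub>R u)) has_vector_derivative w) (at 0)"
      proof -
        have "((\<lambda>t. q + t *\<^sub>R u) has_derivative (\<lambda>s. s *\<^sub>R u)) (at 0)"
          by (auto intro!: derivative_eq_intros)
        from has_derivative_compose[OF this, of p "D q"] pder[OF GS[OF q]]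
        have "((\<lambda>t. p (q + t *\<^sub>R u)) has_derivative (\<lambda>s. D q (s *\<^sub>R u))) (at 0)" by simp
        then show ?thesis using Dlin[OF GS[OF q]] by (simp add: has_vector_derivative_def u linear_cmul)
      qed
      ultimately show "w \<in> tangent_space \<Gamma> q"
        unfolding tangent_space_def using e pmem pid[OF q]
        by (intro CollectI exI[of _ "\<lambda>t. p (q + t *\<^sub>R u)"] exI[of _ \<epsilon>]) auto
    qed
    moreover have "orth_proj (range (D q)) w = D q w" for w
    proof (rule orth_proj_eqI)
      show "subspace (range (D q))" using Dlin[OF GS[OF q]] by (simp add: linear_subspace_image)
      show "orthogonal (w - D q w) z" if "z \<in> range (D q)" for z using that orth[OF q] by (auto simp: orthogonal_def)
    qed simp
    ultimately show ?thesis by auto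
  qed
  show ?thesis 
    by (rule that[OF tub[unfolded D_def[abs_def] p_def] tan[unfolded D_def p_def]])
qed

section \<open>A Poincare inequality on tubes\<close>

lemma nn_integral_affine_le:
  fixes H :: "'a::euclidean_space \<Rightarrow> ennreal"
  assumes [measurable]: "H \<in> borel_measurable borel" and s: "1/2 \<le> s"
  shows "(\<integral>\<^sup>+y. H (c + s *\<^sub>R y) \<partial>lborel) \<le> ennreal (2 ^ DIM('a)) * (\<integral>\<^sup>+y. H y \<partial>lborel)"
proof -
  have "(\<integral>\<^sup>+y. H y \<partial>lborel) = ennreal (s ^ DIM('a)) * (\<integral>\<^sup>+y. H (c + s *\<^sub>R y) \<partial>lborel)"
    using s by (subst lborel_affine[of s c])
      (simp_all add: nn_integral_density nn_integral_distr nn_integral_cmult)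
  then have "ennreal (2 ^ DIM('a)) * (\<integral>\<^sup>+y. H y \<partial>lborel)
      = ennreal (2 ^ DIM('a) * s ^ DIM('a)) * (\<integral>\<^sup>+y. H (c + s *\<^sub>R y) \<partial>lborel)"
    using s by (simp add: ennreal_mult mult.assoc)
  moreover have "1 \<le> ennreal (2 ^ DIM('a) * s ^ DIM('a))"
  proof -
    have "1 \<le> (2 * s) ^ DIM('a)" by (rule one_le_power) (use s in simp)
    then show ?thesis unfolding power_mult_distrib using ennreal_leI by fastforce
  qed
  ultimately show ?thesis 
    using mult_right_mono[of 1 "ennreal (2 ^ DIM('a) * s ^ DIM('a))" "\<integral>\<^sup>+y. H (c + s *\<^sub>R y) \<partial>lborel"] by simp
qed

lemma square_nn_integral_unit_interval:
  assumes [measurable]: "g \<in> borel_measurable borel"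
  shows "(\<integral>\<^sup>+t\<in>{0..1::real}. g t \<partial>lborel)\<^sup>2 \<le> (\<integral>\<^sup>+t\<in>{0..1}. (g t)\<^sup>2 \<partial>lborel)"
proof -
  have ind: "(indicator {0..1::real} x :: ennreal)\<^sup>2 = indicator {0..1} x" for x
    by (simp add: indicator_def)
  have "(\<integral>\<^sup>+t. (g t * indicator {0..1} t) * indicator {0..1} t \<partial>lborel)\<^sup>2
      \<le> (\<integral>\<^sup>+t. (g t * indicator {0..1} t)\<^sup>2 \<partial>lborel) * (\<integral>\<^sup>+t. (indicator {0..1::real} t)\<^sup>2 \<partial>lborel)"
    by (rule Cauchy_Schwarz_nn_integral) measurable
  also have "(\<integral>\<^sup>+t. (indicator {0..1::real} t)\<^sup>2 \<partial>lborel) = 1" by (simp add: ind)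
  finally show ?thesis by (simp add: power_mult_distrib ind mult.assoc indicator_inter_arith[symmetric])
qed

text \<open>Oscillation is measured by a double integral instead of a deviation from a mean: this is
  monotone in both sets and passes easily from the members of a cover to their union.\<close>

definition square_diff :: "('a::euclidean_space \<Rightarrow> real) \<Rightarrow> 'a set \<Rightarrow> 'a set \<Rightarrow> ennreal" where
  "square_diff w A B = (\<integral>\<^sup>+x\<in>A. (\<integral>\<^sup>+y\<in>B. ennreal ((w x - w y)\<^sup>2) \<partial>lborel) \<partial>lborel)"

text \<open>The gradient is integrated along all segments and the segment parameter \<open>t\<close>
  is pulled out by Tonelli. For \<open>t\<close> above 1/2 the substitution is made in the end point
  \<open>y\<close>, below 1/2 in the end point \<open>x\<close>; the scaling factor is then at least
  1/2, whence \<open>2 ^ DIM('a)\<close> for every \<open>t\<close>.\<close>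

lemma convex_poincare:
  fixes w :: "'a::euclidean_space \<Rightarrow> real" and G :: "'a \<Rightarrow> ennreal"
  assumes [measurable]: "w \<in> borel_measurable borel" "G \<in> borel_measurable borel" "B \<in> sets borel"
    and B: "convex B" and \<rho>: "\<And>x y. x \<in> B \<Longrightarrow> y \<in> B \<Longrightarrow> norm (x - y) \<le> \<rho>"
    and seg: "\<And>x y. x \<in> B \<Longrightarrow> y \<in> B \<Longrightarrow>
      ennreal \<bar>w x - w y\<bar> \<le> ennreal (norm (x - y)) * (\<integral>\<^sup>+t\<in>{0..1}. G (x + t *\<^sub>R (y - x)) \<partial>lborel)"
  shows "square_diff w B B \<le> ennreal (\<rho>\<^sup>2 * 2 ^ DIM('a)) * emeasure lborel B * (\<integral>\<^sup>+x\<in>B. (G x)\<^sup>2 \<partial>lborel)"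
proof -
  define J where "J = (\<integral>\<^sup>+x\<in>B. (G x)\<^sup>2 \<partial>lborel)"
  define f where "f t x y = (G (x + t *\<^sub>R (y - x)))\<^sup>2 * indicator {0..1::real} t * indicator B x * indicator B y" for t x y
  have pt: "ennreal ((w x - w y)\<^sup>2) * indicator B y * indicator B x \<le> ennreal (\<rho>\<^sup>2) * (\<integral>\<^sup>+t. f t x y \<partial>lborel)" for x y
  proof (cases "x \<in> B \<and> y \<in> B")
    case True
    have "ennreal ((w x - w y)\<^sup>2) = (ennreal \<bar>w x - w y\<bar>)\<^sup>2" by (simp add: ennreal_power)
    also have "\<dots> \<le> (ennreal \<rho> * (\<integral>\<^sup>+t\<in>{0..1}. G (x + t *\<^sub>R (y - x)) \<partial>lborel))\<^sup>2"
      using True seg[of x y] \<rho>[of x y] by (intro power_mono order_trans[OF seg] mult_right_mono ennreal_leI) auto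
    also have "\<dots> = ennreal (\<rho>\<^sup>2) * (\<integral>\<^sup>+t\<in>{0..1}. G (x + t *\<^sub>R (y - x)) \<partial>lborel)\<^sup>2"
      using \<rho>[of x y] True order_trans[OF norm_ge_zero \<rho>[of x y]] by (simp add: power_mult_distrib ennreal_power)
    also have "\<dots> \<le> ennreal (\<rho>\<^sup>2) * (\<integral>\<^sup>+t\<in>{0..1}. (G (x + t *\<^sub>R (y - x)))\<^sup>2 \<partial>lborel)"
      by (intro mult_left_mono square_nn_integral_unit_interval) auto
    finally show ?thesis using True by (simp add: f_def)
  qed auto
  have "square_diff w B B = (\<integral>\<^sup>+x. \<integral>\<^sup>+y. ennreal ((w x - w y)\<^sup>2) * indicator B y * indicator B x \<partial>lborel \<partial>lborel)"
    unfolding square_diff_def by (simp add: nn_integral_multc)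
  also have "\<dots> \<le> (\<integral>\<^sup>+x. \<integral>\<^sup>+y. ennreal (\<rho>\<^sup>2) * (\<integral>\<^sup>+t. f t x y \<partial>lborel) \<partial>lborel \<partial>lborel)"
    by (intro nn_integral_mono pt)
  also have "\<dots> = ennreal (\<rho>\<^sup>2) * (\<integral>\<^sup>+x. \<integral>\<^sup>+y. \<integral>\<^sup>+t. f t x y \<partial>lborel \<partial>lborel \<partial>lborel)"
    unfolding f_def by (simp add: nn_integral_cmult)
  also have "(\<integral>\<^sup>+x. \<integral>\<^sup>+y. \<integral>\<^sup>+t. f t x y \<partial>lborel \<partial>lborel \<partial>lborel) = (\<integral>\<^sup>+x. \<integral>\<^sup>+t. \<integral>\<^sup>+y. f t x y \<partial>lborel \<partial>lborel \<partial>lborel)"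
    unfolding f_def by (intro nn_integral_cong lborel_pair.Fubini') measurable
  also have "\<dots> = (\<integral>\<^sup>+t. \<integral>\<^sup>+x. \<integral>\<^sup>+y. f t x y \<partial>lborel \<partial>lborel \<partial>lborel)"
    unfolding f_def by (intro lborel_pair.Fubini') measurable
  also have "\<dots> \<le> (\<integral>\<^sup>+t. ennreal (2 ^ DIM('a)) * emeasure lborel B * J * indicator {0..1} t \<partial>(lborel :: real measure))"
  proof (rule nn_integral_mono)
    fix t :: real
    define H where "H z = (G z)\<^sup>2 * indicator B z" for z
    have [measurable]: "H \<in> borel_measurable borel" unfolding H_def by measurable
    have JH: "J = (\<integral>\<^sup>+z. H z \<partial>lborel)" by (simp add: J_def H_def)
    have conv: "x + t *\<^sub>R (y - x) \<in> B" if "x \<in> B" "y \<in> B" "0 \<le> t" "t \<le> 1" for x y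
      using convexD_alt[OF B that] by (simp add: algebra_simps)
    have "(\<integral>\<^sup>+x. \<integral>\<^sup>+y. f t x y \<partial>lborel \<partial>lborel) \<le> (\<integral>\<^sup>+x. ennreal (2 ^ DIM('a)) * J * indicator B x \<partial>lborel)"
      if t: "1/2 \<le> t" "t \<le> 1"
    proof (rule nn_integral_mono)
      fix x
      have "(\<integral>\<^sup>+y. f t x y \<partial>lborel) \<le> (\<integral>\<^sup>+y. H ((x - t *\<^sub>R x) + t *\<^sub>R y) * indicator B x \<partial>lborel)"
        using conv t by (intro nn_integral_mono) (auto simp: f_def H_def indicator_def algebra_simps)
      also have "\<dots> = (\<integral>\<^sup>+y. H ((x - t *\<^sub>R x) + t *\<^sub>R y) \<partial>lborel) * indicator B x"
        by (intro nn_integral_multc) measurable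
      also have "\<dots> \<le> ennreal (2 ^ DIM('a)) * J * indicator B x"
        unfolding JH using t by (intro mult_right_mono nn_integral_affine_le) auto
      finally show "(\<integral>\<^sup>+y. f t x y \<partial>lborel) \<le> ennreal (2 ^ DIM('a)) * J * indicator B x" .
    qed
    moreover have "(\<integral>\<^sup>+x. \<integral>\<^sup>+y. f t x y \<partial>lborel \<partial>lborel) \<le> (\<integral>\<^sup>+y. ennreal (2 ^ DIM('a)) * J * indicator B y \<partial>lborel)"
      if t: "0 \<le> t" "t \<le> 1/2"
    proof -
      have "(\<integral>\<^sup>+x. \<integral>\<^sup>+y. f t x y \<partial>lborel \<partial>lborel) = (\<integral>\<^sup>+y. \<integral>\<^sup>+x. f t x y \<partial>lborel \<partial>lborel)"
        unfolding f_def by (intro lborel_pair.Fubini') measurable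
      also have "\<dots> \<le> (\<integral>\<^sup>+y. ennreal (2 ^ DIM('a)) * J * indicator B y \<partial>lborel)"
      proof (rule nn_integral_mono)
        fix y
        have "(\<integral>\<^sup>+x. f t x y \<partial>lborel) \<le> (\<integral>\<^sup>+x. H (t *\<^sub>R y + (1 - t) *\<^sub>R x) * indicator B y \<partial>lborel)"
          using conv t by (intro nn_integral_mono) (auto simp: f_def H_def indicator_def algebra_simps)
        also have "\<dots> = (\<integral>\<^sup>+x. H (t *\<^sub>R y + (1 - t) *\<^sub>R x) \<partial>lborel) * indicator B y"
          by (intro nn_integral_multc) measurable
        also have "\<dots> \<le> ennreal (2 ^ DIM('a)) * J * indicator B y"
          unfolding JH using t by (intro mult_right_mono nn_integral_affine_le) auto
        finally show "(\<integral>\<^sup>+x. f t x y \<partial>lborel) \<le> ennreal (2 ^ DIM('a)) * J * indicator B y" .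
      qed
      finally show ?thesis .
    qed
    moreover have "(\<integral>\<^sup>+y. ennreal (2 ^ DIM('a)) * J * indicator B y \<partial>lborel) = ennreal (2 ^ DIM('a)) * emeasure lborel B * J"
      by (subst nn_integral_cmult_indicator) (simp_all add: mult_ac)
    moreover have "(\<integral>\<^sup>+x. \<integral>\<^sup>+y. f t x y \<partial>lborel \<partial>lborel) = 0" if "t \<notin> {0..1}"
      using that by (simp add: f_def)
    ultimately show "(\<integral>\<^sup>+x. \<integral>\<^sup>+y. f t x y \<partial>lborel \<partial>lborel) \<le> ennreal (2 ^ DIM('a)) * emeasure lborel B * J * indicator {0..1} t"
      by (cases "t \<in> {0..1}"; cases "t \<le> 1/2") auto
  qed
  also have "\<dots> = ennreal (2 ^ DIM('a)) * emeasure lborel B * J"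
    by (simp add: nn_integral_cmult_indicator)
  finally have "square_diff w B B \<le> ennreal (\<rho>\<^sup>2) * (ennreal (2 ^ DIM('a)) * emeasure lborel B * J)"
    by (simp add: mult_left_mono)
  also have "\<dots> = ennreal (\<rho>\<^sup>2 * 2 ^ DIM('a)) * emeasure lborel B * J"
    by (simp add: ennreal_mult mult_ac)
  finally show ?thesis by (simp add: J_def)
qed

lemma square_diff_commute:
  assumes [measurable]: "w \<in> borel_measurable borel" "A \<in> sets borel" "B \<in> sets borel"
  shows "square_diff w A B = square_diff w B A"
proof -
  have "square_diff w A B = (\<integral>\<^sup>+x. \<integral>\<^sup>+y. ennreal ((w x - w y)\<^sup>2) * indicator B y * indicator A x \<partial>lborel \<partial>lborel)"
    unfolding square_diff_def by (simp add: nn_integral_multc)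
  also have "\<dots> = (\<integral>\<^sup>+y. \<integral>\<^sup>+x. ennreal ((w x - w y)\<^sup>2) * indicator B y * indicator A x \<partial>lborel \<partial>lborel)"
    by (intro lborel_pair.Fubini') measurable
  also have "\<dots> = (\<integral>\<^sup>+y. \<integral>\<^sup>+x. (ennreal ((w y - w x)\<^sup>2) * indicator A x) * indicator B y \<partial>lborel \<partial>lborel)"
    by (intro nn_integral_cong) (simp add: power2_commute mult_ac)
  also have "\<dots> = square_diff w B A"
    unfolding square_diff_def by (simp add: nn_integral_multc)
  finally show ?thesis .
qed

lemma square_diff_mono:
  assumes "A \<subseteq> A'" "B \<subseteq> B'"
  shows "square_diff w A B \<le> square_diff w A' B'"
  unfolding square_diff_def using assms
  by (intro nn_integral_mono mult_mono) (auto simp: indicator_def)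

text \<open>A third point is inserted and integrated over \<open>B\<close>; each term then picks up
  the volume of the set whose variable it does not contain.\<close>

lemma square_diff_triangle:
  assumes [measurable]: "w \<in> borel_measurable borel" "A \<in> sets borel" "B \<in> sets borel" "C \<in> sets borel"
  shows "emeasure lborel B * square_diff w A C \<le> 2 * (emeasure lborel C * square_diff w A B + emeasure lborel A * square_diff w B C)"
proof -
  let ?f = "\<lambda>x y. ennreal ((w x - w y)\<^sup>2)"
  have pt: "?f x y \<le> 2 * (?f x z + ?f z y)" for x y z
  proof -
    have "0 \<le> ((w x - w z) - (w z - w y))\<^sup>2" by simp
    then have "(w x - w y)\<^sup>2 \<le> 2 * ((w x - w z)\<^sup>2 + (w z - w y)\<^sup>2)"
      by (simp add: power2_eq_square algebra_simps)
    then have "?f x y \<le> ennreal (2 * ((w x - w z)\<^sup>2 + (w z - w y)\<^sup>2))" by (rule ennreal_leI)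
    then show ?thesis by (simp add: ennreal_mult)
  qed
  have inner: "(\<integral>\<^sup>+y\<in>C. ?f x y \<partial>lborel) \<le> 2 * (?f x z * emeasure lborel C + (\<integral>\<^sup>+y\<in>C. ?f z y \<partial>lborel))" for x z
  proof -
    have "(\<integral>\<^sup>+y\<in>C. ?f x y \<partial>lborel) \<le> (\<integral>\<^sup>+y. 2 * (?f x z * indicator C y + ?f z y * indicator C y) \<partial>lborel)"
      using pt by (intro nn_integral_mono) (auto simp: indicator_def)
    also have "\<dots> = 2 * (?f x z * emeasure lborel C + (\<integral>\<^sup>+y\<in>C. ?f z y \<partial>lborel))"
      by (simp add: nn_integral_cmult nn_integral_add nn_integral_cmult_indicator)
    finally show ?thesis .
  qed
  have outer: "square_diff w A C \<le> 2 * ((\<integral>\<^sup>+x\<in>A. ?f x z \<partial>lborel) * emeasure lborel C + (\<integral>\<^sup>+y\<in>C. ?f z y \<partial>lborel) * emeasure lborel A)" for z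
  proof -
    have "square_diff w A C \<le> (\<integral>\<^sup>+x. 2 * ((?f x z * indicator A x) * emeasure lborel C + (\<integral>\<^sup>+y\<in>C. ?f z y \<partial>lborel) * indicator A x) \<partial>lborel)"
      unfolding square_diff_def
      using inner[of _ z] by (intro nn_integral_mono) (auto simp: indicator_def)
    also have "\<dots> = 2 * ((\<integral>\<^sup>+x\<in>A. ?f x z \<partial>lborel) * emeasure lborel C + (\<integral>\<^sup>+y\<in>C. ?f z y \<partial>lborel) * emeasure lborel A)"
      by (simp add: nn_integral_cmult nn_integral_add nn_integral_cmult_indicator nn_integral_multc)
    finally show ?thesis .
  qed
  have "emeasure lborel B * square_diff w A C = (\<integral>\<^sup>+z. square_diff w A C * indicator B z \<partial>lborel)"
    by (subst nn_integral_cmult_indicator) (simp_all add: mult.commute)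
  also have "\<dots> \<le> (\<integral>\<^sup>+z. 2 * (((\<integral>\<^sup>+x\<in>A. ?f z x \<partial>lborel) * indicator B z) * emeasure lborel C + ((\<integral>\<^sup>+y\<in>C. ?f z y \<partial>lborel) * indicator B z) * emeasure lborel A) \<partial>lborel)"
    using outer by (intro nn_integral_mono) (auto simp: indicator_def power2_commute)
  also have "\<dots> = 2 * (square_diff w B A * emeasure lborel C + square_diff w B C * emeasure lborel A)"
    unfolding square_diff_def by (simp add: nn_integral_cmult nn_integral_add nn_integral_multc)
  finally show ?thesis by (simp add: square_diff_commute[of w B A] mult.commute)
qed

text \<open>Accommodates functions that are Lipschitz only piece by piece, with a discontinuous
  \<open>G\<close>. Segments are tested only inside \<open>U\<close>, since the lifted function
  carries no information outside the tube.\<close>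

definition upper_gradient_on :: "'a::euclidean_space set \<Rightarrow> ('a \<Rightarrow> real) \<Rightarrow> ('a \<Rightarrow> ennreal) \<Rightarrow> bool" where
  "upper_gradient_on U w G \<longleftrightarrow> w \<in> borel_measurable borel \<and> G \<in> borel_measurable borel \<and>
     (\<forall>x y. closed_segment x y \<subseteq> U \<longrightarrow>
        ennreal \<bar>w x - w y\<bar> \<le> ennreal (norm (x - y)) * (\<integral>\<^sup>+t\<in>{0..1}. G (x + t *\<^sub>R (y - x)) \<partial>lborel))"

lemma square_diff_UN:
  assumes I: "finite I" and [measurable]: "w \<in> borel_measurable borel" "\<And>i. i \<in> I \<Longrightarrow> A i \<in> sets borel"
    and V: "V \<subseteq> (\<Union>i\<in>I. A i)"
  shows "square_diff w V V \<le> (\<Sum>i\<in>I. \<Sum>j\<in>I. square_diff w (A i) (A j))"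
proof -
  have ind: "indicator V x \<le> (\<Sum>i\<in>I. indicator (A i) x :: ennreal)" for x
  proof (cases "x \<in> V")
    case True
    then obtain i where "i \<in> I" "x \<in> A i" using V by blast
    then have "(1::ennreal) \<le> (\<Sum>i\<in>I. indicator (A i) x)"
      using member_le_sum[of i I "\<lambda>i. indicator (A i) x :: ennreal"] I by simp
    then show ?thesis using True by simp
  qed simp
  have "square_diff w V V \<le> (\<integral>\<^sup>+x. (\<integral>\<^sup>+y. ennreal ((w x - w y)\<^sup>2) * (\<Sum>j\<in>I. indicator (A j) y) \<partial>lborel) * (\<Sum>i\<in>I. indicator (A i) x) \<partial>lborel)"
    unfolding square_diff_def using ind by (intro nn_integral_mono mult_mono) auto
  also have "\<dots> = (\<Sum>i\<in>I. \<Sum>j\<in>I. square_diff w (A i) (A j))"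
    unfolding square_diff_def
    by (simp add: sum_distrib_left sum_distrib_right nn_integral_sum cong: sum.cong)
  finally show ?thesis .
qed

text \<open>Two centres are related if the oscillation between the balls about them is bounded by
  the energy with some constant. This is an equivalence relation with open classes, so connectedness
  relates all pairs without an explicit chain, and compactness leaves finitely many pairs to sum
  over.\<close>

proposition tube_poincare:
  fixes \<Gamma> :: "'a::euclidean_space set"
  assumes \<Gamma>: "compact \<Gamma>" "connected \<Gamma>" "\<Gamma> \<noteq> {}" and r: "0 < r"
  obtains C where "0 < C" "\<And>w G. upper_gradient_on (tube \<Gamma> r) w G \<Longrightarrow>
     square_diff w (tube \<Gamma> (r/6)) (tube \<Gamma> (r/6)) \<le> ennreal C * (\<integral>\<^sup>+x\<in>tube \<Gamma> r. (G x)\<^sup>2 \<partial>lborel)"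
proof -
  \<comment> \<open>Balls of radius \<open>2 * s\<close> about points of \<open>\<Gamma>\<close> lie
    in the tube of radius \<open>r\<close>. The smaller radius \<open>r / 6\<close> equals
    \<open>s / 2\<close>: one half of \<open>s\<close> reaches \<open>\<Gamma>\<close>, the other
    half a centre of the finite cover.\<close>
  define s where "s = r / 3"
  have s: "0 < s" using r by (simp add: s_def)
  define R where "R q q' \<longleftrightarrow> (\<exists>C\<ge>0. \<forall>w G. upper_gradient_on (tube \<Gamma> r) w G \<longrightarrow>
     square_diff w (ball q s) (ball q' s) \<le> ennreal C * (\<integral>\<^sup>+x\<in>tube \<Gamma> r. (G x)\<^sup>2 \<partial>lborel))" for q q'
  have bb: "emeasure lborel (ball q s) = emeasure lborel (ball (0::'a) s)" "emeasure lborel (ball q s) \<noteq> \<infinity>" 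
      "emeasure lborel (ball q s) \<noteq> 0" for q :: 'a
  proof -
    have m: "emeasure lborel (ball q s) = ennreal (measure lebesgue (ball q s))" for q :: 'a
      using emeasure_eq_ennreal_measure[of lborel "ball q s"] emeasure_bounded_finite[OF bounded_ball, of q s] by simp
    show "emeasure lborel (ball q s) = emeasure lborel (ball (0::'a) s)"
      unfolding m using content_ball_conv_unit_ball[of s q] content_ball_conv_unit_ball[of s "0::'a"] s by simp
    show "emeasure lborel (ball q s) \<noteq> \<infinity>" "emeasure lborel (ball q s) \<noteq> 0"
      unfolding m using content_ball_pos[OF s, of q] by auto
  qed
  have conn: "R q q'" if "q \<in> \<Gamma>" "q' \<in> \<Gamma>" for q q'
  proof (rule connected_equivalence_relation[OF \<Gamma>(2) that])
    fix x y assume "R x y"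
    then obtain C where C: "0 \<le> C" "\<And>w G. upper_gradient_on (tube \<Gamma> r) w G \<Longrightarrow> 
       square_diff w (ball x s) (ball y s) \<le> ennreal C * (\<integral>\<^sup>+x\<in>tube \<Gamma> r. (G x)\<^sup>2 \<partial>lborel)"
      unfolding R_def by blast
    have "square_diff w (ball y s) (ball x s) = square_diff w (ball x s) (ball y s)" if "upper_gradient_on (tube \<Gamma> r) w G" for w G
      using that by (intro square_diff_commute) (auto simp: upper_gradient_on_def)
    then show "R y x" unfolding R_def using C by (intro exI[of _ C]) auto
  next
    fix x y z assume xyz: "R x y" "R y z"
    obtain C1 where C1: "0 \<le> C1" "\<And>w G. upper_gradient_on (tube \<Gamma> r) w G \<Longrightarrow> square_diff w (ball x s) (ball y s) \<le> ennreal C1 * (\<integral>\<^sup>+x\<in>tube \<Gamma> r. (G x)\<^sup>2 \<partial>lborel)"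
      using xyz(1) unfolding R_def by blast
    obtain C2 where C2: "0 \<le> C2" "\<And>w G. upper_gradient_on (tube \<Gamma> r) w G \<Longrightarrow> square_diff w (ball y s) (ball z s) \<le> ennreal C2 * (\<integral>\<^sup>+x\<in>tube \<Gamma> r. (G x)\<^sup>2 \<partial>lborel)"
      using xyz(2) unfolding R_def by blast
    show "R x z" unfolding R_def
    proof (intro exI[of _ "2 * (C1 + C2)"] conjI allI impI)
      fix w G assume wG: "upper_gradient_on (tube \<Gamma> r) w G"
      let ?E = "\<integral>\<^sup>+x\<in>tube \<Gamma> r. (G x)\<^sup>2 \<partial>lborel" and ?b = "emeasure lborel (ball (0::'a) s)"
      \<comment> \<open>Equal radii give equal volumes, so the weights in the triangle inequality
        cancel.\<close>
      have "?b * square_diff w (ball x s) (ball z s) \<le> 2 * (?b * square_diff w (ball x s) (ball y s) + ?b * square_diff w (ball y s) (ball z s))"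
        using square_diff_triangle[of w "ball x s" "ball y s" "ball z s"] wG bb(1)[of x] bb(1)[of y] bb(1)[of z]
        by (simp add: upper_gradient_on_def)
      also have "\<dots> \<le> 2 * (?b * (ennreal C1 * ?E) + ?b * (ennreal C2 * ?E))"
        using C1(2)[OF wG] C2(2)[OF wG] by (intro mult_left_mono add_mono) auto
      also have "\<dots> = ?b * (ennreal (2 * (C1 + C2)) * ?E)"
        using C1(1) C2(1) by (simp add: ennreal_mult distrib_left distrib_right mult_ac)
      finally show "square_diff w (ball x s) (ball z s) \<le> ennreal (2 * (C1 + C2)) * ?E"
        using bb(2,3)[of 0] by (simp add: ennreal_mult_le_mult_iff)
    qed (use C1(1) C2(1) in simp)
  next
    fix a assume a: "a \<in> \<Gamma>"
    have "R a x" if x: "x \<in> \<Gamma> \<inter> ball a s" for x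
      unfolding R_def
    proof (intro exI[of _ "(4 * s)\<^sup>2 * 2 ^ DIM('a) * measure lebesgue (ball a (2 * s))"] conjI allI impI)
      fix w G assume wG: "upper_gradient_on (tube \<Gamma> r) w G"
      have sub: "ball a (2 * s) \<subseteq> tube \<Gamma> r"
      proof
        fix y assume "y \<in> ball a (2 * s)"
        then show "y \<in> tube \<Gamma> r" using infdist_le[OF a, of y] s by (auto simp: tube_def s_def dist_commute)
      qed
      have "square_diff w (ball a s) (ball x s) \<le> square_diff w (ball a (2 * s)) (ball a (2 * s))"
      proof (rule square_diff_mono)
        show "ball a s \<subseteq> ball a (2 * s)" using s by (intro subset_ball) simp
        show "ball x s \<subseteq> ball a (2 * s)"
        proof
          fix y assume "y \<in> ball x s"
          then show "y \<in> ball a (2 * s)" using x dist_triangle[of a y x] by simp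
        qed
      qed
      also have "\<dots> \<le> ennreal ((4 * s)\<^sup>2 * 2 ^ DIM('a)) * emeasure lborel (ball a (2 * s)) * (\<integral>\<^sup>+x\<in>ball a (2 * s). (G x)\<^sup>2 \<partial>lborel)"
      proof (rule convex_poincare)
        fix x y assume xy: "x \<in> ball a (2 * s)" "y \<in> ball a (2 * s)"
        show "norm (x - y) \<le> 4 * s" using xy dist_triangle[of x y a] by (simp add: dist_norm norm_minus_commute)
        show "ennreal \<bar>w x - w y\<bar> \<le> ennreal (norm (x - y)) * (\<integral>\<^sup>+t\<in>{0..1}. G (x + t *\<^sub>R (y - x)) \<partial>lborel)"
          using wG xy sub closed_segment_subset[OF xy convex_ball] unfolding upper_gradient_on_def by blast
      qed (use wG in \<open>auto simp: upper_gradient_on_def\<close>)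
      also have "\<dots> \<le> ennreal ((4 * s)\<^sup>2 * 2 ^ DIM('a)) * emeasure lborel (ball a (2 * s)) * (\<integral>\<^sup>+x\<in>tube \<Gamma> r. (G x)\<^sup>2 \<partial>lborel)"
        using sub by (intro mult_left_mono nn_integral_mono) (auto simp: indicator_def)
      also have "ennreal ((4 * s)\<^sup>2 * 2 ^ DIM('a)) * emeasure lborel (ball a (2 * s)) = ennreal ((4 * s)\<^sup>2 * 2 ^ DIM('a) * measure lebesgue (ball a (2 * s)))"
        using emeasure_eq_ennreal_measure[of lborel "ball a (2 * s)"] emeasure_bounded_finite[OF bounded_ball, of a "2 * s"]
        by (simp add: ennreal_mult)
      finally show "square_diff w (ball a s) (ball x s) \<le> ennreal ((4 * s)\<^sup>2 * 2 ^ DIM('a) * measure lebesgue (ball a (2 * s))) * (\<integral>\<^sup>+x\<in>tube \<Gamma> r. (G x)\<^sup>2 \<partial>lborel)" .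
    qed simp
    then show "\<exists>T. openin (top_of_set \<Gamma>) T \<and> a \<in> T \<and> (\<forall>x\<in>T. R a x)"
      using a s by (intro exI[of _ "\<Gamma> \<inter> ball a s"]) auto
  qed
  define c where "c q q' = (SOME C. 0 \<le> C \<and> (\<forall>w G. upper_gradient_on (tube \<Gamma> r) w G \<longrightarrow>
     square_diff w (ball q s) (ball q' s) \<le> ennreal C * (\<integral>\<^sup>+x\<in>tube \<Gamma> r. (G x)\<^sup>2 \<partial>lborel)))" for q q'
  have c': "0 \<le> c q q' \<and> (\<forall>w G. upper_gradient_on (tube \<Gamma> r) w G \<longrightarrow>
     square_diff w (ball q s) (ball q' s) \<le> ennreal (c q q') * (\<integral>\<^sup>+x\<in>tube \<Gamma> r. (G x)\<^sup>2 \<partial>lborel))"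
    if "q \<in> \<Gamma>" "q' \<in> \<Gamma>" for q q'
    unfolding c_def by (rule someI_ex) (use conn[OF that] in \<open>unfold R_def\<close>)
  have c: "\<And>q q'. q \<in> \<Gamma> \<Longrightarrow> q' \<in> \<Gamma> \<Longrightarrow> 0 \<le> c q q'"
    "\<And>q q' w G. q \<in> \<Gamma> \<Longrightarrow> q' \<in> \<Gamma> \<Longrightarrow> upper_gradient_on (tube \<Gamma> r) w G \<Longrightarrow>
     square_diff w (ball q s) (ball q' s) \<le> ennreal (c q q') * (\<integral>\<^sup>+x\<in>tube \<Gamma> r. (G x)\<^sup>2 \<partial>lborel)"
    using c' by blast+
  have "\<Gamma> \<subseteq> (\<Union>q\<in>\<Gamma>. ball q (s / 2))" using s by auto
  then obtain I where I: "I \<subseteq> \<Gamma>" "finite I" "\<Gamma> \<subseteq> (\<Union>q\<in>I. ball q (s / 2))"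
    using compactE_image[OF \<Gamma>(1), of \<Gamma> "\<lambda>q. ball q (s / 2)"] by (metis open_ball)
  have cover: "tube \<Gamma> (r/6) \<subseteq> (\<Union>q\<in>I. ball q s)"
  proof
    fix x assume x: "x \<in> tube \<Gamma> (r/6)"
    obtain y where y: "y \<in> \<Gamma>" "infdist x \<Gamma> = dist x y"
      using infdist_attains_inf[OF compact_imp_closed[OF \<Gamma>(1)] \<Gamma>(3)] by blast
    then obtain q where "q \<in> I" "dist q y < s / 2" using I by force
    moreover have "dist x y < s / 2" using x y by (simp add: tube_def s_def)
    ultimately have "dist q x < s" using dist_triangle[of q x y] by (simp add: dist_commute)
    then show "x \<in> (\<Union>q\<in>I. ball q s)" using \<open>q \<in> I\<close> by auto
  qed
  show ?thesis
  proof (rule that)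
    show "0 < 1 + (\<Sum>i\<in>I. \<Sum>j\<in>I. c i j)" using c(1) I by (intro add_pos_nonneg sum_nonneg) auto
    fix w G assume wG: "upper_gradient_on (tube \<Gamma> r) w G"
    let ?E = "\<integral>\<^sup>+x\<in>tube \<Gamma> r. (G x)\<^sup>2 \<partial>lborel"
    have "square_diff w (tube \<Gamma> (r/6)) (tube \<Gamma> (r/6)) \<le> (\<Sum>i\<in>I. \<Sum>j\<in>I. square_diff w (ball i s) (ball j s))"
      using I(2) wG cover by (intro square_diff_UN) (auto simp: upper_gradient_on_def)
    also have "\<dots> \<le> (\<Sum>i\<in>I. \<Sum>j\<in>I. ennreal (c i j) * ?E)"
      using I(1) by (intro sum_mono c(2)[OF _ _ wG]) auto
    also have "\<dots> = ennreal (\<Sum>i\<in>I. \<Sum>j\<in>I. c i j) * ?E"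
      using c(1) I(1) by (simp add: sum_distrib_right[symmetric] sum_nonneg subset_iff cong: sum.cong)
    also have "\<dots> \<le> ennreal (1 + (\<Sum>i\<in>I. \<Sum>j\<in>I. c i j)) * ?E"
      by (intro mult_right_mono ennreal_leI) auto
    finally show "square_diff w (tube \<Gamma> (r/6)) (tube \<Gamma> (r/6)) \<le> ennreal (1 + (\<Sum>i\<in>I. \<Sum>j\<in>I. c i j)) * ?E" .
  qed
qed

section \<open>Lifting to the discrete surface\<close>

text \<open>Applied with \<open>P\<close> the projector onto the plane of a simplex and
  \<open>Q\<close> the one onto the tangent space: a displacement normal to the simplex is the
  normal component of a displacement along a fibre of \<open>p\<close>. This makes the straightening
  map reach a whole normal box.\<close>

lemma projector_lift:
  fixes P Q :: "'a::euclidean_space \<Rightarrow> 'a"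
  assumes P: "is_projector P" and Q: "is_projector Q"
    and PQ: "\<And>u. norm (Q u - P u) \<le> 1/4 * norm u" and n: "P n = 0"
  obtains m where "Q m = 0" "m - P m = n" "norm m \<le> 2 * norm n"
proof -
  have lin: "linear P" "linear Q" using P Q projector_linear by auto
  (* W = P Q + (1 - P) (1 - Q) is close to the identity, hence onto *)
  define W where "W u = P (Q u) + ((u - Q u) - P (u - Q u))" for u
  have linW: "linear W"
    unfolding W_def using lin
    by (intro linear_compose_add linear_compose_sub linear_ident linear_compose[of Q P, unfolded o_def]
         linear_compose[of "\<lambda>u. u - Q u" P, unfolded o_def])
  have Wu: "norm (W u - u) \<le> 1/2 * norm u" for u
  proof -
    have "W u - u = P (Q u - P u) - (Q (Q u) - P (Q u))"
      unfolding W_def using lin projector_idem[OF P, of u] projector_idem[OF Q, of u]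
      by (simp add: linear_diff)
    also have "norm \<dots> \<le> norm (P (Q u - P u)) + norm (Q (Q u) - P (Q u))" by (rule norm_triangle_ineq4)
    also have "\<dots> \<le> norm (Q u - P u) + 1/4 * norm (Q u)"
      using PQ by (intro add_mono projector_norm_le[OF P])
    also have "\<dots> \<le> 1/4 * norm u + 1/4 * norm u"
      using PQ[of u] projector_norm_le(1)[OF Q, of u] by (intro add_mono) auto
    finally show ?thesis by simp
  qed
  have "u = 0" if "W u = 0" for u
    using Wu[of u] that by simp
  then have "inj W" using linear_injective_0[OF linW] by blast
  then have "surj W" using linear_injective_imp_surjective[OF linW] by simp
  then obtain u where u: "W u = n" by (metis surjD)
  define m where "m = u - Q u"
  have Qm: "Q m = 0" unfolding m_def using lin projector_idem[OF Q] by (simp add: linear_diff)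
  have "m - P m = n - P n"
  proof -
    have "P n = P (Q u)" 
      unfolding u[symmetric] W_def using lin projector_idem[OF P] by (simp add: linear_add linear_diff)
    then show ?thesis unfolding m_def using u by (simp add: W_def algebra_simps)
  qed
  then have mn: "m - P m = n" using n by simp
  have "norm (P m) \<le> 1/4 * norm m" using PQ[of m] Qm by simp
  moreover have "norm m - norm (P m) \<le> norm n" using norm_triangle_ineq2[of m "P m"] mn by simp
  moreover have "0 \<le> norm n" by simp
  ultimately have "norm m \<le> 2 * norm n" by linarith
  then show ?thesis using that Qm mn by blast
qed

text \<open>A vector in the range of \<open>P\<close> that \<open>Q\<close> annihilates would have
  to be at most a quarter of its own length. Used in both directions, the lemma identifies the
  dimension of the tangent space with that of a simplex.\<close>

lemma projector_dim_le:
  fixes P Q :: "'a::euclidean_space \<Rightarrow> 'a"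
  assumes P: "is_projector P" and Q: "is_projector Q" and PQ: "\<And>u. norm (Q u - P u) \<le> 1/4 * norm u"
  shows "dim (range P) \<le> dim (range Q)"
proof -
  have sub: "subspace (range P)" using projector_linear[OF P] by (simp add: linear_subspace_image)
  have "inj_on Q (range P)"
    unfolding linear_inj_on_iff_eq_0[OF projector_linear[OF Q] sub]
  proof (intro ballI impI)
    fix x assume "x \<in> range P" "Q x = 0"
    then have "norm x \<le> 1/4 * norm x" using PQ[of x] projector_idem[OF P] by auto
    then show "x = 0" by simp
  qed
  then have "dim (range P) = dim (Q ` range P)"
    using dim_image_eq[OF projector_linear[OF Q], of "range P"] sub by (simp add: span_eq_iff[THEN iffD2])
  also have "\<dots> \<le> dim (range Q)" by (intro dim_subset) auto
  finally show ?thesis .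
qed

text \<open>The third property records that points are removed only where they belong to another
  member. For simplices this is a null set, so the disjoint pieces still carry the full
  area.\<close>

lemma disjoint_refinement:
  assumes "finite I" "\<And>i. i \<in> I \<Longrightarrow> A i \<in> sets M"
  obtains f where "\<And>i. i \<in> I \<Longrightarrow> f i \<subseteq> A i" "\<And>i. i \<in> I \<Longrightarrow> f i \<in> sets M"
    "\<And>i. i \<in> I \<Longrightarrow> A i - f i \<subseteq> (\<Union>j\<in>I - {i}. A j)" "disjoint_family_on f I" "(\<Union>i\<in>I. f i) = (\<Union>i\<in>I. A i)"
proof -
  have "\<exists>f. (\<forall>i\<in>I. f i \<subseteq> A i \<and> f i \<in> sets M \<and> A i - f i \<subseteq> (\<Union>j\<in>I - {i}. A j)) \<and>
     disjoint_family_on f I \<and> (\<Union>i\<in>I. f i) = (\<Union>i\<in>I. A i)"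
    using assms
  proof (induction I)
    case empty
    then show ?case by (auto simp: disjoint_family_on_def)
  next
    case (insert i I)
    then obtain f where f: "\<forall>i\<in>I. f i \<subseteq> A i \<and> f i \<in> sets M \<and> A i - f i \<subseteq> (\<Union>j\<in>I - {i}. A j)"
      "disjoint_family_on f I" "(\<Union>i\<in>I. f i) = (\<Union>i\<in>I. A i)" by auto
    define g where "g = f(i := A i - (\<Union>j\<in>I. A j))"
    have gi: "g i = A i - (\<Union>j\<in>I. A j)" and gj: "j \<in> I \<Longrightarrow> g j = f j" for j
      using insert.hyps by (auto simp: g_def)
    have U: "(\<Union>j\<in>I. g j) = (\<Union>j\<in>I. A j)" using f(3) gj by auto
    have "A i - (\<Union>j\<in>I. A j) \<in> sets M" using insert by (intro sets.Diff sets.finite_UN) auto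
    then have "\<forall>j\<in>insert i I. g j \<subseteq> A j \<and> g j \<in> sets M \<and> A j - g j \<subseteq> (\<Union>k\<in>insert i I - {j}. A k)"
      using f(1) gi gj insert.hyps by (auto 0 3)
    moreover have "disjoint_family_on g (insert i I)"
    proof -
      have "g i \<inter> (\<Union>j\<in>I. g j) = {}" unfolding U gi by auto
      then show ?thesis using f(2) gj insert.hyps
        by (auto simp: disjoint_family_on_def)
    qed
    moreover have "(\<Union>j\<in>insert i I. g j) = (\<Union>j\<in>insert i I. A j)" using U gi by auto
    ultimately show ?case by blast
  qed
  then obtain f where f: "\<forall>i\<in>I. f i \<subseteq> A i \<and> f i \<in> sets M \<and> A i - f i \<subseteq> (\<Union>j\<in>I - {i}. A j)"
    "disjoint_family_on f I" "(\<Union>i\<in>I. f i) = (\<Union>i\<in>I. A i)" by blast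
  show ?thesis by (rule that[of f]) (use f in simp_all)
qed

lemma ennreal_mult_three:
  "0 \<le> a \<Longrightarrow> 0 \<le> b \<Longrightarrow> 0 \<le> c \<Longrightarrow> ennreal a * (ennreal b * (x * ennreal c)) = ennreal (a * b * c) * x"
  by (simp add: ennreal_mult mult_ac)

section \<open>Constants of the lift that depend on the manifold and the dimension only\<close>

context tubular begin

lemma p_continuous: "continuous_on (tube \<Gamma> r) p"
  using p_deriv by (intro differentiable_imp_continuous_on)
    (auto simp: differentiable_on_eq_differentiable_at open_tube differentiable_def)

lemma bounded_tube: "bounded (tube \<Gamma> s)"
proof -
  have "tube \<Gamma> s \<subseteq> {x. infdist x \<Gamma> \<le> \<bar>s\<bar> + 1}" by (auto simp: tube_def)
  moreover have "compact {x. infdist x \<Gamma> \<le> \<bar>s\<bar> + 1}"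
    by (rule compact_infdist_le[OF nonempty_\<Gamma> compact_\<Gamma>]) simp
  ultimately show ?thesis using bounded_subset compact_imp_bounded by blast
qed

text \<open>Lipschitz constant of the inverse of \<open>straighten\<close>: \<open>\<Lambda>\<close>
  for the projections, 2 for the normal offsets, and the last term for the turning of the normal
  spaces along \<open>\<Gamma>\<close>.\<close>

definition fibre_lipschitz :: real where "fibre_lipschitz = \<Lambda> + 2 + 2 * \<Lambda>\<^sup>2 * r"

text \<open>The factors are the covering loss for the inverse of \<open>straighten\<close>, the
  frame loss, and the cross-section of a normal box of half-width \<open>r\<close>.\<close>

definition upper_const :: "nat \<Rightarrow> real" where
  "upper_const d = (2 * fibre_lipschitz * real DIM('a)) ^ DIM('a) * (2 * real DIM('a)) ^ DIM('a) * (2 * r) ^ (DIM('a) - d)"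

text \<open>The divisor is the cross-section of a normal box of half-width
  \<open>s / (4 * DIM('a))\<close>, which \<open>lift_measure_lower\<close> fills from the tube of
  radius \<open>s\<close>.\<close>

definition lower_const :: "nat \<Rightarrow> real \<Rightarrow> real" where
  "lower_const d s = (2 * real DIM('a)) ^ DIM('a) * (2 * (3 * \<Lambda> + 1) * real DIM('a)) ^ DIM('a) / (s / (2 * real DIM('a))) ^ (DIM('a) - d)"

lemma fibre_lipschitz_pos: "0 < fibre_lipschitz"
  using \<Lambda>_ge1 r_pos unfolding fibre_lipschitz_def by (intro add_pos_nonneg) auto

lemma upper_const_pos: "0 < upper_const d"
  using fibre_lipschitz_pos r_pos by (simp add: upper_const_def)

lemma lower_const_pos: "0 < s \<Longrightarrow> 0 < lower_const d s"
  using \<Lambda>_ge1 by (auto simp: lower_const_def intro!: mult_pos_pos divide_pos_pos)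

end

text \<open>The mesh width has disappeared: \<open>\<eta>\<close> bounds the distance to
  \<open>\<Gamma>\<close>, and the two bounds 1/4 together keep the derivative of \<open>p\<close>
  along a simplex within 1/2 of the identity.\<close>

locale discrete_surface = tubular \<Gamma> p D r \<Lambda>
  for \<Gamma> :: "'a::euclidean_space set" and p D r \<Lambda> +
  fixes d :: nat and \<K> :: "'a set set" and \<eta> :: real
  assumes triang: "triangulation \<K>" and simplices: "K \<in> \<K> \<Longrightarrow> int d simplex K"
    and bij: "bij_betw p (\<Union>\<K>) \<Gamma>"
    and \<eta>: "\<eta> < r" "\<Lambda> * \<eta> \<le> 1/4"
    and near: "x \<in> \<Union>\<K> \<Longrightarrow> norm (x - p x) \<le> \<eta>"
    and D_near_parallel: "K \<in> \<K> \<Longrightarrow> x \<in> K \<Longrightarrow> norm (D (p x) u - orth_proj (parallel_space K) u) \<le> 1/4 * norm u"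
begin

lemma finite_\<K>: "finite \<K>" using triang by (simp add: triangulation_def)

lemma K_props:
  assumes "K \<in> \<K>"
  shows "convex K" "compact K" "closed K" "bounded K" "K \<noteq> {}" "aff_dim K = int d" "K \<in> sets borel" "dim (parallel_space K) = d"
proof -
  note s = simplices[OF assms]
  show 1: "convex K" "compact K" "aff_dim K = int d"
    using s by (auto simp: convex_simplex compact_simplex aff_dim_simplex)
  then show "closed K" "bounded K" "K \<in> sets borel" by (auto simp: compact_imp_closed compact_imp_bounded)
  show ne: "K \<noteq> {}" using 1 by auto
  show "dim (parallel_space K) = d" using dim_parallel_space[OF ne] 1 by simp
qed

lemma surface_in_tube: "\<Union>\<K> \<subseteq> tube \<Gamma> r"
proof
  fix x assume "x \<in> \<Union>\<K>"
  then show "x \<in> tube \<Gamma> r" using near[of x] \<eta> p_dist[of x] by (simp add: tube_def)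
qed

text \<open>Along the segment from \<open>a\<close> to \<open>b\<close>, the derivative of
  \<open>p\<close> differs from the identity by at most 1/4 for the distance to
  \<open>\<Gamma>\<close> plus 1/4 for the angle between simplex and tangent plane. Hence
  \<open>p b - p a\<close> differs from \<open>b - a\<close> by at most half its length. Convexity
  ties the argument to a single simplex.\<close>

lemma p_expanding:
  assumes K: "K \<in> \<K>" and ab: "a \<in> K" "b \<in> K"
  shows "norm (a - b) \<le> 2 * norm (p a - p b)"
proof -
  let ?L = "parallel_space K"
  define u where "u = b - a"
  have u: "u \<in> ?L" unfolding u_def using ab by (rule parallel_space_diff[rotated])
  define \<phi> where "\<phi> t = p (a + t *\<^sub>R u) - t *\<^sub>R u" for t :: real
  have zK: "a + t *\<^sub>R u \<in> K" if "t \<in> {0..1}" for t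
    using convexD_alt[OF K_props(1)[OF K] ab, of t] that by (simp add: u_def algebra_simps)
  have "norm (\<phi> 1 - \<phi> 0) \<le> (1/2 * norm u) * norm (1 - 0 :: real)"
  proof (rule differentiable_bound[of "{0..1::real}" \<phi> "\<lambda>t s. D (a + t *\<^sub>R u) (s *\<^sub>R u) - s *\<^sub>R u"])
    fix t :: real assume t: "t \<in> {0..1}"
    let ?z = "a + t *\<^sub>R u"
    have zU: "?z \<in> tube \<Gamma> r" using zK[OF t] K surface_in_tube by blast
    have "((\<lambda>t. a + t *\<^sub>R u) has_derivative (\<lambda>s. s *\<^sub>R u)) (at t)"
      by (auto intro!: derivative_eq_intros)
    from has_derivative_compose[OF this p_deriv[OF zU]]
    have "((\<lambda>t. p (a + t *\<^sub>R u)) has_derivative (\<lambda>s. D ?z (s *\<^sub>R u))) (at t)" .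
    then have "(\<phi> has_derivative (\<lambda>s. D ?z (s *\<^sub>R u) - s *\<^sub>R u)) (at t)"
      unfolding \<phi>_def by (auto intro!: derivative_eq_intros)
    then show "(\<phi> has_derivative (\<lambda>s. D ?z (s *\<^sub>R u) - s *\<^sub>R u)) (at t within {0..1})"
      by (rule has_derivative_at_withinI)
    have lin: "linear (D ?z)" using p_deriv[OF zU] by (rule has_derivative_linear)
    have "norm (D ?z u - u) \<le> norm (D ?z u - D (p ?z) u) + norm (D (p ?z) u - u)"
      using norm_triangle_ineq[of "D ?z u - D (p ?z) u" "D (p ?z) u - u"] by simp
    also have "norm (D ?z u - D (p ?z) u) \<le> 1/4 * norm u"
    proof -
      have "norm (D ?z u - D (p ?z) u) \<le> \<Lambda> * norm (?z - p ?z) * norm u" by (rule D_near[OF zU])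
      also have "\<dots> \<le> \<Lambda> * \<eta> * norm u" 
        using near[of ?z] zK[OF t] K \<Lambda>_ge1 by (intro mult_right_mono mult_left_mono) auto
      also have "\<dots> \<le> 1/4 * norm u" using \<eta> by (intro mult_right_mono) auto
      finally show ?thesis .
    qed
    also have "norm (D (p ?z) u - u) \<le> 1/4 * norm u"
      using D_near_parallel[OF K zK[OF t], of u] orth_proj_id[OF subspace_parallel_space u] by simp
    finally have b: "norm (D ?z u - u) \<le> 1/2 * norm u" by simp
    show "onorm (\<lambda>s. D ?z (s *\<^sub>R u) - s *\<^sub>R u) \<le> 1/2 * norm u"
    proof (rule onorm_le)
      fix s :: real
      have "D ?z (s *\<^sub>R u) - s *\<^sub>R u = s *\<^sub>R (D ?z u - u)" using lin by (simp add: linear_cmul scaleR_diff_right)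
      then have "norm (D ?z (s *\<^sub>R u) - s *\<^sub>R u) = norm s * norm (D ?z u - u)" by simp
      also have "\<dots> \<le> norm s * (1/2 * norm u)" using b by (intro mult_left_mono) auto
      finally show "norm (D ?z (s *\<^sub>R u) - s *\<^sub>R u) \<le> 1/2 * norm u * norm s" by (simp add: mult_ac)
    qed
  qed auto
  then have "norm ((p b - p a) - (b - a)) \<le> 1/2 * norm (b - a)" by (simp add: \<phi>_def u_def algebra_simps)
  then have "norm (b - a) \<le> norm (p b - p a) + 1/2 * norm (b - a)"
    using norm_triangle_ineq2[of "b - a" "p b - p a"] norm_minus_commute[of "b - a" "p b - p a"] by linarith
  then show ?thesis by (simp add: norm_minus_commute)
qed

text \<open>The map \<pi> of the overview, defined at every point because \<open>p\<close> sends
  every point into \<open>\<Gamma>\<close>.\<close>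

definition lift :: "'a \<Rightarrow> 'a" where "lift x = the_inv_into (\<Union>\<K>) p (p x)"

lemma lift_mem: "lift x \<in> \<Union>\<K>"
  unfolding lift_def using bij p_mem by (intro the_inv_into_into) (auto simp: bij_betw_def)

lemma p_lift: "p (lift x) = p x"
  unfolding lift_def using bij p_mem by (intro f_the_inv_into_f) (auto simp: bij_betw_def)

lemma lift_eqI: "y \<in> \<Union>\<K> \<Longrightarrow> p y = p x \<Longrightarrow> lift x = y"
  unfolding lift_def using bij the_inv_into_f_f[of p "\<Union>\<K>" y] by (simp add: bij_betw_def)

text \<open>A continuous bijection from the compact surface has a continuous inverse. This covers
  the passage between simplices, about which \<open>p_expanding\<close> says nothing.\<close>

lemma lift_continuous: "continuous_on (tube \<Gamma> r) lift"
proof -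
  have comp: "compact (\<Union>\<K>)" using finite_\<K> K_props(2) by (intro compact_Union) auto
  have "continuous_on (p ` \<Union>\<K>) (the_inv_into (\<Union>\<K>) p)"
    using comp bij by (intro continuous_on_inv continuous_on_subset[OF p_continuous surface_in_tube])
      (auto simp: bij_betw_def the_inv_into_f_f)
  then show ?thesis
    unfolding lift_def[abs_def] using bij p_mem
    by (intro continuous_on_compose2[OF _ p_continuous]) (auto simp: bij_betw_def)
qed

lemma lift_preimage_borel:
  assumes A: "A \<in> sets borel" and s: "s \<le> r"
  shows "{x \<in> tube \<Gamma> s. lift x \<in> A} \<in> sets borel"
proof -
  have "lift -` A \<inter> space (restrict_space borel (tube \<Gamma> s)) \<in> sets (restrict_space borel (tube \<Gamma> s))"
    using s by (intro measurable_sets[OF borel_measurable_continuous_on_restrict A] 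
        continuous_on_subset[OF lift_continuous]) (auto simp: tube_def)
  then have "lift -` A \<inter> tube \<Gamma> s \<in> sets borel"
    using open_tube[of \<Gamma> s] by (auto simp: sets_restrict_space_iff space_restrict_space)
  moreover have "lift -` A \<inter> tube \<Gamma> s = {x \<in> tube \<Gamma> s. lift x \<in> A}" by auto
  ultimately show ?thesis by simp
qed

lemma lift_lipschitz:
  assumes K: "K \<in> \<K>" and x: "x \<in> tube \<Gamma> r" "y \<in> tube \<Gamma> r" "lift x \<in> K" "lift y \<in> K"
  shows "norm (lift x - lift y) \<le> 2 * \<Lambda> * norm (x - y)"
proof -
  have "norm (lift x - lift y) \<le> 2 * norm (p x - p y)" using p_expanding[OF K x(3,4)] by (simp add: p_lift)
  then show ?thesis using p_lip[OF x(1,2)] by linarith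
qed

section \<open>Straightening the fibres over one simplex\<close>

definition straighten :: "'a set \<Rightarrow> 'a \<Rightarrow> 'a" where
  "straighten K x = lift x + ((x - p x) - orth_proj (parallel_space K) (x - p x))"

lemma straighten_lipschitz:
  assumes K: "K \<in> \<K>" and x: "x \<in> tube \<Gamma> r" "y \<in> tube \<Gamma> r" "lift x \<in> K" "lift y \<in> K"
  shows "norm (straighten K x - straighten K y) \<le> (3 * \<Lambda> + 1) * norm (x - y)"
proof -
  let ?P = "orth_proj (parallel_space K)"
  note P = is_projector_orth_proj[OF subspace_parallel_space[of K]]
  let ?m = "(x - p x) - (y - p y)"
  have "straighten K x - straighten K y = (lift x - lift y) + (?m - ?P ?m)"
    using projector_linear[OF P] by (simp add: straighten_def linear_diff)
  also have "norm \<dots> \<le> norm (lift x - lift y) + norm (?m - ?P ?m)" by (rule norm_triangle_ineq)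
  also have "norm (?m - ?P ?m) \<le> norm ?m" by (rule projector_norm_le[OF P])
  also have "?m = (x - y) - (p x - p y)" by simp
  also have "norm \<dots> \<le> norm (x - y) + norm (p x - p y)" by (rule norm_triangle_ineq4)
  finally have "norm (straighten K x - straighten K y) \<le> norm (lift x - lift y) + (norm (x - y) + norm (p x - p y))" by simp
  then show ?thesis using lift_lipschitz[OF assms] p_lip[OF x(1,2)] by (simp add: algebra_simps)
qed

text \<open>The component of \<open>m - m'\<close> in the plane of \<open>K\<close> is lost by
  \<open>straighten\<close> and has to be recovered. Each offset is annihilated by its own tangent
  projector, so this component consists of the deviation of \<open>K\<close> from the tangent plane,
  absorbed with factor 1/4, and the change of the projector from \<open>p y\<close> to
  \<open>p x\<close>, which is Lipschitz.\<close>

lemma straighten_expanding: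
  assumes K: "K \<in> \<K>" and x: "x \<in> tube \<Gamma> r" "y \<in> tube \<Gamma> r" "lift x \<in> K" "lift y \<in> K"
  shows "norm (x - y) \<le> fibre_lipschitz * norm (straighten K x - straighten K y)"
proof -
  let ?L = "parallel_space K"
  let ?P = "orth_proj ?L"
  note P = is_projector_orth_proj[OF subspace_parallel_space[of K]]
  note lin = projector_linear[OF P]
  define m m' where "m = x - p x" and "m' = y - p y"
  define a where "a = lift x - lift y"
  define n where "n = (m - m') - ?P (m - m')"
  have aL: "?P a = a" unfolding a_def using x by (intro orth_proj_id parallel_space_diff subspace_parallel_space)
  have Pn: "?P n = 0" unfolding n_def using lin projector_idem[OF P] by (simp add: linear_diff)
  have S: "straighten K x - straighten K y = a + n"
    using lin by (simp add: straighten_def linear_diff a_def n_def m_def m'_def)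
  have Pan: "?P (a + n) = a" using lin aL Pn by (simp add: linear_add)
  have an: "norm a \<le> norm (a + n)" "norm n \<le> norm (a + n)"
    using projector_norm_le[OF P, of "a + n"] Pan by simp_all
  have lxU: "lift x \<in> tube \<Gamma> r" "lift y \<in> tube \<Gamma> r" using lift_mem surface_in_tube by blast+
  have q: "norm (p x - p y) \<le> \<Lambda> * norm a" using p_lip[OF lxU] by (simp add: p_lift a_def)
  have Dlin: "linear (D (p x))" "linear (D (p y))" using projector_linear[OF D_proj[OF p_mem]] by auto
  have D0: "D (p x) m = 0" "D (p y) m' = 0" using D_normal x by (auto simp: m_def m'_def)
  have m'r: "norm m' \<le> r" using x p_dist[of y] by (simp add: m'_def tube_def)
  have "?P (m - m') = - (D (p x) (m - m') - ?P (m - m')) + (D (p y) m' - D (p x) m')"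
    using Dlin D0 by (simp add: linear_diff)
  also have "norm \<dots> \<le> norm (D (p x) (m - m') - ?P (m - m')) + norm (D (p y) m' - D (p x) m')"
    by (metis norm_minus_cancel norm_triangle_ineq)
  also have "\<dots> \<le> 1/4 * norm (m - m') + \<Lambda> * norm (p y - p x) * norm m'"
    using D_near_parallel[OF K x(3)] by (intro add_mono D_lip p_mem) (simp add: p_lift)
  also have "\<dots> \<le> 1/4 * norm (m - m') + \<Lambda> * (\<Lambda> * norm a) * r"
    using q m'r \<Lambda>_ge1 r_pos by (intro add_left_mono mult_mono) (auto simp: norm_minus_commute)
  finally have "norm (?P (m - m')) \<le> 1/4 * norm (m - m') + \<Lambda>\<^sup>2 * r * norm a" by (simp add: power2_eq_square mult_ac)
  have "norm (m - m') \<le> norm n + norm (?P (m - m'))"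
    using norm_triangle_ineq[of n "?P (m - m')"] by (simp add: n_def)
  then have mm: "norm (m - m') \<le> 2 * norm n + 2 * (\<Lambda>\<^sup>2 * r * norm a)" 
  proof -
    have "0 \<le> \<Lambda>\<^sup>2 * r * norm a" "0 \<le> norm n" using r_pos by simp_all
    then show ?thesis using \<open>norm (?P (m - m')) \<le> _\<close> \<open>norm (m - m') \<le> norm n + _\<close> by linarith
  qed
  have "x - y = (p x - p y) + (m - m')" by (simp add: m_def m'_def)
  then have "norm (x - y) \<le> norm (p x - p y) + norm (m - m')" by (metis norm_triangle_ineq)
  also have "\<dots> \<le> \<Lambda> * norm a + (2 * norm n + 2 * (\<Lambda>\<^sup>2 * r * norm a))" using q mm by linarith
  also have "\<dots> \<le> \<Lambda> * norm (a + n) + (2 * norm (a + n) + 2 * (\<Lambda>\<^sup>2 * r * norm (a + n)))"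
    using an \<Lambda>_ge1 r_pos by (intro add_mono mult_left_mono) auto
  also have "\<dots> = fibre_lipschitz * norm (a + n)" by (simp add: fibre_lipschitz_def algebra_simps)
  finally show ?thesis by (simp add: S)
qed

lemma flat_piece_exists:
  assumes K: "K \<in> \<K>" and \<rho>: "0 < \<rho>"
  obtains B where "flat_piece K B \<rho>" "card B = DIM('a) - d"
proof -
  obtain B where "orthonormal B" "card B = DIM('a) - dim (parallel_space K)" "span B = {x. \<forall>y\<in>parallel_space K. orthogonal y x}"
    by (rule orthogonal_complement_basis[OF subspace_parallel_space])
  then show ?thesis using K_props[OF K] \<rho> that[of B] by (auto simp: flat_piece_def)
qed

text \<open>The offset \<open>x - p x\<close> is shorter than \<open>r\<close>, and so is its normal
  component; hence \<open>straighten\<close> maps the preimage into a normal box over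
  \<open>A\<close>. The Lipschitz inverse, taken on the image as \<open>S0\<close> inside the box as
  \<open>S\<close>, bounds the volume.\<close>

lemma lift_measure_upper:
  assumes K: "K \<in> \<K>" and A: "A \<in> sets borel" "A \<subseteq> K"
  shows "emeasure lborel {x \<in> tube \<Gamma> r. lift x \<in> A} \<le> ennreal (upper_const d) * emeasure (flat_lborel K) A"
proof -
  obtain B where "flat_piece K B r" and cB: "card B = DIM('a) - d" by (rule flat_piece_exists[OF K r_pos])
  interpret F: flat_piece K B r by fact
  let ?P = "orth_proj (parallel_space K)"
  note P = is_projector_orth_proj[OF subspace_parallel_space[of K]]
  let ?X = "{x \<in> tube \<Gamma> r. lift x \<in> A}"
  define g where "g = the_inv_into ?X (straighten K)"
  have inj: "inj_on (straighten K) ?X"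
  proof (rule inj_onI)
    fix x y assume "x \<in> ?X" "y \<in> ?X" "straighten K x = straighten K y"
    then show "x = y" using straighten_expanding[OF K, of x y] A(2) by auto
  qed
  have gs: "g (straighten K x) = x" if "x \<in> ?X" for x unfolding g_def by (rule the_inv_into_f_f[OF inj that])
  have "emeasure lborel ?X \<le> ennreal ((2 * fibre_lipschitz * real DIM('a)) ^ DIM('a)) * emeasure lborel (normal_box B r A)"
  proof (rule lipschitz_image_emeasure_le)
    show "straighten K ` ?X \<subseteq> normal_box B r A"
    proof clarify
      fix x assume x: "x \<in> tube \<Gamma> r" "lift x \<in> A"
      let ?m = "x - p x"
      have "\<bar>(?m - ?P ?m) \<bullet> b\<bar> < r" if "b \<in> B" for b
      proof -
        have "\<bar>(?m - ?P ?m) \<bullet> b\<bar> \<le> norm (?m - ?P ?m) * norm b" by (rule Cauchy_Schwarz_ineq2)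
        also have "\<dots> \<le> norm ?m" using F.ortho' that projector_norm_le(2)[OF P, of ?m] by (simp add: orthonormal_def)
        also have "\<dots> < r" using x p_dist[of x] by (simp add: tube_def)
        finally show ?thesis .
      qed
      then show "straighten K x \<in> normal_box B r A"
        unfolding normal_box_def F.span_B' using orth_proj_residual[OF subspace_parallel_space, of ?m K] x
        by (intro CollectI bexI[of _ "lift x"]) (auto simp: straighten_def)
    qed
    show "norm (g u - g v) \<le> fibre_lipschitz * norm (u - v)" if "u \<in> straighten K ` ?X" "v \<in> straighten K ` ?X" for u v
      using that gs straighten_expanding[OF K] A(2) by (auto simp: subset_iff)
    show "?X \<subseteq> g ` straighten K ` ?X" using gs by force
    show "0 \<le> fibre_lipschitz" using \<Lambda>_ge1 r_pos by (simp add: fibre_lipschitz_def)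
  qed (use A F.normal_box_borel F.normal_box_bounded lift_preimage_borel in auto)
  also have "\<dots> \<le> ennreal ((2 * fibre_lipschitz * real DIM('a)) ^ DIM('a)) * (ennreal ((2 * real DIM('a)) ^ DIM('a)) * (emeasure (flat_lborel K) A * ennreal ((2 * r) ^ card B)))"
    by (intro mult_left_mono F.normal_box_le_flat_lborel A) auto
  also have "\<dots> = ennreal (upper_const d) * emeasure (flat_lborel K) A"
    unfolding upper_const_def cB
    using fibre_lipschitz_pos r_pos by (intro ennreal_mult_three) auto
  finally show ?thesis .
qed

text \<open>Here \<open>straighten\<close> itself is the Lipschitz map, and the point is that it
  reaches all of a sufficiently narrow normal box: \<open>projector_lift\<close> finds the offset
  and \<open>fibre\<close> confirms that adding it to \<open>p y\<close> does not change the
  projection.\<close>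

lemma lift_measure_lower:
  assumes K: "K \<in> \<K>" and A: "A \<in> sets borel" "A \<subseteq> K" and s: "0 < s" "s \<le> r"
  shows "emeasure (flat_lborel K) A \<le> ennreal (lower_const d s) * emeasure lborel {x \<in> tube \<Gamma> s. lift x \<in> A}"
proof -
  \<comment> \<open>Makes the normal offset \<open>n\<close> at most \<open>s / 4\<close> long.
    \<open>projector_lift\<close> at most doubles it, which leaves the preimage in the tube of
    radius \<open>s\<close>.\<close>
  define \<rho> where "\<rho> = s / (4 * real DIM('a))"
  have \<rho>: "0 < \<rho>" using s by (simp add: \<rho>_def)
  obtain B where "flat_piece K B \<rho>" and cB: "card B = DIM('a) - d" by (rule flat_piece_exists[OF K \<rho>])
  interpret F: flat_piece K B \<rho> by fact
  let ?P = "orth_proj (parallel_space K)"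
  note P = is_projector_orth_proj[OF subspace_parallel_space[of K]]
  let ?X = "{x \<in> tube \<Gamma> s. lift x \<in> A}"
  have sr: "tube \<Gamma> s \<subseteq> tube \<Gamma> r" using s by (auto simp: tube_def)
  have "emeasure lborel (normal_box B \<rho> A) \<le> ennreal ((2 * (3 * \<Lambda> + 1) * real DIM('a)) ^ DIM('a)) * emeasure lborel ?X"
  proof (rule lipschitz_image_emeasure_le[OF _ _ subset_refl])
    show "norm (straighten K x - straighten K y) \<le> (3 * \<Lambda> + 1) * norm (x - y)" if "x \<in> ?X" "y \<in> ?X" for x y
      using that sr A(2) by (intro straighten_lipschitz[OF K]) auto
    show "normal_box B \<rho> A \<subseteq> straighten K ` ?X"
    proof
      fix z assume "z \<in> normal_box B \<rho> A"
      then obtain y where y: "y \<in> A" "z - y \<in> span B" "\<forall>b\<in>B. \<bar>(z - y) \<bullet> b\<bar> < \<rho>"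
        by (auto simp: normal_box_def)
      define n where "n = z - y"
      have Pn: "?P n = 0" using y(2) F.span_B' orth_proj_zero_iff[OF subspace_parallel_space[of K]] by (simp add: n_def)
      have "norm n = norm (\<Sum>b\<in>B. (n \<bullet> b) *\<^sub>R b)" using orthonormal_expand[OF F.ortho', of n] y(2) by (simp add: n_def)
      also have "\<dots> \<le> (\<Sum>b\<in>B. \<rho>)"
        using y(3) by (intro orthonormal_sum_norm_le[OF F.ortho']) (auto simp: n_def less_imp_le)
      also have "\<dots> \<le> real DIM('a) * \<rho>" using cB \<rho> by (simp add: mult_right_mono)
      also have "\<dots> = s / 4" by (simp add: \<rho>_def)
      finally have ns: "norm n \<le> s / 4" .
      have yK: "y \<in> K" using y A by blast
      obtain m where m: "D (p y) m = 0" "m - ?P m = n" "norm m \<le> 2 * norm n"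
        by (rule projector_lift[OF P D_proj[OF p_mem] D_near_parallel[OF K yK] Pn])
      define x where "x = p y + m"
      have ms: "norm m < s" using m(3) ns s by linarith
      have px: "p x = p y" unfolding x_def by (rule fibre[OF p_mem m(1)]) (use ms s in simp)
      have "infdist x \<Gamma> < s" using infdist_le[OF p_mem, of x y] ms by (simp add: x_def dist_norm)
      then have xs: "x \<in> tube \<Gamma> s" by (simp add: tube_def)
      have lx: "lift x = y" by (rule lift_eqI) (use yK K px in auto)
      have "straighten K x = z" using m(2) px lx by (simp add: straighten_def x_def n_def)
      then show "z \<in> straighten K ` ?X" using xs lx y by (intro image_eqI[of _ _ x]) auto
    qed
    show "bounded ?X" by (rule bounded_subset[OF bounded_tube[of s]]) auto
  qed (use A s \<Lambda>_ge1 F.normal_box_borel lift_preimage_borel in auto)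
  then have "ennreal ((2 * real DIM('a)) ^ DIM('a)) * emeasure lborel (normal_box B \<rho> A)
     \<le> ennreal ((2 * real DIM('a)) ^ DIM('a)) * (ennreal ((2 * (3 * \<Lambda> + 1) * real DIM('a)) ^ DIM('a)) * emeasure lborel ?X)"
    by (rule mult_left_mono) simp
  with F.flat_lborel_le_normal_box[OF A]
  have le: "emeasure (flat_lborel K) A * ennreal ((2 * \<rho>) ^ card B) \<le> ennreal ((2 * real DIM('a)) ^ DIM('a)) * (ennreal ((2 * (3 * \<Lambda> + 1) * real DIM('a)) ^ DIM('a)) * emeasure lborel ?X)"
    by (rule order_trans)
  define c1 c2 c3 where "c1 = (2 * real DIM('a)) ^ DIM('a)" and "c2 = (2 * (3 * \<Lambda> + 1) * real DIM('a)) ^ DIM('a)" and "c3 = (2 * \<rho>) ^ card B"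
  have c: "0 \<le> c1" "0 \<le> c2" "0 < c3" using \<Lambda>_ge1 \<rho> by (auto simp: c1_def c2_def c3_def)
  have lc: "lower_const d s = c1 * c2 / c3" by (simp add: lower_const_def c1_def c2_def c3_def cB \<rho>_def)
  have "emeasure (flat_lborel K) A = emeasure (flat_lborel K) A * ennreal c3 * ennreal (1 / c3)"
    using c by (simp add: mult.assoc ennreal_mult[symmetric])
  also have "\<dots> \<le> (ennreal c1 * (ennreal c2 * emeasure lborel ?X)) * ennreal (1 / c3)"
    using le unfolding c1_def c2_def c3_def by (rule mult_right_mono) simp
  also have "\<dots> = ennreal (c1 * c2 * (1 / c3)) * emeasure lborel ?X"
    using c ennreal_mult_three[of c1 c2 "1 / c3" "emeasure lborel ?X"] by (simp add: mult.assoc)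
  finally show ?thesis by (simp add: lc)
qed

text \<open>If the intersection were all of \<open>K\<close>, then \<open>K\<close> would be a
  proper face of \<open>K'\<close> and have smaller dimension, but both have dimension
  \<open>d\<close>. So it is a proper face of \<open>K\<close> and lies in a hyperplane that is
  transversal to \<open>K\<close>.\<close>

lemma overlap_null:
  assumes K: "K \<in> \<K>" "K' \<in> \<K>" "K \<noteq> K'"
  shows "emeasure (flat_lborel K) (K \<inter> K') = 0"
proof (cases "K \<inter> K' = {}")
  case False
  have faces: "K \<inter> K' face_of K" "K' \<inter> K face_of K'" using triang K by (auto simp: triangulation_def)
  have ne: "K \<inter> K' \<noteq> K"
  proof
    assume eq: "K \<inter> K' = K"
    then have "K face_of K'" using faces(2) by (simp add: Int_commute)
    then have "aff_dim K < aff_dim K'" using face_of_aff_dim_lt[of K' K] K K_props(1) by auto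
    then show False using K K_props(6) by auto
  qed
  then have lt: "aff_dim (K \<inter> K') < aff_dim K" using face_of_aff_dim_lt[of K "K \<inter> K'"] faces K K_props(1) by auto
  obtain u t where u: "u \<in> parallel_space K" "u \<noteq> 0" "K \<inter> K' \<subseteq> {x. u \<bullet> x = t}"
    by (rule lower_dim_in_hyperplane[OF _ False lt]) auto
  obtain B where "flat_piece K B 1" by (rule flat_piece_exists[OF K(1), of 1]) auto
  interpret F: flat_piece K B 1 by fact
  show ?thesis using K K_props by (intro F.flat_lborel_hyperplane_null[OF _ _ u]) auto
qed simp

lemma flat_lborel_finite: "K \<in> \<K> \<Longrightarrow> emeasure (flat_lborel K) K < \<infinity>"
proof -
  assume K: "K \<in> \<K>"
  obtain B where "flat_piece K B 1" by (rule flat_piece_exists[OF K, of 1]) auto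
  interpret F: flat_piece K B 1 by fact
  show ?thesis using K K_props by (intro F.flat_lborel_finite) auto
qed

end

section \<open>A Poincare inequality on the discrete surface\<close>

lemma tube_borel [measurable, simp]: "tube M \<delta> \<in> sets borel"
  by (rule borel_open[OF open_tube])

text \<open>By the intermediate value theorem the images of the pieces cover the interval between \<open>f 0\<close>
  and \<open>f 1\<close>. The factor 2 comes from covering by cubes.\<close>

lemma increment_le_cover:
  fixes f :: "real \<Rightarrow> real"
  assumes f: "continuous_on {0..1} f" and I: "finite I"
    and A: "\<And>i. i \<in> I \<Longrightarrow> A i \<in> sets borel" "\<And>i. i \<in> I \<Longrightarrow> A i \<subseteq> {0..1}" "{0..1} \<subseteq> (\<Union>i\<in>I. A i)"
    and M: "\<And>i. i \<in> I \<Longrightarrow> 0 \<le> M i"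
    and lip: "\<And>i s t. i \<in> I \<Longrightarrow> s \<in> A i \<Longrightarrow> t \<in> A i \<Longrightarrow> \<bar>f s - f t\<bar> \<le> M i * \<bar>s - t\<bar>"
  shows "ennreal \<bar>f 0 - f 1\<bar> \<le> (\<Sum>i\<in>I. ennreal (2 * M i) * emeasure lborel (A i))"
proof (rule ennreal_le_epsilon)
  fix e :: real assume e: "0 < e"
  define S where "S = (\<Sum>i\<in>I. 2 * M i)"
  have S: "0 \<le> S" unfolding S_def using M by (intro sum_nonneg) auto
  define e' where "e' = e / (S + 1)"
  have e': "0 < e'" using e S by (simp add: e'_def)
  have "\<exists>W. W \<in> sets borel \<and> f ` A i \<subseteq> W \<and> emeasure lborel W \<le> ennreal (2 * M i) * (emeasure lborel (A i) + ennreal e')"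
    if i: "i \<in> I" for i
  proof -
    have bd: "bounded (A i)" using A(2)[OF i] bounded_subset bounded_closed_interval by blast
    obtain W where "W \<in> sets borel" "f ` A i \<subseteq> W"
      "emeasure lborel W \<le> ennreal ((2 * M i * DIM(real)) ^ DIM(real)) * (emeasure lborel (A i) + ennreal e')"
      by (rule lipschitz_image_cover[OF A(1)[OF i] bd subset_refl _ M[OF i] e', of f]) (use lip[OF i] in auto)
    then show ?thesis by auto
  qed
  then obtain W where W: "\<And>i. i \<in> I \<Longrightarrow> W i \<in> sets borel" "\<And>i. i \<in> I \<Longrightarrow> f ` A i \<subseteq> W i"
    "\<And>i. i \<in> I \<Longrightarrow> emeasure lborel (W i) \<le> ennreal (2 * M i) * (emeasure lborel (A i) + ennreal e')" by metis
  let ?J = "{min (f 0) (f 1)..max (f 0) (f 1)}"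
  have conn: "connected (f ` {0..1})" using f connected_continuous_image connected_Icc by blast
  have "?J \<subseteq> f ` {0..1}"
    by (rule connected_contains_Icc[OF conn]) (auto simp: min_def max_def)
  also have "\<dots> \<subseteq> (\<Union>i\<in>I. W i)" using A(3) W(2) by fastforce
  finally have J: "?J \<subseteq> (\<Union>i\<in>I. W i)" .
  have "ennreal \<bar>f 0 - f 1\<bar> = emeasure lborel ?J" by (simp add: min_def max_def)
  also have "\<dots> \<le> emeasure lborel (\<Union>i\<in>I. W i)" using J W(1) I by (intro emeasure_mono) auto
  also have "\<dots> \<le> (\<Sum>i\<in>I. emeasure lborel (W i))" using W(1) I by (intro emeasure_subadditive_finite) auto
  also have "\<dots> \<le> (\<Sum>i\<in>I. ennreal (2 * M i) * emeasure lborel (A i) + ennreal (2 * M i * e'))"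
    using W(3) M e' by (intro sum_mono) (auto simp: distrib_left ennreal_mult)
  also have "\<dots> = (\<Sum>i\<in>I. ennreal (2 * M i) * emeasure lborel (A i)) + ennreal (S * e')"
    using M e' by (simp add: sum.distrib S_def sum_distrib_right)
  also have "\<dots> \<le> (\<Sum>i\<in>I. ennreal (2 * M i) * emeasure lborel (A i)) + ennreal e"
  proof (intro add_left_mono ennreal_leI)
    have "S / (S + 1) * e \<le> 1 * e" using S e by (intro mult_right_mono) auto
    then show "S * e' \<le> e" by (simp add: e'_def)
  qed
  finally show "ennreal \<bar>f 0 - f 1\<bar> \<le> (\<Sum>i\<in>I. ennreal (2 * M i) * emeasure lborel (A i)) + ennreal e" .
qed

context tubular begin

text \<open>Naming the constant in a context that knows only \<open>\<Gamma>\<close> and its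
  projection keeps it visibly independent of the meshes, of \<open>h\<close> and of
  \<open>v\<close>.\<close>

definition tube_const :: real where
  "tube_const = (SOME C. 0 < C \<and> (\<forall>w G. upper_gradient_on (tube \<Gamma> r) w G \<longrightarrow>
     square_diff w (tube \<Gamma> (r/6)) (tube \<Gamma> (r/6)) \<le> ennreal C * (\<integral>\<^sup>+x\<in>tube \<Gamma> r. (G x)\<^sup>2 \<partial>lborel)))"

lemma tube_const: "0 < tube_const"
  "upper_gradient_on (tube \<Gamma> r) w G \<Longrightarrow>
     square_diff w (tube \<Gamma> (r/6)) (tube \<Gamma> (r/6)) \<le> ennreal tube_const * (\<integral>\<^sup>+x\<in>tube \<Gamma> r. (G x)\<^sup>2 \<partial>lborel)"
proof -
  obtain C where "0 < C" "\<And>w G. upper_gradient_on (tube \<Gamma> r) w G \<Longrightarrow>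
     square_diff w (tube \<Gamma> (r/6)) (tube \<Gamma> (r/6)) \<le> ennreal C * (\<integral>\<^sup>+x\<in>tube \<Gamma> r. (G x)\<^sup>2 \<partial>lborel)"
    using tube_poincare[OF compact_\<Gamma> connected_\<Gamma> nonempty_\<Gamma> r_pos] by blast
  then have "\<exists>C. 0 < C \<and> (\<forall>w G. upper_gradient_on (tube \<Gamma> r) w G \<longrightarrow>
     square_diff w (tube \<Gamma> (r/6)) (tube \<Gamma> (r/6)) \<le> ennreal C * (\<integral>\<^sup>+x\<in>tube \<Gamma> r. (G x)\<^sup>2 \<partial>lborel))" by blast
  from someI_ex[OF this, folded tube_const_def]
  show "0 < tube_const" "upper_gradient_on (tube \<Gamma> r) w G \<Longrightarrow>
     square_diff w (tube \<Gamma> (r/6)) (tube \<Gamma> (r/6)) \<le> ennreal tube_const * (\<integral>\<^sup>+x\<in>tube \<Gamma> r. (G x)\<^sup>2 \<partial>lborel)"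
    by blast+
qed

definition tube_volume :: real where "tube_volume = measure lborel (tube \<Gamma> r)"

lemma tube_volume: "emeasure lborel (tube \<Gamma> r) = ennreal tube_volume" "0 < tube_volume"
proof -
  have fin: "emeasure lborel (tube \<Gamma> r) < \<infinity>" by (rule emeasure_bounded_finite[OF bounded_tube])
  then show 1: "emeasure lborel (tube \<Gamma> r) = ennreal tube_volume"
    unfolding tube_volume_def by (intro emeasure_eq_ennreal_measure) auto
  obtain q where q: "q \<in> \<Gamma>" using nonempty_\<Gamma> by blast
  have "ball q r \<subseteq> tube \<Gamma> r"
  proof
    fix x assume "x \<in> ball q r"
    then show "x \<in> tube \<Gamma> r" using infdist_le[OF q, of x] by (simp add: tube_def dist_commute)
  qed
  then have "emeasure lborel (ball q r) \<le> ennreal tube_volume"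
    unfolding 1[symmetric] using open_tube by (intro emeasure_mono) auto
  moreover have "0 < emeasure lborel (ball q r)"
    using content_ball_pos[OF r_pos, of q] by (auto simp: measure_def intro: gr_zeroI)
  ultimately have "0 < ennreal tube_volume" by (rule less_le_trans[rotated])
  then show "0 < tube_volume" by simp
qed

text \<open>From the left: the reciprocal of a lower bound for the area, the passage from surface to
  tube integrals, the Poincare constant of the tube, the square of the factor
  \<open>4 * \<Lambda>\<close> in the upper gradient, and the passage of the energy from the tube
  back to the surface.\<close>

definition surface_const :: "nat \<Rightarrow> real" where
  "surface_const d = upper_const d / tube_volume * lower_const d (r/6) * tube_const * (16 * \<Lambda>\<^sup>2) * upper_const d"

lemma surface_const_pos: "0 < surface_const d"
  unfolding surface_const_def using upper_const_pos tube_volume lower_const_pos tube_const(1) r_pos \<Lambda>_ge1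
  by (intro mult_pos_pos divide_pos_pos) auto

end

context discrete_surface begin

lemma disjoint_pieces:
  obtains f where "\<And>K. K \<in> \<K> \<Longrightarrow> f K \<subseteq> K" "\<And>K. K \<in> \<K> \<Longrightarrow> f K \<in> sets borel"
    "\<And>K. K \<in> \<K> \<Longrightarrow> K - f K \<subseteq> (\<Union>j\<in>\<K> - {K}. j)"
    "disjoint_family_on f \<K>" "(\<Union>K\<in>\<K>. f K) = \<Union>\<K>"
  by (rule disjoint_refinement[of \<K> "\<lambda>K. K" borel, OF finite_\<K> K_props(7)], assumption, rule that) simp_all

section \<open>The lifted function and its upper gradient\<close>

context
  fixes v :: "'a \<Rightarrow> real" and g :: "'a set \<Rightarrow> real"
  assumes v: "continuous_on (\<Union>\<K>) v" and g0: "\<And>K. K \<in> \<K> \<Longrightarrow> 0 \<le> g K"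
    and g: "\<And>K a b. K \<in> \<K> \<Longrightarrow> a \<in> K \<Longrightarrow> b \<in> K \<Longrightarrow> \<bar>v a - v b\<bar> \<le> g K * norm (a - b)"
begin

text \<open>The value 0 off the tube makes the function Borel on the whole space, as
  \<open>upper_gradient_on\<close> demands.\<close>

definition lifted :: "'a \<Rightarrow> real" where "lifted x = (if x \<in> tube \<Gamma> r then v (lift x) else 0)"

lemma lifted_continuous: "continuous_on (tube \<Gamma> r) lifted"
proof -
  have "continuous_on (tube \<Gamma> r) (\<lambda>x. v (lift x))"
    using lift_mem by (intro continuous_on_compose2[OF v lift_continuous]) auto
  then show ?thesis by (rule continuous_on_eq) (simp add: lifted_def)
qed

lemma lifted_measurable [measurable]: "lifted \<in> borel_measurable borel"
proof -
  have "(\<lambda>x. if x \<in> tube \<Gamma> r then v (lift x) else 0) \<in> borel_measurable borel"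
    using lift_mem open_tube
    by (intro borel_measurable_continuous_on_if continuous_on_compose2[OF v lift_continuous]) auto
  then show ?thesis by (simp add: lifted_def[abs_def])
qed

text \<open>The upper gradient is constant on the preimage of each disjoint piece. Its factor
  \<open>4 * \<Lambda>\<close> is the Lipschitz constant \<open>2 * \<Lambda>\<close> of the lift
  times the covering loss 2 of \<open>increment_le_cover\<close>.\<close>

lemma lifted_square_diff_le:
  "square_diff lifted (tube \<Gamma> (r/6)) (tube \<Gamma> (r/6))
     \<le> ennreal (tube_const * (16 * \<Lambda>\<^sup>2) * upper_const d * (\<Sum>K\<in>\<K>. (g K)\<^sup>2 * measure (flat_lborel K) K))"
proof -
  obtain f where f: "\<And>K. K \<in> \<K> \<Longrightarrow> f K \<subseteq> K" "\<And>K. K \<in> \<K> \<Longrightarrow> f K \<in> sets borel"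
    "\<And>K. K \<in> \<K> \<Longrightarrow> K - f K \<subseteq> (\<Union>j\<in>\<K> - {K}. j)"
    "disjoint_family_on f \<K>" "(\<Union>K\<in>\<K>. f K) = \<Union>\<K>"
    by (rule disjoint_pieces, rule that) simp_all
  define S where "S K = {x \<in> tube \<Gamma> r. lift x \<in> f K}" for K
  have Sb [measurable]: "S K \<in> sets borel" if "K \<in> \<K>" for K
    unfolding S_def using f(2)[OF that] by (intro lift_preimage_borel) auto
  define G where "G x = (\<Sum>K\<in>\<K>. ennreal (4 * \<Lambda> * g K) * indicator (S K) x)" for x
  have "upper_gradient_on (tube \<Gamma> r) lifted G"
    unfolding upper_gradient_on_def
  proof (intro conjI allI impI)
    show [measurable]: "G \<in> borel_measurable borel" unfolding G_def by measurable
    fix x y assume seg: "closed_segment x y \<subseteq> tube \<Gamma> r"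
    define z where "z t = x + t *\<^sub>R (y - x)" for t :: real
    have z: "z t \<in> tube \<Gamma> r" if "t \<in> {0..1}" for t
    proof -
      have "z t \<in> closed_segment x y"
        unfolding z_def closed_segment_def by (intro CollectI exI[of _ t]) (use that in \<open>simp add: algebra_simps\<close>)
      then show ?thesis using seg by blast
    qed
    have zm: "z \<in> borel_measurable borel" unfolding z_def by measurable
    \<comment> \<open>These parameter sets are merely Borel: the segment may return to the same
      piece arbitrarily often.\<close>
    define A where "A K = z -` S K \<inter> {0..1}" for K
    have "ennreal \<bar>lifted (z 0) - lifted (z 1)\<bar> \<le> (\<Sum>K\<in>\<K>. ennreal (2 * (g K * (2 * \<Lambda> * norm (y - x)))) * emeasure lborel (A K))"
    proof (rule increment_le_cover[of "\<lambda>t. lifted (z t)", OF _ finite_\<K>])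
      show "continuous_on {0..1} (\<lambda>t. lifted (z t))"
        using z by (intro continuous_on_compose2[OF lifted_continuous]) (auto simp: z_def intro!: continuous_intros)
      show "A K \<in> sets borel" if "K \<in> \<K>" for K
        unfolding A_def using measurable_sets[OF zm Sb[OF that]] by simp
      show "{0..1} \<subseteq> (\<Union>K\<in>\<K>. A K)"
      proof
        fix t :: real assume t: "t \<in> {0..1}"
        have "lift (z t) \<in> (\<Union>K\<in>\<K>. f K)" using lift_mem f(5) by auto
        then show "t \<in> (\<Union>K\<in>\<K>. A K)" using t z[OF t] by (auto simp: A_def S_def)
      qed
      fix K assume K: "K \<in> \<K>"
      show "0 \<le> g K * (2 * \<Lambda> * norm (y - x))" using g0[OF K] \<Lambda>_ge1 by simp
      fix s t assume st: "s \<in> A K" "t \<in> A K"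
      then have U: "z s \<in> tube \<Gamma> r" "z t \<in> tube \<Gamma> r" "lift (z s) \<in> K" "lift (z t) \<in> K"
        using f(1)[OF K] by (auto simp: A_def S_def)
      have "\<bar>lifted (z s) - lifted (z t)\<bar> \<le> g K * norm (lift (z s) - lift (z t))"
        using g[OF K U(3,4)] U by (simp add: lifted_def)
      also have "\<dots> \<le> g K * (2 * \<Lambda> * norm (z s - z t))"
        using g0[OF K] lift_lipschitz[OF K U] by (rule mult_left_mono[rotated])
      also have "z s - z t = (s - t) *\<^sub>R (y - x)" by (simp add: z_def algebra_simps)
      finally show "\<bar>lifted (z s) - lifted (z t)\<bar> \<le> g K * (2 * \<Lambda> * norm (y - x)) * \<bar>s - t\<bar>" by (simp add: mult_ac)
    qed (auto simp: A_def)
    also have "\<dots> = ennreal (norm (x - y)) * (\<Sum>K\<in>\<K>. ennreal (4 * \<Lambda> * g K) * emeasure lborel (A K))"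
      unfolding sum_distrib_left
    proof (rule sum.cong)
      fix K assume K: "K \<in> \<K>"
      have "2 * (g K * (2 * \<Lambda> * norm (y - x))) = norm (x - y) * (4 * \<Lambda> * g K)" by (simp add: norm_minus_commute)
      then show "ennreal (2 * (g K * (2 * \<Lambda> * norm (y - x)))) * emeasure lborel (A K)
         = ennreal (norm (x - y)) * (ennreal (4 * \<Lambda> * g K) * emeasure lborel (A K))"
        using g0[OF K] \<Lambda>_ge1 by (simp only: ennreal_mult mult.assoc[symmetric]) (simp add: ennreal_mult)
    qed simp
    also have "(\<Sum>K\<in>\<K>. ennreal (4 * \<Lambda> * g K) * emeasure lborel (A K)) = (\<integral>\<^sup>+t\<in>{0..1}. G (x + t *\<^sub>R (y - x)) \<partial>lborel)"
    proof -
      have "(\<integral>\<^sup>+t\<in>{0..1}. G (x + t *\<^sub>R (y - x)) \<partial>lborel) = (\<integral>\<^sup>+t. (\<Sum>K\<in>\<K>. ennreal (4 * \<Lambda> * g K) * indicator (A K) t) \<partial>lborel)"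
        unfolding G_def sum_distrib_right z_def[symmetric]
        by (intro nn_integral_cong sum.cong) (auto simp: A_def indicator_def)
      also have "\<dots> = (\<Sum>K\<in>\<K>. \<integral>\<^sup>+t. ennreal (4 * \<Lambda> * g K) * indicator (A K) t \<partial>lborel)"
        using measurable_sets[OF zm Sb] by (intro nn_integral_sum) (auto simp: A_def)
      also have "\<dots> = (\<Sum>K\<in>\<K>. ennreal (4 * \<Lambda> * g K) * emeasure lborel (A K))"
        using measurable_sets[OF zm Sb] by (intro sum.cong nn_integral_cmult_indicator) (auto simp: A_def)
      finally show ?thesis by simp
    qed
    finally show "ennreal \<bar>lifted x - lifted y\<bar> \<le> ennreal (norm (x - y)) * (\<integral>\<^sup>+t\<in>{0..1}. G (x + t *\<^sub>R (y - x)) \<partial>lborel)"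
      by (simp add: z_def)
  qed (rule lifted_measurable)
  from tube_const(2)[OF this]
  have "square_diff lifted (tube \<Gamma> (r/6)) (tube \<Gamma> (r/6)) \<le> ennreal tube_const * (\<integral>\<^sup>+x\<in>tube \<Gamma> r. (G x)\<^sup>2 \<partial>lborel)" .
  also have "(\<integral>\<^sup>+x\<in>tube \<Gamma> r. (G x)\<^sup>2 \<partial>lborel) \<le> (\<integral>\<^sup>+x. (\<Sum>K\<in>\<K>. ennreal ((4 * \<Lambda> * g K)\<^sup>2) * indicator (S K) x) \<partial>lborel)"
  proof (rule nn_integral_mono)
    fix x
    show "(G x)\<^sup>2 * indicator (tube \<Gamma> r) x \<le> (\<Sum>K\<in>\<K>. ennreal ((4 * \<Lambda> * g K)\<^sup>2) * indicator (S K) x)"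
    proof (cases "x \<in> tube \<Gamma> r")
      case True
      then obtain K0 where K0: "K0 \<in> \<K>" "x \<in> S K0" using lift_mem[of x] f(5) unfolding S_def by blast
      have other: "x \<notin> S K" if "K \<in> \<K>" "K \<noteq> K0" for K
        using K0 that f(4) unfolding S_def disjoint_family_on_def by blast
      \<comment> \<open>Disjointness of the pieces leaves one summand at each point, so squaring
        produces no mixed terms.\<close>
      have single: "(\<Sum>K\<in>\<K>. c K * indicator (S K) x) = (c K0 :: ennreal)" for c
      proof -
        have "(\<Sum>K\<in>\<K>. c K * indicator (S K) x) = (\<Sum>K\<in>{K0}. c K * indicator (S K) x)"
          using K0 other finite_\<K> by (intro sum.mono_neutral_right) auto
        then show ?thesis using K0 by simp
      qed
      have "G x = ennreal (4 * \<Lambda> * g K0)" unfolding G_def by (rule single)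
      then have "(G x)\<^sup>2 = ennreal ((4 * \<Lambda> * g K0)\<^sup>2)"
        using g0[OF K0(1)] \<Lambda>_ge1 by (simp add: ennreal_power)
      then show ?thesis using single[of "\<lambda>K. ennreal ((4 * \<Lambda> * g K)\<^sup>2)"] True by simp
    qed simp
  qed
  also have "\<dots> = (\<Sum>K\<in>\<K>. ennreal ((4 * \<Lambda> * g K)\<^sup>2) * emeasure lborel (S K))"
    by (subst nn_integral_sum) (auto intro!: sum.cong nn_integral_cmult_indicator)
  also have "\<dots> \<le> (\<Sum>K\<in>\<K>. ennreal ((4 * \<Lambda> * g K)\<^sup>2) * (ennreal (upper_const d) * ennreal (measure (flat_lborel K) K)))"
  proof (intro sum_mono mult_left_mono)
    fix K assume K: "K \<in> \<K>"
    have "emeasure lborel (S K) \<le> emeasure lborel {x \<in> tube \<Gamma> r. lift x \<in> K}"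
      unfolding S_def using f(1)[OF K] K_props(7)[OF K] by (intro emeasure_mono) (auto intro!: lift_preimage_borel)
    also have "\<dots> \<le> ennreal (upper_const d) * emeasure (flat_lborel K) K"
      using K_props(7)[OF K] by (intro lift_measure_upper[OF K]) auto
    also have "emeasure (flat_lborel K) K = ennreal (measure (flat_lborel K) K)"
      using flat_lborel_finite[OF K] by (intro emeasure_eq_ennreal_measure) auto
    finally show "emeasure lborel (S K) \<le> ennreal (upper_const d) * ennreal (measure (flat_lborel K) K)" .
  qed simp
  also have "\<dots> = ennreal ((16 * \<Lambda>\<^sup>2) * upper_const d * (\<Sum>K\<in>\<K>. (g K)\<^sup>2 * measure (flat_lborel K) K))"
  proof -
    have "(\<Sum>K\<in>\<K>. ennreal ((4 * \<Lambda> * g K)\<^sup>2) * (ennreal (upper_const d) * ennreal (measure (flat_lborel K) K)))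
       = (\<Sum>K\<in>\<K>. ennreal ((16 * \<Lambda>\<^sup>2) * upper_const d * ((g K)\<^sup>2 * measure (flat_lborel K) K)))"
      using upper_const_pos[of d] by (intro sum.cong) (simp_all add: ennreal_mult[symmetric] power_mult_distrib mult_ac)
    then show ?thesis
      using upper_const_pos[of d] by (simp add: sum_distrib_left)
  qed
  finally have "square_diff lifted (tube \<Gamma> (r/6)) (tube \<Gamma> (r/6))
     \<le> ennreal tube_const * ennreal ((16 * \<Lambda>\<^sup>2) * upper_const d * (\<Sum>K\<in>\<K>. (g K)\<^sup>2 * measure (flat_lborel K) K))"
    by (simp add: mult_left_mono)
  then show ?thesis
    using tube_const(1) upper_const_pos[of d] by (simp add: ennreal_mult[symmetric] sum_nonneg mult_ac)
qed

end

definition area :: real where "area = (\<Sum>K\<in>\<K>. measure (flat_lborel K) K)"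

text \<open>The preimages of the simplices under the lift cover the tube, whose volume is fixed;
  this keeps the area away from zero uniformly in the mesh.\<close>

lemma area_ge: "tube_volume / upper_const d \<le> area"
proof -
  have "tube \<Gamma> r = (\<Union>K\<in>\<K>. {x \<in> tube \<Gamma> r. lift x \<in> K})" using lift_mem by auto
  then have "ennreal tube_volume = emeasure lborel (\<Union>K\<in>\<K>. {x \<in> tube \<Gamma> r. lift x \<in> K})"
    using tube_volume(1) by simp
  also have "\<dots> \<le> (\<Sum>K\<in>\<K>. emeasure lborel {x \<in> tube \<Gamma> r. lift x \<in> K})"
    using finite_\<K> K_props(7) by (intro emeasure_subadditive_finite) (auto intro!: lift_preimage_borel)
  also have "\<dots> \<le> (\<Sum>K\<in>\<K>. ennreal (upper_const d * measure (flat_lborel K) K))"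
  proof (rule sum_mono)
    fix K assume K: "K \<in> \<K>"
    have "emeasure lborel {x \<in> tube \<Gamma> r. lift x \<in> K} \<le> ennreal (upper_const d) * emeasure (flat_lborel K) K"
      using K_props(7)[OF K] by (intro lift_measure_upper[OF K]) auto
    also have "emeasure (flat_lborel K) K = ennreal (measure (flat_lborel K) K)"
      using flat_lborel_finite[OF K] by (intro emeasure_eq_ennreal_measure) auto
    finally show "emeasure lborel {x \<in> tube \<Gamma> r. lift x \<in> K} \<le> ennreal (upper_const d * measure (flat_lborel K) K)"
      using upper_const_pos[of d] by (simp add: ennreal_mult)
  qed
  also have "\<dots> = ennreal (upper_const d * area)"
    using upper_const_pos[of d] by (simp add: area_def sum_distrib_left)
  finally have "tube_volume \<le> upper_const d * area"
    using upper_const_pos[of d] by (simp add: area_def sum_nonneg)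
  then show ?thesis using upper_const_pos[of d] by (simp add: field_simps)
qed

lemma area_pos: "0 < area"
  using area_ge upper_const_pos[of d] tube_volume(2) by (meson divide_pos_pos less_le_trans)

text \<open>The set estimate \<open>lift_measure_lower\<close> says that one measure is dominated by
  the image of another under the lift. Domination of measures passes to integrals of all nonnegative
  Borel functions.\<close>

lemma nn_integral_flat_le_lift:
  assumes K: "K \<in> \<K>" and A: "A \<in> sets borel" "A \<subseteq> K" and s: "0 < s" "s \<le> r"
    and [measurable]: "\<psi> \<in> borel_measurable borel"
  shows "(\<integral>\<^sup>+y\<in>A. \<psi> y \<partial>flat_lborel K) \<le> ennreal (lower_const d s) * (\<integral>\<^sup>+x\<in>{x \<in> tube \<Gamma> s. lift x \<in> A}. \<psi> (lift x) \<partial>lborel)"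
proof -
  let ?S = "{x \<in> tube \<Gamma> s. lift x \<in> A}"
  define l where "l x = (if x \<in> tube \<Gamma> r then lift x else 0)" for x
  have [measurable]: "l \<in> borel_measurable borel"
    unfolding l_def[abs_def] using open_tube by (intro borel_measurable_continuous_on_if lift_continuous) auto
  have Sb [measurable]: "?S \<in> sets borel" using A s by (intro lift_preimage_borel)
  have [measurable]: "A \<in> sets borel" by fact
  have lS: "l x = lift x" if "x \<in> ?S" for x using that s by (auto simp: l_def tube_def)
  define M1 where "M1 = density (flat_lborel K) (indicator A)"
  define M2 where "M2 = distr (density lborel (\<lambda>x. ennreal (lower_const d s) * indicator ?S x)) borel l"
  have "M1 \<le> M2"
  proof (subst le_measure)
    show "sets M1 = sets M2" by (simp add: M1_def M2_def)
    show "\<forall>X\<in>sets M1. emeasure M1 X \<le> emeasure M2 X"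
    proof
      fix X assume "X \<in> sets M1"
      then have X [measurable]: "X \<in> sets borel" by (simp add: M1_def)
      have "emeasure M1 X = emeasure (flat_lborel K) (A \<inter> X)"
        unfolding M1_def by (subst emeasure_density) (auto simp: indicator_inter_arith[symmetric])
      also have "\<dots> \<le> ennreal (lower_const d s) * emeasure lborel {x \<in> tube \<Gamma> s. lift x \<in> A \<inter> X}"
        using A by (intro lift_measure_lower[OF K _ _ s]) auto
      also have "{x \<in> tube \<Gamma> s. lift x \<in> A \<inter> X} = ?S \<inter> l -` X" using lS by auto
      also have "ennreal (lower_const d s) * emeasure lborel (?S \<inter> l -` X) = emeasure M2 X"
      proof -
        have lX: "l -` X \<in> sets borel" using measurable_sets[of l borel borel X] by simp
        have "emeasure M2 X = (\<integral>\<^sup>+x. ennreal (lower_const d s) * indicator ?S x * indicator (l -` X) x \<partial>lborel)"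
          unfolding M2_def using lX by (subst emeasure_distr) (auto simp: emeasure_density)
        also have "\<dots> = (\<integral>\<^sup>+x. ennreal (lower_const d s) * indicator (?S \<inter> l -` X) x \<partial>lborel)"
          by (intro nn_integral_cong) (auto simp: indicator_def)
        also have "\<dots> = ennreal (lower_const d s) * emeasure lborel (?S \<inter> l -` X)"
          using lX Sb by (intro nn_integral_cmult_indicator) auto
        finally show ?thesis by simp
      qed
      finally show "emeasure M1 X \<le> emeasure M2 X" .
    qed
  qed
  then have "(\<integral>\<^sup>+y. \<psi> y \<partial>M1) \<le> (\<integral>\<^sup>+y. \<psi> y \<partial>M2)"
    by (intro nn_integral_mono_measure) (simp_all add: M1_def M2_def)
  moreover have "(\<integral>\<^sup>+y. \<psi> y \<partial>M1) = (\<integral>\<^sup>+y\<in>A. \<psi> y \<partial>flat_lborel K)"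
    unfolding M1_def by (subst nn_integral_density) (auto simp: mult.commute)
  moreover have "(\<integral>\<^sup>+y. \<psi> y \<partial>M2) = (\<integral>\<^sup>+x. ennreal (lower_const d s) * (\<psi> (l x) * indicator ?S x) \<partial>lborel)"
    unfolding M2_def by (simp add: nn_integral_distr nn_integral_density mult_ac)
  moreover have "\<dots> = ennreal (lower_const d s) * (\<integral>\<^sup>+x. \<psi> (l x) * indicator ?S x \<partial>lborel)"
    by (rule nn_integral_cmult) measurable
  moreover have "(\<integral>\<^sup>+x. \<psi> (l x) * indicator ?S x \<partial>lborel) = (\<integral>\<^sup>+x\<in>?S. \<psi> (lift x) \<partial>lborel)"
    by (intro nn_integral_cong) (simp add: indicator_def lS)
  ultimately show ?thesis by simp
qed

lemma flat_set_integrable: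
  fixes f :: "'a \<Rightarrow> real"
  assumes K: "K \<in> \<K>" and f: "continuous_on K f"
  shows "set_integrable (flat_lborel K) K f"
proof -
  have "bounded (f ` K)" using compact_continuous_image[OF f K_props(2)[OF K]] compact_imp_bounded by blast
  then obtain B where B: "\<And>x. x \<in> K \<Longrightarrow> norm (f x) \<le> B" by (auto simp: bounded_iff)
  have "(\<lambda>x. indicator K x *\<^sub>R f x) \<in> borel_measurable borel"
    using borel_measurable_continuous_on_indicator[OF K_props(7)[OF K] f] .
  then show ?thesis
    unfolding set_integrable_def
    by (intro integrableI_bounded_set[where A=K and B=B]) (use B K_props(7)[OF K] flat_lborel_finite[OF K] in \<open>auto simp: indicator_def\<close>)
qed

text \<open>The right-hand side is a quadratic in \<open>a\<close> with leading coefficient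
  \<open>area\<close> and vertex at the average. Its minimum is nonnegative, being itself an
  integral of squares.\<close>

lemma average_variance:
  assumes v: "continuous_on (\<Union>\<K>) v"
  shows "area * (a - surface_average \<K> v)\<^sup>2 \<le> (\<Sum>K\<in>\<K>. LINT y:K|flat_lborel K. (a - v y)\<^sup>2)"
proof -
  have cv: "continuous_on K v" if "K \<in> \<K>" for K using v that by (meson Union_upper continuous_on_subset)
  define I where "I = (\<Sum>K\<in>\<K>. LINT y:K|flat_lborel K. v y)"
  define Q where "Q = (\<Sum>K\<in>\<K>. LINT y:K|flat_lborel K. (v y)\<^sup>2)"
  have one: "(LINT y:K|flat_lborel K. c) = c * measure (flat_lborel K) K" if "K \<in> \<K>" for K and c :: real
  proof -
    have "integrable (flat_lborel K) (indicator K :: 'a \<Rightarrow> real)"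
      using that K_props(7) flat_lborel_finite by (intro integrable_real_indicator) auto
    then show ?thesis by (simp add: set_lebesgue_integral_def)
  qed
  have exp: "(\<Sum>K\<in>\<K>. LINT y:K|flat_lborel K. (a - v y)\<^sup>2) = a\<^sup>2 * area - 2 * a * I + Q" for a
  proof -
    have "(LINT y:K|flat_lborel K. (a - v y)\<^sup>2) = a\<^sup>2 * measure (flat_lborel K) K - 2 * a * (LINT y:K|flat_lborel K. v y) + (LINT y:K|flat_lborel K. (v y)\<^sup>2)"
      if K: "K \<in> \<K>" for K
    proof -
      have int: "set_integrable (flat_lborel K) K (\<lambda>y. a\<^sup>2)" "set_integrable (flat_lborel K) K (\<lambda>y. 2 * a * v y)"
        "set_integrable (flat_lborel K) K (\<lambda>y. (v y)\<^sup>2)"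
        by (intro flat_set_integrable[OF K] continuous_intros cv[OF K])+
      have "(LINT y:K|flat_lborel K. (a - v y)\<^sup>2) = (LINT y:K|flat_lborel K. (a\<^sup>2 - 2 * a * v y) + (v y)\<^sup>2)"
        by (simp add: power2_diff algebra_simps)
      also have "\<dots> = (LINT y:K|flat_lborel K. a\<^sup>2) - (LINT y:K|flat_lborel K. 2 * a * v y) + (LINT y:K|flat_lborel K. (v y)\<^sup>2)"
        using int by (simp add: set_integral_add set_integral_diff)
      finally show ?thesis using one[OF K] by simp
    qed
    then show ?thesis by (simp add: sum.distrib sum_subtractf sum_distrib_left area_def I_def Q_def)
  qed
  have lam: "surface_average \<K> v = I / area"
    using one by (simp add: surface_average_def surface_integral_def I_def area_def)
  have "0 \<le> (\<Sum>K\<in>\<K>. LINT y:K|flat_lborel K. (I / area - v y)\<^sup>2)"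
    by (intro sum_nonneg) (auto simp: set_lebesgue_integral_def intro!: integral_nonneg_AE)
  then have "0 \<le> (I / area)\<^sup>2 * area - 2 * (I / area) * I + Q" by (simp only: exp)
  then have "area * (a - I / area)\<^sup>2 \<le> a\<^sup>2 * area - 2 * a * I + Q"
    using area_pos by (simp add: power2_eq_square field_simps)
  then show ?thesis by (simp only: exp lam)
qed

text \<open>The left-hand side stays on the tube, because the bulk estimate later averages over
  subsets of it. Only the mean value and the energy are transferred to the discrete surface.\<close>

lemma surface_poincare:
  assumes v: "continuous_on (\<Union>\<K>) v" and g0: "\<And>K. K \<in> \<K> \<Longrightarrow> 0 \<le> g K"
    and g: "\<And>K a b. K \<in> \<K> \<Longrightarrow> a \<in> K \<Longrightarrow> b \<in> K \<Longrightarrow> \<bar>v a - v b\<bar> \<le> g K * norm (a - b)"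
  shows "(\<integral>\<^sup>+x\<in>tube \<Gamma> (r/6). ennreal ((v (lift x) - surface_average \<K> v)\<^sup>2) \<partial>lborel)
    \<le> ennreal (surface_const d * (\<Sum>K\<in>\<K>. (g K)\<^sup>2 * measure (flat_lborel K) K))"
proof -
  let ?V = "tube \<Gamma> (r/6)" and ?avg = "surface_average \<K> v"
  define w where "w = lifted v"
  have [measurable]: "w \<in> borel_measurable borel" unfolding w_def by (rule lifted_measurable[OF v g0 g])
  have w: "w x = v (lift x)" if "x \<in> ?V" for x
    using that r_pos by (simp add: w_def lifted_def[OF v g0 g] tube_def)
  have Vb [measurable]: "?V \<in> sets borel" using open_tube by simp
  have L: "0 < lower_const d (r/6)" using lower_const_pos r_pos by simp
  obtain f where f: "\<And>K. K \<in> \<K> \<Longrightarrow> f K \<subseteq> K" "\<And>K. K \<in> \<K> \<Longrightarrow> f K \<in> sets borel"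
    "\<And>K. K \<in> \<K> \<Longrightarrow> K - f K \<subseteq> (\<Union>j\<in>\<K> - {K}. j)"
    "disjoint_family_on f \<K>" "(\<Union>K\<in>\<K>. f K) = \<Union>\<K>"
    by (rule disjoint_pieces, rule that) simp_all
  \<comment> \<open>Choosing disjoint pieces costs no area, since what \<open>f K\<close> omits lies
    in intersections with other simplices.\<close>
  have null: "emeasure (flat_lborel K) (K - f K) = 0" if K: "K \<in> \<K>" for K
  proof -
    have "K - f K \<subseteq> (\<Union>j\<in>\<K> - {K}. K \<inter> j)" using f(3)[OF K] by auto
    moreover have "emeasure (flat_lborel K) (\<Union>j\<in>\<K> - {K}. K \<inter> j) \<le> (\<Sum>j\<in>\<K> - {K}. emeasure (flat_lborel K) (K \<inter> j))"
      using finite_\<K> K K_props(7) by (intro emeasure_subadditive_finite) auto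
    moreover have "(\<Sum>j\<in>\<K> - {K}. emeasure (flat_lborel K) (K \<inter> j)) = 0"
      using K by (intro sum.neutral) (auto intro!: overlap_null)
    moreover have "(\<Union>j\<in>\<K> - {K}. K \<inter> j) \<in> sets (flat_lborel K)"
      using finite_\<K> K K_props(7) by (intro sets.finite_UN) auto
    ultimately show ?thesis by (metis emeasure_mono le_zero_eq)
  qed
  define u where "u y = (if y \<in> \<Union>\<K> then v y else 0)" for y
  have ub [measurable]: "u \<in> borel_measurable borel"
    unfolding u_def[abs_def] using finite_\<K> K_props(7) v
    by (intro borel_measurable_continuous_on_if) auto
  \<comment> \<open>Inserting \<open>a = w x\<close> and integrating over \<open>x\<close> produces
    exactly \<open>square_diff\<close> on the tube.\<close>
  have key: "ennreal (area * (a - ?avg)\<^sup>2) \<le> ennreal (lower_const d (r/6)) * (\<integral>\<^sup>+x\<in>?V. ennreal ((a - w x)\<^sup>2) \<partial>lborel)" for a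
  proof -
    have "ennreal (area * (a - ?avg)\<^sup>2) \<le> ennreal (\<Sum>K\<in>\<K>. LINT y:K|flat_lborel K. (a - v y)\<^sup>2)"
      by (intro ennreal_leI average_variance v)
    also have "\<dots> = (\<Sum>K\<in>\<K>. ennreal (LINT y:K|flat_lborel K. (a - v y)\<^sup>2))"
      by (intro sum_ennreal[symmetric]) (auto simp: set_lebesgue_integral_def intro!: integral_nonneg_AE)
    also have "\<dots> \<le> (\<Sum>K\<in>\<K>. ennreal (lower_const d (r/6)) * (\<integral>\<^sup>+x\<in>{x \<in> ?V. lift x \<in> f K}. ennreal ((a - u (lift x))\<^sup>2) \<partial>lborel))"
    proof (rule sum_mono)
      fix K assume K: "K \<in> \<K>"
      have "continuous_on K v" using v K by (meson Union_upper continuous_on_subset)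
      then have si: "set_integrable (flat_lborel K) K (\<lambda>y. (a - v y)\<^sup>2)"
        by (intro flat_set_integrable[OF K] continuous_intros)
      have "ennreal (LINT y:K|flat_lborel K. (a - v y)\<^sup>2) = (\<integral>\<^sup>+y. ennreal (indicator K y *\<^sub>R (a - v y)\<^sup>2) \<partial>flat_lborel K)"
        unfolding set_lebesgue_integral_def using si[unfolded set_integrable_def]
        by (intro nn_integral_eq_integral[symmetric]) auto
      also have "\<dots> = (\<integral>\<^sup>+y\<in>f K. ennreal ((a - u y)\<^sup>2) \<partial>flat_lborel K)"
      proof (rule nn_integral_cong_AE)
        have "AE y in flat_lborel K. y \<notin> K - f K"
          using null[OF K] f(2)[OF K] K_props(7)[OF K] by (intro AE_not_in) (auto simp: null_sets_def)
        then show "AE y in flat_lborel K. ennreal (indicator K y *\<^sub>R (a - v y)\<^sup>2) = ennreal ((a - u y)\<^sup>2) * indicator (f K) y"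
          by eventually_elim (use f(1)[OF K] K in \<open>auto simp: indicator_def u_def\<close>)
      qed
      also have "\<dots> \<le> ennreal (lower_const d (r/6)) * (\<integral>\<^sup>+x\<in>{x \<in> ?V. lift x \<in> f K}. ennreal ((a - u (lift x))\<^sup>2) \<partial>lborel)"
        using f(1,2)[OF K] r_pos by (intro nn_integral_flat_le_lift[OF K]) auto
      finally show "ennreal (LINT y:K|flat_lborel K. (a - v y)\<^sup>2) \<le> \<dots>" .
    qed
    also have "\<dots> = ennreal (lower_const d (r/6)) * (\<Sum>K\<in>\<K>. \<integral>\<^sup>+x. ennreal ((a - w x)\<^sup>2) * indicator {x \<in> ?V. lift x \<in> f K} x \<partial>lborel)"
      unfolding sum_distrib_left
    proof (rule sum.cong)
      fix K
      have "(\<integral>\<^sup>+x\<in>{x \<in> ?V. lift x \<in> f K}. ennreal ((a - u (lift x))\<^sup>2) \<partial>lborel)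
        = (\<integral>\<^sup>+x. ennreal ((a - w x)\<^sup>2) * indicator {x \<in> ?V. lift x \<in> f K} x \<partial>lborel)"
        using lift_mem w by (intro nn_integral_cong) (auto simp: indicator_def u_def)
      then show "ennreal (lower_const d (r/6)) * (\<integral>\<^sup>+x\<in>{x \<in> ?V. lift x \<in> f K}. ennreal ((a - u (lift x))\<^sup>2) \<partial>lborel)
        = ennreal (lower_const d (r/6)) * (\<integral>\<^sup>+x. ennreal ((a - w x)\<^sup>2) * indicator {x \<in> ?V. lift x \<in> f K} x \<partial>lborel)"
        by simp
    qed simp
    also have "(\<Sum>K\<in>\<K>. \<integral>\<^sup>+x. ennreal ((a - w x)\<^sup>2) * indicator {x \<in> ?V. lift x \<in> f K} x \<partial>lborel)
       = (\<integral>\<^sup>+x. (\<Sum>K\<in>\<K>. ennreal ((a - w x)\<^sup>2) * indicator {x \<in> ?V. lift x \<in> f K} x) \<partial>lborel)"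
    proof (rule nn_integral_sum[symmetric])
      fix K assume "K \<in> \<K>"
      then have [measurable]: "{x \<in> ?V. lift x \<in> f K} \<in> sets borel" using f(2) r_pos by (intro lift_preimage_borel) auto
      show "(\<lambda>x. ennreal ((a - w x)\<^sup>2) * indicator {x \<in> ?V. lift x \<in> f K} x) \<in> borel_measurable lborel" by measurable
    qed
    also have "\<dots> \<le> (\<integral>\<^sup>+x\<in>?V. ennreal ((a - w x)\<^sup>2) \<partial>lborel)"
    proof (rule nn_integral_mono)
      fix x
      show "(\<Sum>K\<in>\<K>. ennreal ((a - w x)\<^sup>2) * indicator {x \<in> ?V. lift x \<in> f K} x) \<le> ennreal ((a - w x)\<^sup>2) * indicator ?V x"
      proof (cases "x \<in> ?V")
        case True
        obtain K0 where K0: "K0 \<in> \<K>" "lift x \<in> f K0" using lift_mem[of x] f(5) by blast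
        have "(\<Sum>K\<in>\<K>. ennreal ((a - w x)\<^sup>2) * indicator {x \<in> ?V. lift x \<in> f K} x)
           = (\<Sum>K\<in>{K0}. ennreal ((a - w x)\<^sup>2) * indicator {x \<in> ?V. lift x \<in> f K} x)"
          using K0 f(4) finite_\<K> by (intro sum.mono_neutral_right) (auto simp: disjoint_family_on_def indicator_def)
        then show ?thesis using True K0 by simp
      qed simp
    qed
    finally show ?thesis by (simp add: mult_left_mono)
  qed
  have "ennreal area * (\<integral>\<^sup>+x\<in>?V. ennreal ((w x - ?avg)\<^sup>2) \<partial>lborel) = (\<integral>\<^sup>+x. ennreal (area * (w x - ?avg)\<^sup>2) * indicator ?V x \<partial>lborel)"
    using area_pos by (subst nn_integral_cmult[symmetric]) (auto simp: ennreal_mult mult.assoc)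
  also have "\<dots> \<le> (\<integral>\<^sup>+x. ennreal (lower_const d (r/6)) * ((\<integral>\<^sup>+y\<in>?V. ennreal ((w x - w y)\<^sup>2) \<partial>lborel) * indicator ?V x) \<partial>lborel)"
    using key by (intro nn_integral_mono) (auto simp: indicator_def)
  also have "\<dots> = ennreal (lower_const d (r/6)) * square_diff w ?V ?V"
    unfolding square_diff_def by (rule nn_integral_cmult) measurable
  also have "\<dots> \<le> ennreal (lower_const d (r/6)) * ennreal (tube_const * (16 * \<Lambda>\<^sup>2) * upper_const d * (\<Sum>K\<in>\<K>. (g K)\<^sup>2 * measure (flat_lborel K) K))"
    unfolding w_def by (intro mult_left_mono lifted_square_diff_le[OF v g0 g]) auto
  finally have *: "ennreal area * (\<integral>\<^sup>+x\<in>?V. ennreal ((w x - ?avg)\<^sup>2) \<partial>lborel)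
    \<le> ennreal (lower_const d (r/6)) * ennreal (tube_const * (16 * \<Lambda>\<^sup>2) * upper_const d * (\<Sum>K\<in>\<K>. (g K)\<^sup>2 * measure (flat_lborel K) K))" .
  \<comment> \<open>The lower bound for the area gives \<open>c * area\<close> at least 1, which
    removes the area from the left-hand side at the price of a mesh-independent constant.\<close>
  define c where "c = upper_const d / tube_volume"
  have c: "0 < c" "1 \<le> c * area"
    using area_ge upper_const_pos[of d] tube_volume(2) by (auto simp: c_def field_simps)
  have "(\<integral>\<^sup>+x\<in>?V. ennreal ((v (lift x) - ?avg)\<^sup>2) \<partial>lborel) = (\<integral>\<^sup>+x\<in>?V. ennreal ((w x - ?avg)\<^sup>2) \<partial>lborel)"
    using w by (intro nn_integral_cong) (auto simp: indicator_def)
  also have "\<dots> \<le> ennreal (c * area) * (\<integral>\<^sup>+x\<in>?V. ennreal ((w x - ?avg)\<^sup>2) \<partial>lborel)"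
    using c mult_right_mono[of 1 "ennreal (c * area)"] by simp
  also have "\<dots> = ennreal c * (ennreal area * (\<integral>\<^sup>+x\<in>?V. ennreal ((w x - ?avg)\<^sup>2) \<partial>lborel))"
    using c area_pos by (simp add: ennreal_mult mult.assoc)
  also have "\<dots> \<le> ennreal c * (ennreal (lower_const d (r/6)) * ennreal (tube_const * (16 * \<Lambda>\<^sup>2) * upper_const d * (\<Sum>K\<in>\<K>. (g K)\<^sup>2 * measure (flat_lborel K) K)))"
    using * by (rule mult_left_mono) simp
  also have "\<dots> = ennreal (surface_const d * (\<Sum>K\<in>\<K>. (g K)\<^sup>2 * measure (flat_lborel K) K))"
    using c L tube_const(1) upper_const_pos[of d]
    by (simp add: ennreal_mult[symmetric] sum_nonneg surface_const_def c_def mult_ac)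
  finally show ?thesis .
qed

end

section \<open>Estimates on the background mesh\<close>

text \<open>The values are covered, not the parameters: each index contributes one interval of
  length \<open>2 * \<delta> i\<close> to the range of \<open>f\<close>, however often the path
  returns to the corresponding element.\<close>

lemma oscillation_le_cover:
  fixes f :: "real \<Rightarrow> real"
  assumes f: "continuous_on {0..1} f" and I: "finite I" and \<delta>: "\<And>i. i \<in> I \<Longrightarrow> 0 \<le> \<delta> i"
    and cover: "\<And>t. t \<in> {0..1} \<Longrightarrow> \<exists>i\<in>I. \<bar>f t - c i\<bar> \<le> \<delta> i"
  shows "\<bar>f 0 - f 1\<bar> \<le> (\<Sum>i\<in>I. 2 * \<delta> i)"
proof -
  let ?J = "{min (f 0) (f 1)..max (f 0) (f 1)}"
  have conn: "connected (f ` {0..1})" using f connected_continuous_image connected_Icc by blast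
  have "?J \<subseteq> f ` {0..1}"
    by (rule connected_contains_Icc[OF conn]) (auto simp: min_def max_def)
  also have "\<dots> \<subseteq> (\<Union>i\<in>I. {c i - \<delta> i..c i + \<delta> i})"
  proof clarify
    fix t :: real assume "t \<in> {0..1}"
    then obtain i where "i \<in> I" "\<bar>f t - c i\<bar> \<le> \<delta> i" using cover by blast
    then show "f t \<in> (\<Union>i\<in>I. {c i - \<delta> i..c i + \<delta> i})" by (intro UN_I[of i]) auto
  qed
  finally have J: "?J \<subseteq> (\<Union>i\<in>I. {c i - \<delta> i..c i + \<delta> i})" .
  have "ennreal \<bar>f 0 - f 1\<bar> = emeasure lborel ?J" by (simp add: min_def max_def)
  also have "\<dots> \<le> emeasure lborel (\<Union>i\<in>I. {c i - \<delta> i..c i + \<delta> i})" using J I by (intro emeasure_mono) auto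
  also have "\<dots> \<le> (\<Sum>i\<in>I. emeasure lborel {c i - \<delta> i..c i + \<delta> i})" using I by (intro emeasure_subadditive_finite) auto
  also have "\<dots> = (\<Sum>i\<in>I. ennreal (2 * \<delta> i))" using \<delta> by (intro sum.cong) auto
  also have "\<dots> = ennreal (\<Sum>i\<in>I. 2 * \<delta> i)" using \<delta> by (intro sum_ennreal) auto
  finally show ?thesis using \<delta> by (simp add: sum_nonneg)
qed

lemma negligible_Int_of_interior_disjoint:
  fixes A B :: "'a::euclidean_space set"
  assumes "convex A" "convex B" "interior A \<inter> interior B = {}"
  shows "negligible (A \<inter> B)"
  using assms by (simp add: convex_Int negligible_convex_interior)

section \<open>Volume of the tube above a small piece of the manifold\<close>

context tubular begin

definition section_const :: "nat \<Rightarrow> real" where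
  "section_const d = (1 / (\<Lambda> * real DIM('a))) ^ d * (r / (12 * real DIM('a))) ^ (DIM('a) - d) / (2 * real DIM('a)) ^ DIM('a)"

lemma section_const_pos: "0 < section_const d"
  unfolding section_const_def using \<Lambda>_ge1 r_pos by (intro divide_pos_pos mult_pos_pos zero_less_power) auto

lemma section_borel:
  assumes "s \<le> r" shows "{x \<in> tube \<Gamma> s. norm (p x - q) < h} \<in> sets borel"
proof -
  have "continuous_on (tube \<Gamma> s) p" by (rule continuous_on_subset[OF p_continuous]) (use assms in \<open>auto simp: tube_def\<close>)
  then have "open (tube \<Gamma> s \<inter> p -` ball q h)"
    using continuous_on_open_vimage[OF open_tube, of \<Gamma> s p] open_ball[of q h] by (simp add: Int_commute)
  moreover have "tube \<Gamma> s \<inter> p -` ball q h = {x \<in> tube \<Gamma> s. norm (p x - q) < h}"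
    by (auto simp: dist_norm norm_minus_commute)
  ultimately show ?thesis by simp
qed

text \<open>The set contains a box about \<open>q\<close> with tangential half-widths proportional
  to \<open>h\<close> and normal ones proportional to \<open>r\<close>. A normal offset does not
  move the projection by \<open>fibre\<close>, and a tangential offset moves it at most
  \<open>\<Lambda>\<close> times its length.\<close>

lemma section_measure:
  assumes q: "q \<in> \<Gamma>" and d: "dim (range (D q)) = d" and h: "0 < h" "h \<le> r / 6"
  shows "ennreal (section_const d * h ^ d) \<le> emeasure lborel {x \<in> tube \<Gamma> (r/6). norm (p x - q) < h}"
proof -
  let ?k = "real DIM('a)" and ?R = "{x \<in> tube \<Gamma> (r/6). norm (p x - q) < h}"
  note P = D_proj[OF q]
  define L where "L = range (D q)"
  have sL: "subspace L" unfolding L_def using projector_linear[OF P] by (simp add: linear_subspace_image)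
  obtain B1 where B1: "orthonormal B1" "card B1 = dim L" "span B1 = L" by (rule subspace_orthonormal_basis[OF sL])
  obtain B2 where B2: "orthonormal B2" "card B2 = DIM('a) - dim L" "span B2 = {x. \<forall>y\<in>L. orthogonal y x}"
    by (rule orthogonal_complement_basis[OF sL])
  have kerD: "D q n = 0" if "n \<in> span B2" for n
  proof -
    have "D q n \<bullet> D q n = D q (D q n) \<bullet> n" using projector_sym[OF P] by simp
    also have "\<dots> = 0" using that B2(3) by (simp add: L_def orthogonal_def)
    finally show ?thesis by simp
  qed
  have fin: "finite B1" "finite B2" using B1 B2 orthonormal_finite by auto
  note BB = orthonormal_complement_Un[OF B1(1) B2(1) B2(3)[folded B1(3)]]
  note disj = BB(1) and oBB = BB(2)
  obtain \<beta> where "orthonormal_frame (B1 \<union> B2) \<beta>" using orthonormal_frame_exists[OF oBB BB(3)] by blast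
  then interpret F: orthonormal_frame "B1 \<union> B2" \<beta> .
  \<comment> \<open>The tangential part is then at most \<open>h / (2 * \<Lambda>)\<close> long, so
    the projection moves by at most \<open>h / 2\<close>. Together with the normal part of at most
    \<open>r / 24\<close> and \<open>h \<le> r / 6\<close>, the box stays in the tube of radius
    \<open>r / 6\<close>.\<close>
  define \<rho>1 \<rho>2 where "\<rho>1 = h / (2 * \<Lambda> * ?k)" and "\<rho>2 = r / (24 * ?k)"
  have \<rho>: "0 < \<rho>1" "0 < \<rho>2" using h r_pos \<Lambda>_ge1 by (auto simp: \<rho>1_def \<rho>2_def)
  define \<rho> where "\<rho> b = (if b \<in> B1 then \<rho>1 else \<rho>2)" for b
  have sub: "{x. \<forall>b\<in>B1 \<union> B2. \<bar>(x - q) \<bullet> b\<bar> < \<rho> b} \<subseteq> ?R"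
  proof clarify
    fix x assume x: "\<forall>b\<in>B1 \<union> B2. \<bar>(x - q) \<bullet> b\<bar> < \<rho> b"
    define a n where "a = (\<Sum>b\<in>B1. ((x - q) \<bullet> b) *\<^sub>R b)" and "n = (\<Sum>b\<in>B2. ((x - q) \<bullet> b) *\<^sub>R b)"
    have "x - q = (\<Sum>b\<in>B1 \<union> B2. ((x - q) \<bullet> b) *\<^sub>R b)"
      using orthonormal_expand[OF oBB, of "x - q"] F.span_UNIV by simp
    then have "x - q = a + n" unfolding a_def n_def using sum.union_disjoint[OF fin disj] by metis
    then have xan: "x = (q + n) + a" by (simp add: algebra_simps)
    have b1: "\<bar>(x - q) \<bullet> b\<bar> \<le> \<rho>1" if "b \<in> B1" for b using bspec[OF x, of b] that by (simp add: \<rho>_def)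
    have b2: "\<bar>(x - q) \<bullet> b\<bar> \<le> \<rho>2" if "b \<in> B2" for b 
      using bspec[OF x, of b] that disj by (auto simp: \<rho>_def split: if_splits)
    have "norm a \<le> (\<Sum>b\<in>B1. \<rho>1)" unfolding a_def using b1 by (rule orthonormal_sum_norm_le[OF B1(1)])
    also have "\<dots> \<le> ?k * \<rho>1" using B1(2) dim_subset_UNIV[of L] \<rho> by (simp add: mult_right_mono)
    also have "\<dots> = h / (2 * \<Lambda>)" by (simp add: \<rho>1_def)
    finally have na: "norm a \<le> h / (2 * \<Lambda>)" .
    also have "\<dots> \<le> h / 2" using \<Lambda>_ge1 h by (simp add: field_simps)
    finally have na': "norm a \<le> h / 2" .
    have "norm n \<le> (\<Sum>b\<in>B2. \<rho>2)" unfolding n_def using b2 by (rule orthonormal_sum_norm_le[OF B2(1)])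
    also have "\<dots> \<le> ?k * \<rho>2" using B2(2) \<rho> by (simp add: mult_right_mono)
    also have "\<dots> = r / 24" by (simp add: \<rho>2_def)
    finally have nn: "norm n \<le> r / 24" .
    have nspan: "n \<in> span B2" unfolding n_def by (intro span_sum span_scale span_base)
    have pn: "p (q + n) = q" by (rule fibre[OF q kerD[OF nspan]]) (use nn r_pos in linarith)
    have "infdist (q + n) \<Gamma> \<le> r / 24" using infdist_le[OF q, of "q + n"] nn by (simp add: dist_norm)
    then have t1: "q + n \<in> tube \<Gamma> r" using r_pos by (simp add: tube_def)
    have "norm (x - q) \<le> norm n + norm a" using norm_triangle_ineq[of n a] by (simp add: xan)
    then have "infdist x \<Gamma> < r / 6" using infdist_le[OF q, of x] nn na' h r_pos by (simp add: dist_norm)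
    then have t2: "x \<in> tube \<Gamma> (r/6)" "x \<in> tube \<Gamma> r" using r_pos by (auto simp: tube_def)
    have "norm (p x - q) \<le> \<Lambda> * norm (x - (q + n))" using p_lip[OF t2(2) t1] pn by simp
    also have "\<dots> = \<Lambda> * norm a" by (simp add: xan)
    also have "\<dots> \<le> \<Lambda> * (h / (2 * \<Lambda>))" using na \<Lambda>_ge1 by (intro mult_left_mono) auto
    also have "\<dots> < h" using \<Lambda>_ge1 h by simp
    finally show "x \<in> tube \<Gamma> (r/6) \<and> norm (p x - q) < h" using t2 by simp
  qed
  have "ennreal (\<Prod>b\<in>B1 \<union> B2. 2 * \<rho> b) \<le> ennreal ((2 * ?k) ^ DIM('a)) * emeasure lborel {x. \<forall>b\<in>B1 \<union> B2. \<bar>(x - q) \<bullet> b\<bar> < \<rho> b}"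
    by (rule F.frame_box_measure) (use \<rho> in \<open>auto simp: \<rho>_def\<close>)
  also have "(\<Prod>b\<in>B1 \<union> B2. 2 * \<rho> b) = (\<Prod>b\<in>B1. 2 * \<rho>1) * (\<Prod>b\<in>B2. 2 * \<rho>2)"
    unfolding prod.union_disjoint[OF fin disj] using disj
    by (intro arg_cong2[where f="(*)"] prod.cong) (auto simp: \<rho>_def)
  also have "\<dots> = (2 * \<rho>1) ^ d * (2 * \<rho>2) ^ (DIM('a) - d)" using B1(2) B2(2) d by (simp add: L_def)
  also have "ennreal ((2 * ?k) ^ DIM('a)) * emeasure lborel {x. \<forall>b\<in>B1 \<union> B2. \<bar>(x - q) \<bullet> b\<bar> < \<rho> b}
      \<le> ennreal ((2 * ?k) ^ DIM('a)) * emeasure lborel ?R"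
    using section_borel[of "r/6" q h] r_pos sub by (intro mult_left_mono emeasure_mono) auto
  finally have le: "ennreal ((2 * \<rho>1) ^ d * (2 * \<rho>2) ^ (DIM('a) - d)) \<le> ennreal ((2 * ?k) ^ DIM('a)) * emeasure lborel ?R" .
  define K where "K = (2 * ?k) ^ DIM('a)"
  have K: "0 < K" by (simp add: K_def)
  have eq: "section_const d * h ^ d = (1 / K) * ((2 * \<rho>1) ^ d * (2 * \<rho>2) ^ (DIM('a) - d))"
    by (simp add: section_const_def K_def \<rho>1_def \<rho>2_def power_divide power_mult_distrib mult_ac)
  have "ennreal (section_const d * h ^ d) = ennreal (1 / K) * ennreal ((2 * \<rho>1) ^ d * (2 * \<rho>2) ^ (DIM('a) - d))"
    unfolding eq using K \<rho> by (intro ennreal_mult) auto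
  also have "\<dots> \<le> ennreal (1 / K) * (ennreal K * emeasure lborel ?R)"
    unfolding K_def by (intro mult_left_mono le) simp
  also have "\<dots> = emeasure lborel ?R" using K by (simp add: mult.assoc[symmetric] ennreal_mult[symmetric])
  finally show ?thesis .
qed

end

text \<open>Here \<open>\<T>\<close> is already the active mesh, \<open>G T\<close> is the constant
  gradient on \<open>T\<close>, and \<open>\<sigma>\<close> compares \<open>h\<close> directly with
  the inradius. Distance to \<open>\<Gamma>\<close> appears twice: \<open>\<eta>\<close> is a fixed
  threshold for the geometry, \<open>near_h\<close> controls how far paths stray on the scale of the
  mesh.\<close>

locale fe_setting = discrete_surface \<Gamma> p D r \<Lambda> d \<K> \<eta>
  for \<Gamma> :: "'a::euclidean_space set" and p D r \<Lambda> d \<K> \<eta> +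
  fixes h \<sigma> \<tau> :: real and \<T> :: "'a set set" and v :: "'a \<Rightarrow> real" and G :: "'a set \<Rightarrow> 'a" and b :: "'a set \<Rightarrow> real"
  assumes h: "0 < h" "h \<le> r / 6" and \<sigma>: "1 \<le> \<sigma>" and \<tau>: "1 \<le> \<tau>"
    and finite_\<T>: "finite \<T>" and T_convex: "T \<in> \<T> \<Longrightarrow> convex T" and T_compact: "T \<in> \<T> \<Longrightarrow> compact T"
    and T_active: "T \<in> \<T> \<Longrightarrow> T \<inter> \<Union>\<K> \<noteq> {}"
    and T_disjoint: "T \<in> \<T> \<Longrightarrow> T' \<in> \<T> \<Longrightarrow> T \<noteq> T' \<Longrightarrow> interior T \<inter> interior T' = {}"
    and T_ball: "T \<in> \<T> \<Longrightarrow> \<exists>x \<rho>. h \<le> \<sigma> * \<rho> \<and> cball x \<rho> \<subseteq> T"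
    and T_diam: "T \<in> \<T> \<Longrightarrow> x \<in> T \<Longrightarrow> y \<in> T \<Longrightarrow> norm (x - y) \<le> \<tau> * h"
    and compat: "K \<in> \<K> \<Longrightarrow> \<exists>T\<in>\<T>. K \<subseteq> T"
    and near_h: "x \<in> \<Union>\<K> \<Longrightarrow> norm (x - p x) \<le> h"
    and v_cont: "continuous_on (\<Union>\<T>) v"
    and v_affine: "T \<in> \<T> \<Longrightarrow> x \<in> T \<Longrightarrow> v x = G T \<bullet> x + b T"
begin

lemma surface_covered: "\<Union>\<K> \<subseteq> \<Union>\<T>" using compat by blast

lemma T_lmeasurable: "T \<in> \<T> \<Longrightarrow> T \<in> lmeasurable" by (simp add: T_compact lmeasurable_compact)

lemma T_negligible_Int: "T \<in> \<T> \<Longrightarrow> T' \<in> \<T> \<Longrightarrow> T \<noteq> T' \<Longrightarrow> negligible (T \<inter> T')"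
  by (intro negligible_Int_of_interior_disjoint T_convex T_disjoint)

lemma unit_ball_pos: "0 < measure lebesgue (ball (0::'a) 1)" using content_ball_pos[of 1 "0::'a"] by simp

lemma T_measure_ge: assumes T: "T \<in> \<T>" shows "(h / \<sigma>) ^ DIM('a) * measure lebesgue (ball (0::'a) 1) \<le> measure lebesgue T"
proof -
  obtain x \<rho> where x: "h \<le> \<sigma> * \<rho>" "cball x \<rho> \<subseteq> T" using T_ball[OF T] by blast
  have \<rho>1: "h / \<sigma> \<le> \<rho>" using x \<sigma> by (simp add: field_simps)
  moreover have "0 < h / \<sigma>" using h \<sigma> by simp
  ultimately have \<rho>: "h / \<sigma> \<le> \<rho>" "0 \<le> \<rho>" by linarith+
  have "(h / \<sigma>) ^ DIM('a) * measure lebesgue (ball (0::'a) 1) \<le> \<rho> ^ DIM('a) * measure lebesgue (ball (0::'a) 1)"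
    using \<rho> h \<sigma> by (intro mult_right_mono power_mono) auto
  also have "\<dots> = measure lebesgue (cball x \<rho>)" using content_ball_conv_unit_ball[OF \<rho>(2), of x] by (simp add: content_cball_conv_ball)
  also have "\<dots> \<le> measure lebesgue T" using x T_lmeasurable[OF T] by (intro measure_mono_fmeasurable) auto
  finally show ?thesis .
qed

lemma T_measure_le: assumes T: "T \<in> \<T>" shows "measure lebesgue T \<le> (\<tau> * h) ^ DIM('a) * measure lebesgue (ball (0::'a) 1)"
proof -
  obtain x where x: "x \<in> T" using T_active[OF T] by blast
  have "T \<subseteq> cball x (\<tau> * h)" using T_diam[OF T x] by (auto simp: dist_norm)
  then have "measure lebesgue T \<le> measure lebesgue (cball x (\<tau> * h))"
    using T_lmeasurable[OF T] by (intro measure_mono_fmeasurable) (auto simp: fmeasurableD)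
  then show ?thesis using content_ball_conv_unit_ball[of "\<tau> * h" x] h \<tau> by (simp add: content_cball_conv_ball)
qed

section \<open>Counting elements near a point\<close>

definition count_const :: "real \<Rightarrow> real" where "count_const a = ((a + \<tau>) * \<sigma>) ^ DIM('a)"

lemma count_const_pos: "0 \<le> a \<Longrightarrow> 0 < count_const a" using \<tau> \<sigma> by (simp add: count_const_def)

text \<open>A packing argument: these elements lie in the ball of radius
  \<open>(a + \<tau>) * h\<close>, overlap in null sets only, and each has at least the volume of a
  ball of radius \<open>h / \<sigma>\<close>.\<close>

lemma count_elements:
  assumes a: "0 \<le> a"
  shows "real (card {T\<in>\<T>. T \<inter> cball z (a * h) \<noteq> {}}) \<le> count_const a"
proof -
  let ?N = "{T\<in>\<T>. T \<inter> cball z (a * h) \<noteq> {}}"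
  have fin: "finite ?N" using finite_\<T> by simp
  have "real (card ?N) * ((h / \<sigma>) ^ DIM('a) * measure lebesgue (ball (0::'a) 1)) \<le> (\<Sum>T\<in>?N. measure lebesgue T)"
    using T_measure_ge by (intro sum_bounded_below) auto
  also have "\<dots> = measure lebesgue (\<Union>?N)"
    using fin T_lmeasurable T_negligible_Int
    by (intro measure_negligible_finite_Union[symmetric]) (auto simp: pairwise_def)
  also have "\<dots> \<le> measure lebesgue (cball z ((a + \<tau>) * h))"
  proof (rule measure_mono_fmeasurable)
    show "\<Union>?N \<subseteq> cball z ((a + \<tau>) * h)"
    proof clarify
      fix x T y assume T: "x \<in> T" "T \<in> \<T>" "T \<inter> cball z (a * h) \<noteq> {}"
      then obtain y where y: "y \<in> T" "dist z y \<le> a * h" by auto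
      have "dist z x \<le> dist z y + dist y x" by (rule dist_triangle)
      also have "\<dots> \<le> a * h + \<tau> * h" using y T_diam[OF T(2) y(1) T(1)] by (simp add: dist_norm)
      finally show "x \<in> cball z ((a + \<tau>) * h)" by (simp add: algebra_simps)
    qed
    show "\<Union>?N \<in> sets lebesgue" using fin T_lmeasurable by (intro sets.finite_Union) (auto simp: fmeasurableD)
  qed simp
  also have "\<dots> = ((a + \<tau>) * h) ^ DIM('a) * measure lebesgue (ball (0::'a) 1)"
    using content_ball_conv_unit_ball[of "(a + \<tau>) * h" z] a h \<tau> by (simp add: content_cball_conv_ball)
  also have "\<dots> = count_const a * ((h / \<sigma>) ^ DIM('a) * measure lebesgue (ball (0::'a) 1))"
    using \<sigma> by (simp add: count_const_def power_mult_distrib power_divide)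
  finally show ?thesis using h \<sigma> unit_ball_pos by (simp add: mult_le_cancel_right)
qed

definition anchor :: "'a set \<Rightarrow> 'a" where "anchor T = (SOME y. y \<in> T \<inter> \<Union>\<K>)"

lemma anchor: "T \<in> \<T> \<Longrightarrow> anchor T \<in> T" "T \<in> \<T> \<Longrightarrow> anchor T \<in> \<Union>\<K>"
  using someI_ex[of "\<lambda>y. y \<in> T \<inter> \<Union>\<K>"] T_active[of T] unfolding anchor_def by blast+

text \<open>The radius adds up the distance from a path point to its projection, the length
  \<open>\<Lambda> * h\<close> of the projected way, and the distance from the projection of the
  anchor to the anchor.\<close>

definition patch :: "'a set \<Rightarrow> 'a set set" where
  "patch T = {T'\<in>\<T>. T' \<inter> cball (anchor T) ((\<Lambda> + 2) * h) \<noteq> {}}"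

definition slab :: "'a set \<Rightarrow> 'a set" where
  "slab T = {x \<in> tube \<Gamma> (r/6). norm (p x - p (anchor T)) < h}"

text \<open>The dimension of the tangent space is read off from a simplex through the anchor: the
  two projectors are close, so \<open>projector_dim_le\<close> applies in both directions.\<close>

lemma slab_measure:
  assumes T: "T \<in> \<T>" shows "ennreal (section_const d * h ^ d) \<le> emeasure lborel (slab T)"
  unfolding slab_def
proof (rule section_measure[OF p_mem _ h])
  obtain K where K: "K \<in> \<K>" "anchor T \<in> K" using anchor[OF T] by blast
  let ?P = "orth_proj (parallel_space K)"
  note P = is_projector_orth_proj[OF subspace_parallel_space[of K]]
  have "range ?P = parallel_space K"
    using orth_proj_mem[OF subspace_parallel_space[of K]] orth_proj_id[OF subspace_parallel_space[of K]]
    by (metis image_subset_iff rangeI subsetI subset_antisym)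
  then have r: "dim (range ?P) = d" using K_props(8)[OF K(1)] by simp
  have c: "norm (D (p (anchor T)) u - ?P u) \<le> 1/4 * norm u" for u using D_near_parallel[OF K] .
  have "dim (range ?P) \<le> dim (range (D (p (anchor T))))"
    by (rule projector_dim_le[OF P D_proj[OF p_mem] c])
  moreover have "dim (range (D (p (anchor T)))) \<le> dim (range ?P)"
    by (rule projector_dim_le[OF D_proj[OF p_mem] P]) (use c in \<open>simp add: norm_minus_commute\<close>)
  ultimately show "dim (range (D (p (anchor T)))) = d" using r by simp
qed

lemma slab_borel [measurable]: "slab T \<in> sets borel"
  unfolding slab_def using r_pos by (intro section_borel) simp

lemma v_oscillation: "T \<in> \<T> \<Longrightarrow> x \<in> T \<Longrightarrow> y \<in> T \<Longrightarrow> \<bar>v x - v y\<bar> \<le> \<tau> * h * norm (G T)"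
proof -
  assume T: "T \<in> \<T>" "x \<in> T" "y \<in> T"
  have "v x - v y = G T \<bullet> (x - y)" using v_affine[OF T(1)] T by (simp add: inner_diff_right)
  then have "\<bar>v x - v y\<bar> \<le> norm (G T) * norm (x - y)" using Cauchy_Schwarz_ineq2[of "G T" "x - y"] by simp
  also have "\<dots> \<le> norm (G T) * (\<tau> * h)" using T_diam[OF T] by (intro mult_left_mono) auto
  finally show ?thesis by (simp add: mult_ac)
qed

text \<open>The segment between the two projections runs in the ambient space but stays in the tube,
  as it is shorter than \<open>h\<close>. Its lift is a path in the discrete surface from the anchor
  to \<open>lift x\<close>, because \<open>p\<close> fixes both ends of the segment.
  \<open>oscillation_le_cover\<close> charges every element of the patch once.\<close>

lemma slab_oscillation:
  assumes T: "T \<in> \<T>" and x: "x \<in> slab T"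
  shows "\<bar>v (anchor T) - v (lift x)\<bar> \<le> (\<Sum>T'\<in>patch T. 2 * (\<tau> * h * norm (G T')))"
proof -
  let ?q = "p (anchor T)"
  define z where "z t = ?q + t *\<^sub>R (p x - ?q)" for t :: real
  have zq: "norm (z t - ?q) \<le> h" if "t \<in> {0..1}" for t
  proof -
    have "norm (z t - ?q) = \<bar>t\<bar> * norm (p x - ?q)" by (simp add: z_def)
    also have "\<dots> \<le> 1 * norm (p x - ?q)" using that by (intro mult_right_mono) auto
    finally show ?thesis using x by (simp add: slab_def)
  qed
  have zU: "z t \<in> tube \<Gamma> r" if "t \<in> {0..1}" for t
    using infdist_le[OF p_mem, of "z t" "anchor T"] zq[OF that] h r_pos by (simp add: tube_def dist_norm)
  have qU: "?q \<in> tube \<Gamma> r" using p_mem r_pos by (simp add: tube_def)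
  define f where "f t = v (lift (z t))" for t
  have "\<bar>f 0 - f 1\<bar> \<le> (\<Sum>T'\<in>patch T. 2 * (\<tau> * h * norm (G T')))"
  proof (rule oscillation_le_cover)
    have "continuous_on {0..1} (\<lambda>t. lift (z t))"
      using zU by (intro continuous_on_compose2[OF lift_continuous]) (auto simp: z_def intro!: continuous_intros)
    then show "continuous_on {0..1} f"
      unfolding f_def using lift_mem surface_covered by (intro continuous_on_compose2[OF v_cont]) auto
    show "finite (patch T)" using finite_\<T> by (simp add: patch_def)
    show "0 \<le> \<tau> * h * norm (G T')" for T' using \<tau> h by simp
    fix t :: real assume t: "t \<in> {0..1}"
    let ?c = "lift (z t)"
    obtain T' where T': "T' \<in> \<T>" "?c \<in> T'" using lift_mem surface_covered by blast
    have "norm (?c - anchor T) \<le> norm (?c - p ?c) + norm (p ?c - ?q) + norm (?q - anchor T)"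
      using norm_triangle_ineq[of "?c - p ?c" "p ?c - ?q"] norm_triangle_ineq[of "?c - ?q" "?q - anchor T"] by simp
    also have "norm (?c - p ?c) \<le> h" by (rule near_h[OF lift_mem])
    also have "norm (?q - anchor T) \<le> h" using near_h[OF anchor(2)[OF T]] by (simp add: norm_minus_commute)
    also have "norm (p ?c - ?q) \<le> \<Lambda> * h"
    proof -
      have "norm (p ?c - ?q) = norm (p (z t) - p ?q)" by (simp add: p_lift p_id p_mem)
      also have "\<dots> \<le> \<Lambda> * norm (z t - ?q)" by (rule p_lip[OF zU[OF t] qU])
      also have "\<dots> \<le> \<Lambda> * h" using zq[OF t] \<Lambda>_ge1 by (intro mult_left_mono) auto
      finally show ?thesis .
    qed
    finally have "norm (?c - anchor T) \<le> (\<Lambda> + 2) * h" by (simp add: algebra_simps)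
    then have "?c \<in> T' \<inter> cball (anchor T) ((\<Lambda> + 2) * h)" using T' by (simp add: dist_norm norm_minus_commute)
    then have "T' \<in> patch T" using T' unfolding patch_def by blast
    moreover have "\<bar>f t - v (anchor T')\<bar> \<le> \<tau> * h * norm (G T')"
      unfolding f_def by (rule v_oscillation[OF T' anchor(1)[OF T'(1)]])
    ultimately show "\<exists>i\<in>patch T. \<bar>f t - v (anchor i)\<bar> \<le> \<tau> * h * norm (G i)" by blast
  qed
  moreover have "lift (z 0) = anchor T" by (rule lift_eqI[OF anchor(2)[OF T]]) (simp add: z_def p_id p_mem)
  moreover have "lift (z 1) = lift x" unfolding lift_def by (simp add: z_def p_id p_mem)
  ultimately show ?thesis by (simp add: f_def)
qed

text \<open>Carries no volume weights: all element volumes are comparable to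
  \<open>h ^ DIM('a)\<close>, and this factor is restored in \<open>bulk_estimate\<close>.\<close>

definition grad_energy :: real where "grad_energy = (\<Sum>T\<in>\<T>. (norm (G T))\<^sup>2)"

definition surface_energy :: real where
  "surface_energy = (\<Sum>K\<in>\<K>. (norm (orth_proj (parallel_space K) (G (SOME T. T \<in> \<T> \<and> K \<subseteq> T))))\<^sup>2 * measure (flat_lborel K) K)"

lemma chosen_element: "K \<in> \<K> \<Longrightarrow> (SOME T. T \<in> \<T> \<and> K \<subseteq> T) \<in> \<T>" "K \<in> \<K> \<Longrightarrow> K \<subseteq> (SOME T. T \<in> \<T> \<and> K \<subseteq> T)"
  using someI_ex[of "\<lambda>T. T \<in> \<T> \<and> K \<subseteq> T"] compat[of K] by blast+

text \<open>Differences of points of \<open>K\<close> lie in \<open>parallel_space K\<close>, so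
  only the projected gradient acts on them. Its norm is the Lipschitz constant of \<open>v\<close>
  on \<open>K\<close>.\<close>

lemma lifted_energy:
  "(\<integral>\<^sup>+x\<in>tube \<Gamma> (r/6). ennreal ((v (lift x) - surface_average \<K> v)\<^sup>2) \<partial>lborel) \<le> ennreal (surface_const d * surface_energy)"
  unfolding surface_energy_def
proof (rule surface_poincare)
  show "continuous_on (\<Union>\<K>) v" using v_cont surface_covered by (rule continuous_on_subset)
  fix K a c assume K: "K \<in> \<K>" "a \<in> K" "c \<in> K"
  let ?T = "SOME T. T \<in> \<T> \<and> K \<subseteq> T"
  note T = chosen_element[OF K(1)]
  let ?P = "orth_proj (parallel_space K)"
  note P = is_projector_orth_proj[OF subspace_parallel_space[of K]]
  have "v a - v c = G ?T \<bullet> (a - c)" using v_affine[OF T(1)] T(2) K by (simp add: inner_diff_right subset_iff)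
  also have "a - c = ?P (a - c)" using K by (simp add: orth_proj_id parallel_space_diff)
  also have "G ?T \<bullet> ?P (a - c) = ?P (G ?T) \<bullet> (a - c)" using projector_sym[OF P] by simp
  finally show "\<bar>v a - v c\<bar> \<le> norm (?P (G ?T)) * norm (a - c)" using Cauchy_Schwarz_ineq2[of "?P (G ?T)" "a - c"] by simp
qed simp

definition anchor_error :: "'a set \<Rightarrow> real" where
  "anchor_error T = (v (anchor T) - surface_average \<K> v)\<^sup>2"

text \<open>The 8 is 2 from splitting a square times 4 from squaring the interval length
  \<open>2 * \<tau> * h * norm (G T')\<close>; the count comes from Cauchy-Schwarz over the
  patch.\<close>

definition patch_term :: "'a set \<Rightarrow> real" where
  "patch_term T = 8 * count_const (\<Lambda> + 2) * (\<tau> * h)\<^sup>2 * (\<Sum>T'\<in>patch T. (norm (G T'))\<^sup>2)"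

lemma anchor_error_le:
  assumes T: "T \<in> \<T>" and x: "x \<in> slab T"
  shows "anchor_error T \<le> 2 * (v (lift x) - surface_average \<K> v)\<^sup>2 + patch_term T"
proof -
  let ?avg = "surface_average \<K> v" and ?N = "count_const (\<Lambda> + 2)"
  define s where "s = (\<Sum>T'\<in>patch T. norm (G T'))"
  have card: "real (card (patch T)) \<le> ?N" unfolding patch_def by (rule count_elements) (use \<Lambda>_ge1 in simp)
  have "s\<^sup>2 \<le> (\<Sum>T'\<in>patch T. (norm (G T'))\<^sup>2) * real (card (patch T))"
    unfolding s_def by (rule sum_squared_le_sum_of_squares)
  also have "\<dots> \<le> (\<Sum>T'\<in>patch T. (norm (G T'))\<^sup>2) * ?N"
    using card by (intro mult_left_mono sum_nonneg) auto
  finally have s2: "s\<^sup>2 \<le> ?N * (\<Sum>T'\<in>patch T. (norm (G T'))\<^sup>2)" by (simp add: mult.commute)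
  have "\<bar>v (anchor T) - v (lift x)\<bar> \<le> 2 * \<tau> * h * s"
    using slab_oscillation[OF T x] by (simp add: s_def sum_distrib_left mult_ac)
  then have "(v (anchor T) - v (lift x))\<^sup>2 \<le> (2 * \<tau> * h * s)\<^sup>2" by (meson abs_le_square_iff abs_of_nonneg abs_ge_self order_trans power2_abs abs_le_D1 power_mono abs_ge_zero)
  also have "\<dots> = 4 * (\<tau> * h)\<^sup>2 * s\<^sup>2" by (simp add: power_mult_distrib)
  also have "\<dots> \<le> 4 * (\<tau> * h)\<^sup>2 * (?N * (\<Sum>T'\<in>patch T. (norm (G T'))\<^sup>2))" using s2 by (intro mult_left_mono) auto
  finally have 1: "2 * (v (anchor T) - v (lift x))\<^sup>2 \<le> patch_term T" by (simp add: patch_term_def)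
  have "0 \<le> ((v (anchor T) - v (lift x)) - (v (lift x) - ?avg))\<^sup>2" by simp
  then have "anchor_error T \<le> 2 * (v (anchor T) - v (lift x))\<^sup>2 + 2 * (v (lift x) - ?avg)\<^sup>2"
    by (simp add: anchor_error_def power2_eq_square algebra_simps)
  then show ?thesis using 1 by simp
qed

text \<open>If \<open>x\<close> lies in the slab of \<open>T\<close>, the anchor of \<open>T\<close>
  is within \<open>2 * h\<close> of \<open>p x\<close>, so \<open>T\<close> is among the boundedly
  many elements that meet that ball.\<close>

lemma slab_overlap: "(\<Sum>T\<in>\<T>. indicator (slab T) x) \<le> (ennreal (count_const 2) * indicator (tube \<Gamma> (r/6)) x)"
proof (cases "x \<in> tube \<Gamma> (r/6)")
  case True
  have "(\<Sum>T\<in>\<T>. indicator (slab T) x :: ennreal) = of_nat (card {T\<in>\<T>. x \<in> slab T})"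
    using finite_\<T> by (simp add: indicator_def sum.If_cases Int_def)
  also have "\<dots> = ennreal (real (card {T\<in>\<T>. x \<in> slab T}))" by (simp add: ennreal_of_nat_eq_real_of_nat)
  also have "real (card {T\<in>\<T>. x \<in> slab T}) \<le> real (card {T\<in>\<T>. T \<inter> cball (p x) (2 * h) \<noteq> {}})"
  proof -
    have "{T\<in>\<T>. x \<in> slab T} \<subseteq> {T\<in>\<T>. T \<inter> cball (p x) (2 * h) \<noteq> {}}"
    proof clarify
      fix T assume T: "T \<in> \<T>" "x \<in> slab T" and e: "T \<inter> cball (p x) (2 * h) = {}"
      have "norm (p x - anchor T) \<le> norm (p x - p (anchor T)) + norm (p (anchor T) - anchor T)"
        using norm_triangle_ineq[of "p x - p (anchor T)" "p (anchor T) - anchor T"] by simp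
      also have "\<dots> \<le> h + h" using T(2) near_h[OF anchor(2)[OF T(1)]] by (intro add_mono) (auto simp: slab_def norm_minus_commute)
      finally show False using e anchor(1)[OF T(1)] by (auto simp: dist_norm)
    qed
    then show ?thesis using finite_\<T> by (simp add: card_mono)
  qed
  also have "\<dots> \<le> count_const 2" by (rule count_elements) simp
  finally show ?thesis using True by (simp add: ennreal_leI)
next
  case False
  then show ?thesis by (simp add: slab_def)
qed

text \<open>On the slab of \<open>T\<close>, the number \<open>anchor_error T - patch_term T\<close>
  lies below twice the squared deviation of the lifted function. Integrating over slabs, of volume
  at least of order \<open>h ^ d\<close>, and summing gives one integral over the tube with bounded
  multiplicity.\<close>

lemma sum_anchor_error:
  "(\<Sum>T\<in>\<T>. anchor_error T) \<le> 2 * count_const 2 * surface_const d / (section_const d * h ^ d) * surface_energy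
     + 8 * count_const (\<Lambda> + 2) * count_const (\<Lambda> + 2 + \<tau>) * (\<tau> * h)\<^sup>2 * grad_energy"
proof -
  let ?V = "tube \<Gamma> (r/6)" and ?c = "section_const d * h ^ d"
  define F where "F x = (v (lift x) - surface_average \<K> v)\<^sup>2" for x
  \<comment> \<open>The extension by 0 is Borel on the whole space; on the tube of radius
    \<open>r\<close> nothing changes.\<close>
  define F' where "F' x = (if x \<in> tube \<Gamma> r then F x else 0)" for x
  have c: "0 < ?c" using section_const_pos h by simp
  have "continuous_on (tube \<Gamma> r) F"
    unfolding F_def using lift_mem surface_covered
    by (intro continuous_intros continuous_on_compose2[OF v_cont lift_continuous]) auto
  then have F'm [measurable]: "F' \<in> borel_measurable borel"
    unfolding F'_def[abs_def] by (intro borel_measurable_continuous_on_if) auto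
  have F': "F' x = F x" if "x \<in> ?V" for x using that r_pos by (simp add: F'_def tube_def)
  have sE: "0 \<le> surface_energy" unfolding surface_energy_def by (intro sum_nonneg) auto
  have one: "ennreal (?c * (anchor_error T - patch_term T)) \<le> 2 * (\<integral>\<^sup>+x. ennreal (F' x) * indicator (slab T) x \<partial>lborel)"
    if T: "T \<in> \<T>" for T
  proof -
    have "ennreal (?c * (anchor_error T - patch_term T)) = ennreal (anchor_error T - patch_term T) * ennreal ?c"
      using c by (simp add: ennreal_mult' mult.commute)
    also have "\<dots> \<le> ennreal (anchor_error T - patch_term T) * emeasure lborel (slab T)"
      using slab_measure[OF T] by (rule mult_left_mono) simp
    also have "\<dots> = (\<integral>\<^sup>+x. ennreal (anchor_error T - patch_term T) * indicator (slab T) x \<partial>lborel)"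
      by (rule nn_integral_cmult_indicator[symmetric]) simp
    also have "\<dots> \<le> (\<integral>\<^sup>+x. 2 * (ennreal (F' x) * indicator (slab T) x) \<partial>lborel)"
    proof (rule nn_integral_mono)
      fix x
      show "ennreal (anchor_error T - patch_term T) * indicator (slab T) x \<le> 2 * (ennreal (F' x) * indicator (slab T) x)"
      proof (cases "x \<in> slab T")
        case True
        then have "anchor_error T - patch_term T \<le> 2 * F' x"
          using anchor_error_le[OF T True] F'[of x] by (simp add: F_def slab_def)
        then have "ennreal (anchor_error T - patch_term T) \<le> ennreal (2 * F' x)" by (rule ennreal_leI)
        then show ?thesis using True by (simp add: ennreal_mult')
      qed simp
    qed
    also have "\<dots> = 2 * (\<integral>\<^sup>+x. ennreal (F' x) * indicator (slab T) x \<partial>lborel)"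
      by (rule nn_integral_cmult) measurable
    finally show ?thesis .
  qed
  \<comment> \<open>Negative differences become 0 as extended nonnegative reals, which only enlarges
    the right-hand side.\<close>
  have "ennreal (?c * (\<Sum>T\<in>\<T>. anchor_error T - patch_term T)) \<le> (\<Sum>T\<in>\<T>. ennreal (?c * (anchor_error T - patch_term T)))"
  proof -
    have "ennreal (?c * (\<Sum>T\<in>\<T>. anchor_error T - patch_term T)) \<le> ennreal (\<Sum>T\<in>\<T>. max 0 (?c * (anchor_error T - patch_term T)))"
      unfolding sum_distrib_left by (intro ennreal_leI sum_mono) auto
    also have "\<dots> = (\<Sum>T\<in>\<T>. ennreal (max 0 (?c * (anchor_error T - patch_term T))))" by (rule sum_ennreal[symmetric]) simp
    also have "\<dots> = (\<Sum>T\<in>\<T>. ennreal (?c * (anchor_error T - patch_term T)))" by (intro sum.cong) (auto simp: max_def ennreal_neg)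
    finally show ?thesis .
  qed
  also have "\<dots> \<le> (\<Sum>T\<in>\<T>. 2 * (\<integral>\<^sup>+x. ennreal (F' x) * indicator (slab T) x \<partial>lborel))"
    by (intro sum_mono one)
  also have "\<dots> = 2 * (\<integral>\<^sup>+x. ennreal (F' x) * (\<Sum>T\<in>\<T>. indicator (slab T) x) \<partial>lborel)"
    unfolding sum_distrib_left[symmetric] by (subst nn_integral_sum[symmetric]) (auto simp: sum_distrib_left)
  also have "\<dots> \<le> 2 * (\<integral>\<^sup>+x. ennreal (F' x) * (ennreal (count_const 2) * indicator ?V x) \<partial>lborel)"
    using slab_overlap by (intro mult_left_mono nn_integral_mono) auto
  also have "(\<integral>\<^sup>+x. ennreal (F' x) * (ennreal (count_const 2) * indicator ?V x) \<partial>lborel) = (\<integral>\<^sup>+x. ennreal (count_const 2) * (ennreal (F x) * indicator ?V x) \<partial>lborel)"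
    using F' by (intro nn_integral_cong) (auto simp: indicator_def mult_ac)
  also have "\<dots> = (\<integral>\<^sup>+x. ennreal (count_const 2) * (ennreal (F' x) * indicator ?V x) \<partial>lborel)"
    using F' by (intro nn_integral_cong) (auto simp: indicator_def)
  also have "\<dots> = ennreal (count_const 2) * (\<integral>\<^sup>+x. ennreal (F' x) * indicator ?V x \<partial>lborel)"
    by (rule nn_integral_cmult) measurable
  also have "(\<integral>\<^sup>+x. ennreal (F' x) * indicator ?V x \<partial>lborel) = (\<integral>\<^sup>+x\<in>?V. ennreal (F x) \<partial>lborel)"
    using F' by (intro nn_integral_cong) (auto simp: indicator_def)
  also have "2 * (ennreal (count_const 2) * \<dots>) \<le> 2 * (ennreal (count_const 2) * ennreal (surface_const d * surface_energy))"
    using lifted_energy by (intro mult_left_mono) (auto simp: F_def)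
  also have "\<dots> = ennreal (2 * count_const 2 * surface_const d * surface_energy)"
    using count_const_pos[of 2] surface_const_pos[of d] sE by (simp add: ennreal_mult mult_ac)
  finally have "?c * (\<Sum>T\<in>\<T>. anchor_error T - patch_term T) \<le> 2 * count_const 2 * surface_const d * surface_energy"
    using count_const_pos[of 2] surface_const_pos[of d] sE by (subst (asm) ennreal_le_iff) auto
  then have 1: "(\<Sum>T\<in>\<T>. anchor_error T) - (\<Sum>T\<in>\<T>. patch_term T) \<le> 2 * count_const 2 * surface_const d * surface_energy / ?c"
    using c by (simp add: sum_subtractf pos_le_divide_eq mult.commute)
  \<comment> \<open>Exchanging the sums reduces the estimate to counting the patches that contain a
    given element.\<close>
  have "(\<Sum>T\<in>\<T>. \<Sum>T'\<in>patch T. (norm (G T'))\<^sup>2) = (\<Sum>T'\<in>\<T>. \<Sum>T\<in>{T\<in>\<T>. T' \<in> patch T}. (norm (G T'))\<^sup>2)"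
  proof -
    have "(\<Sum>T\<in>\<T>. \<Sum>T'\<in>{T'\<in>\<T>. T' \<in> patch T}. (norm (G T'))\<^sup>2) = (\<Sum>T'\<in>\<T>. \<Sum>T\<in>{T\<in>\<T>. T' \<in> patch T}. (norm (G T'))\<^sup>2)"
      by (rule sum.swap_restrict[OF finite_\<T> finite_\<T>])
    moreover have "{T'\<in>\<T>. T' \<in> patch T} = patch T" for T by (auto simp: patch_def)
    ultimately show ?thesis by simp
  qed
  also have "\<dots> \<le> (\<Sum>T'\<in>\<T>. count_const (\<Lambda> + 2 + \<tau>) * (norm (G T'))\<^sup>2)"
  proof (rule sum_mono)
    fix T' assume T': "T' \<in> \<T>"
    \<comment> \<open>The anchor of such an element is within \<open>(\<Lambda> + 2) * h\<close> of
      some point of \<open>T'\<close>, and that point is within one element diameter of the anchor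
      of \<open>T'\<close>; hence the additional \<open>\<tau>\<close>.\<close>
    have "{T\<in>\<T>. T' \<in> patch T} \<subseteq> {T\<in>\<T>. T \<inter> cball (anchor T') ((\<Lambda> + 2 + \<tau>) * h) \<noteq> {}}"
    proof clarify
      fix T assume T: "T \<in> \<T>" "T' \<in> patch T" and e: "T \<inter> cball (anchor T') ((\<Lambda> + 2 + \<tau>) * h) = {}"
      then obtain y where y: "y \<in> T'" "norm (anchor T - y) \<le> (\<Lambda> + 2) * h" by (auto simp: patch_def dist_norm)
      have "norm (anchor T' - anchor T) \<le> norm (anchor T' - y) + norm (anchor T - y)"
        using norm_triangle_ineq4[of "anchor T' - y" "anchor T - y"] by simp
      also have "\<dots> \<le> \<tau> * h + (\<Lambda> + 2) * h" using y T_diam[OF T' anchor(1)[OF T'] y(1)] by (intro add_mono) auto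
      finally have "norm (anchor T' - anchor T) \<le> (\<Lambda> + 2 + \<tau>) * h" by (simp add: algebra_simps)
      then show False using e anchor(1)[OF T(1)] by (auto simp: dist_norm)
    qed
    then have "real (card {T\<in>\<T>. T' \<in> patch T}) \<le> real (card {T\<in>\<T>. T \<inter> cball (anchor T') ((\<Lambda> + 2 + \<tau>) * h) \<noteq> {}})"
      using finite_\<T> by (simp add: card_mono)
    also have "\<dots> \<le> count_const (\<Lambda> + 2 + \<tau>)" by (rule count_elements) (use \<Lambda>_ge1 \<tau> in simp)
    finally show "(\<Sum>T\<in>{T\<in>\<T>. T' \<in> patch T}. (norm (G T'))\<^sup>2) \<le> count_const (\<Lambda> + 2 + \<tau>) * (norm (G T'))\<^sup>2"
      by (simp add: mult_right_mono)
  qed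
  finally have 2: "(\<Sum>T\<in>\<T>. \<Sum>T'\<in>patch T. (norm (G T'))\<^sup>2) \<le> count_const (\<Lambda> + 2 + \<tau>) * grad_energy"
    by (simp add: grad_energy_def sum_distrib_left)
  have "(\<Sum>T\<in>\<T>. patch_term T) = 8 * count_const (\<Lambda> + 2) * (\<tau> * h)\<^sup>2 * (\<Sum>T\<in>\<T>. \<Sum>T'\<in>patch T. (norm (G T'))\<^sup>2)"
    by (simp add: patch_term_def sum_distrib_left)
  also have "\<dots> \<le> 8 * count_const (\<Lambda> + 2) * (\<tau> * h)\<^sup>2 * (count_const (\<Lambda> + 2 + \<tau>) * grad_energy)"
    using 2 count_const_pos[of "\<Lambda> + 2"] \<Lambda>_ge1 by (intro mult_left_mono mult_nonneg_nonneg) auto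
  finally have 3: "(\<Sum>T\<in>\<T>. patch_term T) \<le> 8 * count_const (\<Lambda> + 2) * count_const (\<Lambda> + 2 + \<tau>) * (\<tau> * h)\<^sup>2 * grad_energy" by (simp add: mult_ac)
  show ?thesis using 1 3 by simp
qed

lemma element_bound:
  assumes T: "T \<in> \<T>" and x: "x \<in> T"
  shows "(v x - surface_average \<K> v)\<^sup>2 \<le> 2 * (\<tau> * h)\<^sup>2 * (norm (G T))\<^sup>2 + 2 * anchor_error T"
proof -
  let ?avg = "surface_average \<K> v" and ?y = "anchor T"
  have "\<bar>v x - v ?y\<bar> \<le> \<tau> * h * norm (G T)" by (rule v_oscillation[OF T x anchor(1)[OF T]])
  then have "\<bar>v x - v ?y\<bar>\<^sup>2 \<le> (\<tau> * h * norm (G T))\<^sup>2" by (rule power_mono) simp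
  then have 1: "(v x - v ?y)\<^sup>2 \<le> (\<tau> * h)\<^sup>2 * (norm (G T))\<^sup>2" by (simp add: power_mult_distrib)
  have "0 \<le> ((v x - v ?y) - (v ?y - ?avg))\<^sup>2" by simp
  then have "(v x - ?avg)\<^sup>2 \<le> 2 * (v x - v ?y)\<^sup>2 + 2 * (v ?y - ?avg)\<^sup>2"
    by (simp add: power2_eq_square algebra_simps)
  then show ?thesis using 1 by (simp add: anchor_error_def)
qed

end

section \<open>The discrete Poincare inequality\<close>

text \<open>On element boundaries \<open>gradient v (at x)\<close> may be a meaningless value of the
  choice operator. Completeness of Lebesgue measure lets measurability ignore that null set.\<close>

lemma lebesgue_measurable_negligible_diff:
  fixes f g :: "'a::euclidean_space \<Rightarrow> 'b::topological_space"
  assumes g: "g \<in> borel_measurable lebesgue" and N: "negligible N" and eq: "\<And>x. x \<notin> N \<Longrightarrow> f x = g x"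
  shows "f \<in> borel_measurable lebesgue"
proof (rule measurableI)
  fix A :: "'b set" assume A: "A \<in> sets borel"
  have gA: "g -` A \<in> sets lebesgue" using measurable_sets[OF g A] by simp
  have "negligible (f -` A \<inter> N)" using N by (rule negligible_subset) auto
  then have "(g -` A - N) \<union> (f -` A \<inter> N) \<in> sets lebesgue"
    using gA negligible_imp_sets[OF N] negligible_imp_sets by (intro sets.Un sets.Diff) auto
  moreover have "f -` A \<inter> space lebesgue = (g -` A - N) \<union> (f -` A \<inter> N)" using eq by auto
  ultimately show "f -` A \<inter> space lebesgue \<in> sets lebesgue" by simp
qed simp

lemma gradient_of_inner:
  assumes "frechet_derivative v F = (\<lambda>u. g \<bullet> u)" shows "gradient v F = g"
  unfolding gradient_def assms by (rule euclidean_representation)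

lemma gradient_interior:
  fixes T :: "'a::euclidean_space set"
  assumes v: "\<And>y. y \<in> T \<Longrightarrow> v y = g \<bullet> y + b" and x: "x \<in> interior T"
  shows "gradient v (at x) = g"
proof -
  have "((\<lambda>y. g \<bullet> y + b) has_derivative (\<lambda>u. g \<bullet> u)) (at x)"
    by (auto intro!: derivative_eq_intros)
  then have "(v has_derivative (\<lambda>u. g \<bullet> u)) (at x)"
    by (rule has_derivative_transform_within_open[OF _ open_interior x]) (use v interior_subset in force)
  then show ?thesis using frechet_derivative_at gradient_of_inner by metis
qed

text \<open>Meant for boundary points of an element, where a surface simplex may lie. The difference
  of two derivatives vanishes in every direction from \<open>x\<close> into \<open>T\<close>, and
  these directions span the space because \<open>T\<close> has interior points.\<close>

lemma has_derivative_within_convex_unique: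
  fixes T :: "'a::euclidean_space set" and f :: "'a \<Rightarrow> real"
  assumes T: "convex T" "interior T \<noteq> {}" and x: "x \<in> T"
    and f: "(f has_derivative f1) (at x within T)" "(f has_derivative f2) (at x within T)"
  shows "f1 = f2"
proof
  define l where "l u = f1 u - f2 u" for u
  have l: "linear l" unfolding l_def using f by (intro linear_compose_sub has_derivative_linear)
  have "((\<lambda>y. f y - f y) has_derivative l) (at x within T)" unfolding l_def by (rule has_derivative_diff[OF f])
  then have l0: "((\<lambda>y. 0) has_derivative l) (at x within T)" by simp
  have edge: "l (y - x) = 0" if y: "y \<in> T" for y
  proof -
    let ?z = "\<lambda>t::real. x + t *\<^sub>R (y - x)"
    have zT: "?z ` {0..1} \<subseteq> T" using convexD_alt[OF T(1) x y] by (auto simp: algebra_simps)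
    have "(?z has_derivative (\<lambda>s. s *\<^sub>R (y - x))) (at 0 within {0..1})" by (auto intro!: derivative_eq_intros)
    moreover have "((\<lambda>y. 0) has_derivative l) (at (?z 0) within ?z ` {0..1})"
      using l0 by (simp) (rule has_derivative_subset[OF _ zT], simp)
    ultimately have "((\<lambda>t. 0) has_derivative (\<lambda>s. l (s *\<^sub>R (y - x)))) (at 0 within {0..1})"
      using has_derivative_in_compose[of ?z _ 0 "{0..1}" "\<lambda>y. 0" l] by simp
    then have "((\<lambda>t. 0) has_vector_derivative l (y - x)) (at (0::real) within {0..1})"
      using l by (simp add: has_vector_derivative_def linear_cmul)
    moreover have "((\<lambda>t. 0) has_vector_derivative 0) (at (0::real) within {0..1})" by (rule has_vector_derivative_const)
    ultimately show ?thesis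
      by (rule vector_derivative_unique_within[rotated]) (simp add: at_within_Icc_at_right)
  qed
  obtain z e where z: "0 < e" "ball z e \<subseteq> T" using T(2) mem_interior by (metis ex_in_conv)
  fix u :: 'a
  show "f1 u = f2 u"
  proof (cases "u = 0")
    case True
    then show ?thesis using f has_derivative_linear linear_0 by metis
  next
    case False
    define c where "c = e / (2 * norm u)"
    have c: "0 < c" using z False by (simp add: c_def)
    have "z + c *\<^sub>R u \<in> ball z e" using z False by (simp add: c_def dist_norm)
    then have "l ((z + c *\<^sub>R u) - x) = 0" using edge z by blast
    moreover have "l (z - x) = 0" using edge z by force
    moreover have "(z + c *\<^sub>R u) - x = (z - x) + c *\<^sub>R u" by simp
    ultimately have "c * l u = 0" using l by (simp only: linear_add linear_cmul) simp
    then show ?thesis using c by (simp add: l_def)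
  qed
qed

lemma gradient_within:
  fixes T :: "'a::euclidean_space set"
  assumes T: "convex T" "interior T \<noteq> {}" and v: "\<And>y. y \<in> T \<Longrightarrow> v y = g \<bullet> y + b" and x: "x \<in> T"
  shows "gradient v (at x within T) = g"
proof -
  have "((\<lambda>y. g \<bullet> y + b) has_derivative (\<lambda>u. g \<bullet> u)) (at x within T)"
    by (auto intro!: derivative_eq_intros)
  then have d: "(v has_derivative (\<lambda>u. g \<bullet> u)) (at x within T)"
    by (rule has_derivative_transform[OF x, rotated]) (use v in auto)
  then have "(v has_derivative frechet_derivative v (at x within T)) (at x within T)"
    using frechet_derivative_works differentiable_def by blast
  then have "frechet_derivative v (at x within T) = (\<lambda>u. g \<bullet> u)"
    using d by (rule has_derivative_within_convex_unique[OF T x])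
  then show ?thesis by (rule gradient_of_inner)
qed

lemma flat_lborel_AE_closedD:
  fixes K :: "'a::euclidean_space set"
  assumes K: "convex K" "compact K" and Q: "closed {x\<in>K. Q x}" and ae: "AE x\<in>K in flat_lborel K. Q x" and y: "y \<in> K"
  shows "Q y"
proof -
  obtain B where B: "orthonormal B" "card B = DIM('a) - dim (parallel_space K)" "span B = {x. \<forall>y\<in>parallel_space K. orthogonal y x}"
    by (rule orthogonal_complement_basis[OF subspace_parallel_space])
  interpret flat_piece K B 1 using K B by unfold_locales (auto simp: compact_imp_bounded)
  show ?thesis by (rule flat_lborel_AE_closed[OF K(1) compact_imp_closed[OF K(2)] Q ae y])
qed

lemma bulk_L2_norm_square: "(bulk_L2_norm \<T> f)\<^sup>2 = (LINT x:\<Union>\<T>|lebesgue. (norm (f x))\<^sup>2)"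
  unfolding bulk_L2_norm_def by (rule real_sqrt_pow2) (auto simp: set_lebesgue_integral_def intro!: integral_nonneg_AE)

context fe_setting begin

lemma T_interior: "T \<in> \<T> \<Longrightarrow> interior T \<noteq> {}"
proof -
  assume T: "T \<in> \<T>"
  obtain x \<rho> where x: "h \<le> \<sigma> * \<rho>" "cball x \<rho> \<subseteq> T" using T_ball[OF T] by blast
  then have "0 < \<sigma> * \<rho>" using h by linarith
  then have "0 < \<rho>" using \<sigma> by (simp add: zero_less_mult_iff)
  then have "x \<in> interior T" using x(2) by (meson ball_subset_cball centre_in_ball interiorI open_ball order_trans)
  then show ?thesis by blast
qed

lemma bulk_error_le:
  "(bulk_L2_norm \<T> (\<lambda>x. v x - surface_average \<K> v))\<^sup>2
     \<le> (\<Sum>T\<in>\<T>. (2 * (\<tau> * h)\<^sup>2 * (norm (G T))\<^sup>2 + 2 * anchor_error T) * measure lebesgue T)"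
proof -
  define B where "B T = 2 * (\<tau> * h)\<^sup>2 * (norm (G T))\<^sup>2 + 2 * anchor_error T" for T
  have B0: "0 \<le> B T" for T by (simp add: B_def anchor_error_def)
  have int: "integrable lebesgue (\<lambda>x. B T * indicator T x)" if "T \<in> \<T>" for T
    using T_lmeasurable[OF that] by (intro integrable_mult_right integrable_real_indicator) (auto simp: fmeasurable_def)
  have "(LINT x:\<Union>\<T>|lebesgue. (norm (v x - surface_average \<K> v))\<^sup>2) \<le> (\<integral>x. (\<Sum>T\<in>\<T>. B T * indicator T x) \<partial>lebesgue)"
    unfolding set_lebesgue_integral_def
  proof (rule integral_mono')
    show "integrable lebesgue (\<lambda>x. \<Sum>T\<in>\<T>. B T * indicator T x)" using int by (rule Bochner_Integration.integrable_sum)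
    fix x
    show "0 \<le> (\<Sum>T\<in>\<T>. B T * indicator T x :: real)" using B0 by (intro sum_nonneg) auto
    show "indicator (\<Union>\<T>) x *\<^sub>R (norm (v x - surface_average \<K> v))\<^sup>2 \<le> (\<Sum>T\<in>\<T>. B T * indicator T x)"
    proof (cases "x \<in> \<Union>\<T>")
      case True
      then obtain T where T: "T \<in> \<T>" "x \<in> T" by blast
      have "(norm (v x - surface_average \<K> v))\<^sup>2 \<le> B T * indicator T x" using element_bound[OF T] T by (simp add: B_def)
      also have "\<dots> \<le> (\<Sum>T\<in>\<T>. B T * indicator T x)"
        using T finite_\<T> B0 by (intro member_le_sum[of T \<T> "\<lambda>T. B T * indicator T x"]) auto
      finally show ?thesis using True by simp
    qed (use B0 in \<open>auto intro!: sum_nonneg\<close>)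
  qed
  also have "\<dots> = (\<Sum>T\<in>\<T>. B T * measure lebesgue T)"
    using int by (subst Bochner_Integration.integral_sum) auto
  finally show ?thesis by (simp add: bulk_L2_norm_square B_def)
qed

lemma bulk_gradient_eq:
  "(bulk_L2_norm \<T> (\<lambda>x. gradient v (at x)))\<^sup>2 = (\<Sum>T\<in>\<T>. (norm (G T))\<^sup>2 * measure lebesgue T)"
proof -
  let ?f = "\<lambda>x. indicator (\<Union>\<T>) x *\<^sub>R (norm (gradient v (at x)))\<^sup>2 :: real"
  let ?g = "\<lambda>x. (\<Sum>T\<in>\<T>. (norm (G T))\<^sup>2 * indicator (interior T) x)"
  \<comment> \<open>Off these frontiers every point of the mesh is interior to exactly one element,
    where the gradient is a genuine derivative. Frontiers of convex sets are null.\<close>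
  define N where "N = (\<Union>T\<in>\<T>. frontier T)"
  have N: "negligible N"
    unfolding N_def using finite_\<T> T_convex by (intro negligible_Union) (auto intro: negligible_convex_frontier)
  have eq: "?f x = ?g x" if x: "x \<notin> N" for x
  proof (cases "x \<in> \<Union>\<T>")
    case True
    then obtain T0 where T0: "T0 \<in> \<T>" "x \<in> T0" by blast
    then have xi: "x \<in> interior T0" using x closure_subset[of T0] unfolding N_def frontier_def by blast
    have "?g x = (\<Sum>T\<in>{T0}. (norm (G T))\<^sup>2 * indicator (interior T) x)"
      using T0 xi T_disjoint finite_\<T> by (intro sum.mono_neutral_right) (auto simp: indicator_def)
    also have "\<dots> = (norm (G T0))\<^sup>2" using xi by simp
    finally show ?thesis using True gradient_interior[OF v_affine[OF T0(1)] xi] by simp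
  next
    case False
    then have "x \<notin> interior T" if "T \<in> \<T>" for T using that interior_subset by blast
    then show ?thesis using False by simp
  qed
  have gm: "?g \<in> borel_measurable lebesgue"
    by (intro borel_measurable_sum borel_measurable_times borel_measurable_const borel_measurable_indicator) auto
  have fm: "?f \<in> borel_measurable lebesgue" by (rule lebesgue_measurable_negligible_diff[OF gm N eq])
  have "AE x in lebesgue. x \<notin> N" using N by (intro AE_not_in) (simp add: negligible_iff_null_sets)
  then have "AE x in lebesgue. ?f x = ?g x" by eventually_elim (rule eq)
  then have "(\<integral>x. ?f x \<partial>lebesgue) = (\<integral>x. ?g x \<partial>lebesgue)" by (rule integral_cong_AE[OF fm gm])
  also have "\<dots> = (\<Sum>T\<in>\<T>. (norm (G T))\<^sup>2 * measure lebesgue (interior T))"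
  proof -
    have "integrable lebesgue (\<lambda>x. (norm (G T))\<^sup>2 * indicator (interior T) x)" if "T \<in> \<T>" for T
    proof -
      have "bounded (interior T)" using T_compact[OF that] by (simp add: bounded_interior compact_imp_bounded)
      then have "interior T \<in> lmeasurable" by (simp add: lmeasurable_open)
      then show ?thesis by (intro integrable_mult_right integrable_real_indicator) (auto simp: fmeasurable_def)
    qed
    then show ?thesis by (subst Bochner_Integration.integral_sum) auto
  qed
  also have "\<dots> = (\<Sum>T\<in>\<T>. (norm (G T))\<^sup>2 * measure lebesgue T)"
  proof (intro sum.cong arg_cong2[where f="(*)"] refl)
    fix T assume T: "T \<in> \<T>"
    show "measure lebesgue (interior T) = measure lebesgue T"
      using T_compact[OF T] T_convex[OF T] by (intro measure_interior negligible_convex_frontier compact_imp_bounded)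
  qed
  finally show ?thesis by (simp add: bulk_L2_norm_square set_lebesgue_integral_def)
qed

lemma surface_gradient_energy:
  "(surface_L2_norm \<K> (surface_gradient \<T> v))\<^sup>2 = surface_energy"
proof -
  have "(LINT x:K|flat_lborel K. (norm (surface_gradient \<T> v K x))\<^sup>2)
     = (norm (orth_proj (parallel_space K) (G (SOME T. T \<in> \<T> \<and> K \<subseteq> T))))\<^sup>2 * measure (flat_lborel K) K"
    if K: "K \<in> \<K>" for K
  proof -
    let ?T = "SOME T. T \<in> \<T> \<and> K \<subseteq> T"
    note T = chosen_element[OF K]
    have "surface_gradient \<T> v K x = orth_proj (parallel_space K) (G ?T)" if "x \<in> K" for x
      unfolding surface_gradient_def
      using gradient_within[OF T_convex[OF T(1)] T_interior[OF T(1)] v_affine[OF T(1)], of x] that T(2) by auto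
    then have "(LINT x:K|flat_lborel K. (norm (surface_gradient \<T> v K x))\<^sup>2) = (LINT x:K|flat_lborel K. (norm (orth_proj (parallel_space K) (G ?T)))\<^sup>2)"
      using K_props(7)[OF K] by (intro set_lebesgue_integral_cong) auto
    moreover have "integrable (flat_lborel K) (indicator K :: 'a \<Rightarrow> real)"
      using K K_props(7) flat_lborel_finite by (intro integrable_real_indicator) auto
    ultimately show ?thesis by (simp add: set_lebesgue_integral_def)
  qed
  then have "surface_integral \<K> (\<lambda>K x. (norm (surface_gradient \<T> v K x))\<^sup>2) = surface_energy"
    by (simp add: surface_integral_def surface_energy_def)
  moreover have "0 \<le> surface_energy" unfolding surface_energy_def by (intro sum_nonneg) auto
  ultimately show ?thesis by (simp add: surface_L2_norm_def)
qed

end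

section \<open>Assembling the constants and the estimate\<close>

context tubular begin

text \<open>The 4 is 2 from \<open>element_bound\<close> times 2 from
  \<open>anchor_error_le\<close>, the power of \<open>\<tau>\<close> with the unit ball bounds
  element volumes, and \<open>((2 + \<tau>) * \<sigma>) ^ DIM('a)\<close> is
  \<open>count_const 2\<close>, spelled out so that no mesh occurs in the term.\<close>

definition surface_factor :: "nat \<Rightarrow> real \<Rightarrow> real \<Rightarrow> real" where
  "surface_factor d \<sigma> \<tau> = 4 * \<tau> ^ DIM('a) * measure lebesgue (ball (0::'a) 1) * ((2 + \<tau>) * \<sigma>) ^ DIM('a) * surface_const d / section_const d"

text \<open>The power of \<open>\<sigma> * \<tau>\<close> compares the largest with the smallest
  possible element volume; the 2 stems from the oscillation on the element itself, and the 16 is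
  twice the 8 in \<open>patch_term\<close>.\<close>

definition gradient_factor :: "real \<Rightarrow> real \<Rightarrow> real" where
  "gradient_factor \<sigma> \<tau> = (\<sigma> * \<tau>) ^ DIM('a) * (2 + 16 * ((\<Lambda> + 2 + \<tau>) * \<sigma>) ^ DIM('a) * ((\<Lambda> + 2 + \<tau> + \<tau>) * \<sigma>) ^ DIM('a)) * \<tau>\<^sup>2"

end

text \<open>Element volumes of order \<open>h ^ DIM('a)\<close> meet the divisor
  \<open>h ^ d\<close> from the slabs, which leaves the codimension as exponent. In the gradient
  part the same power of \<open>h\<close> is traded by shape regularity for the true element
  volumes.\<close>

lemma (in fe_setting) bulk_estimate:
  assumes d: "d \<le> DIM('a)"
  shows "(bulk_L2_norm \<T> (\<lambda>x. v x - surface_average \<K> v))\<^sup>2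
    \<le> surface_factor d \<sigma> \<tau> * h ^ (DIM('a) - d) * (surface_L2_norm \<K> (surface_gradient \<T> v))\<^sup>2
      + gradient_factor \<sigma> \<tau> * h\<^sup>2 * (bulk_L2_norm \<T> (\<lambda>x. gradient v (at x)))\<^sup>2"
proof -
  let ?k = "DIM('a)"
  define \<omega> where "\<omega> = measure lebesgue (ball (0::'a) 1)"
  define N1 N2 N3 where "N1 = count_const 2" and "N2 = count_const (\<Lambda> + 2)" and "N3 = count_const (\<Lambda> + 2 + \<tau>)"
  have N: "0 < N1" "0 < N2" "0 < N3" using count_const_pos \<Lambda>_ge1 \<tau> by (auto simp: N1_def N2_def N3_def)
  have \<omega>: "0 < \<omega>" using unit_ball_pos by (simp add: \<omega>_def)
  define E where "E = (\<Sum>T\<in>\<T>. anchor_error T)"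
  have E: "E \<le> 2 * N1 * surface_const d / (section_const d * h ^ d) * surface_energy + 8 * N2 * N3 * (\<tau> * h)\<^sup>2 * grad_energy"
    using sum_anchor_error by (simp add: E_def N1_def N2_def N3_def)
  have err: "0 \<le> anchor_error T" for T by (simp add: anchor_error_def)
  have "(bulk_L2_norm \<T> (\<lambda>x. v x - surface_average \<K> v))\<^sup>2
     \<le> (\<Sum>T\<in>\<T>. (2 * (\<tau> * h)\<^sup>2 * (norm (G T))\<^sup>2 + 2 * anchor_error T) * measure lebesgue T)" by (rule bulk_error_le)
  also have "\<dots> \<le> (\<Sum>T\<in>\<T>. (2 * (\<tau> * h)\<^sup>2 * (norm (G T))\<^sup>2 + 2 * anchor_error T) * ((\<tau> * h) ^ ?k * \<omega>))"
    using T_measure_le err by (intro sum_mono mult_left_mono add_nonneg_nonneg) (auto simp: \<omega>_def)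
  also have "\<dots> = (2 * (\<tau> * h)\<^sup>2 * grad_energy + 2 * E) * ((\<tau> * h) ^ ?k * \<omega>)"
    by (simp add: sum_distrib_right[symmetric] sum.distrib sum_distrib_left[symmetric] grad_energy_def E_def)
  also have "\<dots> \<le> (2 * (\<tau> * h)\<^sup>2 * grad_energy + 2 * (2 * N1 * surface_const d / (section_const d * h ^ d) * surface_energy
        + 8 * N2 * N3 * (\<tau> * h)\<^sup>2 * grad_energy)) * ((\<tau> * h) ^ ?k * \<omega>)"
    using E \<omega> \<tau> h by (intro mult_right_mono add_left_mono mult_left_mono) auto
  also have "\<dots> = (4 * \<tau> ^ ?k * \<omega> * N1 * surface_const d / section_const d) * (h ^ ?k / h ^ d) * surface_energy
     + (\<tau> ^ ?k * (2 + 16 * N2 * N3) * \<tau>\<^sup>2) * h\<^sup>2 * (h ^ ?k * \<omega> * grad_energy)"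
    by (simp add: power_mult_distrib field_simps)
  also have "h ^ ?k / h ^ d = h ^ (?k - d)" using h d by (simp add: power_diff)
  also have "4 * \<tau> ^ ?k * \<omega> * N1 * surface_const d / section_const d = surface_factor d \<sigma> \<tau>"
    by (simp add: surface_factor_def \<omega>_def N1_def count_const_def)
  finally have 1: "(bulk_L2_norm \<T> (\<lambda>x. v x - surface_average \<K> v))\<^sup>2
     \<le> surface_factor d \<sigma> \<tau> * h ^ (?k - d) * surface_energy + (\<tau> ^ ?k * (2 + 16 * N2 * N3) * \<tau>\<^sup>2) * h\<^sup>2 * (h ^ ?k * \<omega> * grad_energy)" .
  have "(h / \<sigma>) ^ ?k * \<omega> * grad_energy \<le> (bulk_L2_norm \<T> (\<lambda>x. gradient v (at x)))\<^sup>2"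
    unfolding bulk_gradient_eq grad_energy_def sum_distrib_left
  proof (rule sum_mono)
    fix T assume "T \<in> \<T>"
    from mult_right_mono[OF T_measure_ge[OF this], of "(norm (G T))\<^sup>2"]
    show "(h / \<sigma>) ^ ?k * \<omega> * (norm (G T))\<^sup>2 \<le> (norm (G T))\<^sup>2 * measure lebesgue T" by (simp add: \<omega>_def mult.commute)
  qed
  then have "\<sigma> ^ ?k * ((h / \<sigma>) ^ ?k * \<omega> * grad_energy) \<le> \<sigma> ^ ?k * (bulk_L2_norm \<T> (\<lambda>x. gradient v (at x)))\<^sup>2"
    using \<sigma> by (intro mult_left_mono) auto
  then have 2: "h ^ ?k * \<omega> * grad_energy \<le> \<sigma> ^ ?k * (bulk_L2_norm \<T> (\<lambda>x. gradient v (at x)))\<^sup>2"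
    using \<sigma> by (simp add: power_divide)
  have "(\<tau> ^ ?k * (2 + 16 * N2 * N3) * \<tau>\<^sup>2) * h\<^sup>2 * (h ^ ?k * \<omega> * grad_energy)
     \<le> (\<tau> ^ ?k * (2 + 16 * N2 * N3) * \<tau>\<^sup>2) * h\<^sup>2 * (\<sigma> ^ ?k * (bulk_L2_norm \<T> (\<lambda>x. gradient v (at x)))\<^sup>2)"
    using 2 \<tau> N by (intro mult_left_mono mult_nonneg_nonneg) auto
  also have "\<dots> = gradient_factor \<sigma> \<tau> * h\<^sup>2 * (bulk_L2_norm \<T> (\<lambda>x. gradient v (at x)))\<^sup>2"
    by (simp add: gradient_factor_def N2_def N3_def count_const_def power_mult_distrib mult_ac)
  finally show ?thesis using 1 by (simp add: surface_gradient_energy)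
qed

text \<open>Both geometric assumptions hold only almost everywhere on each simplex. The bounds
  needed are closed conditions in the point, so they extend to all points, including shared
  faces.\<close>

lemma approximating_surface_discrete:
  fixes \<Gamma> :: "'a::euclidean_space set" and p :: "'a \<Rightarrow> 'a"
  assumes tub: "tubular \<Gamma> (closest_point \<Gamma>) D r \<Lambda>"
    and tan: "\<And>q. q \<in> \<Gamma> \<Longrightarrow> orth_proj (tangent_space \<Gamma> q) = D q"
    and K: "approximating_surface d \<Gamma> \<delta> C\<^sub>\<rho> C\<^sub>P h \<K>"
    and \<eta>: "\<eta> < r" "\<Lambda> * \<eta> \<le> 1/4" "C\<^sub>\<rho> * h\<^sup>2 \<le> \<eta>" "C\<^sub>P * h \<le> 1/4"
  shows "discrete_surface \<Gamma> (closest_point \<Gamma>) D r \<Lambda> d \<K> \<eta>"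
    and "x \<in> \<Union>\<K> \<Longrightarrow> norm (x - closest_point \<Gamma> x) \<le> C\<^sub>\<rho> * h\<^sup>2"
proof -
  interpret tubular \<Gamma> "closest_point \<Gamma>" D r \<Lambda> by fact
  let ?p = "closest_point \<Gamma>"
  have mesh: "triangulation \<K>" "\<And>K. K \<in> \<K> \<Longrightarrow> int d simplex K" "bij_betw ?p (\<Union>\<K>) \<Gamma>"
    using K by (auto simp: approximating_surface_def closed_surface_mesh_def)
  have dist_le: "norm (x - ?p x) \<le> C\<^sub>\<rho> * h\<^sup>2" if "K \<in> \<K>" "x \<in> K" for K x
  proof -
    note Ks = mesh(2)[OF that(1)]
    have "\<bar>infdist x \<Gamma>\<bar> \<le> C\<^sub>\<rho> * h\<^sup>2"
    proof (rule flat_lborel_AE_closedD[OF convex_simplex[OF Ks] compact_simplex[OF Ks] _ _ that(2)])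
      have "{x \<in> K. \<bar>infdist x \<Gamma>\<bar> \<le> C\<^sub>\<rho> * h\<^sup>2} = K \<inter> {x. \<bar>infdist x \<Gamma>\<bar> \<le> C\<^sub>\<rho> * h\<^sup>2}" by auto
      moreover have "closed (K \<inter> {x. \<bar>infdist x \<Gamma>\<bar> \<le> C\<^sub>\<rho> * h\<^sup>2})"
        by (intro closed_Int closed_simplex[OF Ks] closed_Collect_le continuous_intros)
      ultimately show "closed {x \<in> K. \<bar>infdist x \<Gamma>\<bar> \<le> C\<^sub>\<rho> * h\<^sup>2}" by simp
      show "AE x\<in>K in flat_lborel K. \<bar>infdist x \<Gamma>\<bar> \<le> C\<^sub>\<rho> * h\<^sup>2"
        using K that(1) by (auto simp: approximating_surface_def surface_Linf_le_def)
    qed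
    then show ?thesis using p_dist[of x] by simp
  qed
  then show "x \<in> \<Union>\<K> \<Longrightarrow> norm (x - ?p x) \<le> C\<^sub>\<rho> * h\<^sup>2" by blast
  have inU: "x \<in> tube \<Gamma> r" if "K \<in> \<K>" "x \<in> K" for K x
    using dist_le[OF that] p_dist[of x] \<eta> by (simp add: tube_def)
  have proj: "norm (D (?p x) u - orth_proj (parallel_space K) u) \<le> 1/4 * norm u" if "K \<in> \<K>" "x \<in> K" for K x u
  proof -
    note Ks = mesh(2)[OF that(1)]
    let ?P = "orth_proj (parallel_space K)"
    \<comment> \<open>For a fixed vector \<open>u\<close> the condition is closed in
      \<open>x\<close>, since \<open>D q u\<close> depends continuously on \<open>q\<close>; the
      operator norm bound is used only at the points where it is given.\<close>
    show ?thesis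
    proof (rule flat_lborel_AE_closedD[OF convex_simplex[OF Ks] compact_simplex[OF Ks] _ _ that(2)])
      have cont: "continuous_on K (\<lambda>x. norm (D (?p x) u - ?P u))"
      proof (intro continuous_on_norm continuous_on_diff continuous_on_const)
        have cp: "continuous_on K ?p"
          by (rule continuous_on_subset[OF p_continuous]) (use inU[OF that(1)] in auto)
        have "continuous_on \<Gamma> (\<lambda>q. D q u)"
        proof (rule lipschitz_on_continuous_on[OF lipschitz_onI])
          show "dist (D q u) (D q' u) \<le> (\<Lambda> * norm u) * dist q q'" if "q \<in> \<Gamma>" "q' \<in> \<Gamma>" for q q'
            using D_lip[OF that, of u] by (simp add: dist_norm mult_ac)
        qed (use \<Lambda>_ge1 in simp)
        then show "continuous_on K (\<lambda>x. D (?p x) u)"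
          by (rule continuous_on_compose2[OF _ cp]) (use p_mem in auto)
      qed
      show "closed {x \<in> K. norm (D (?p x) u - ?P u) \<le> 1/4 * norm u}"
        using continuous_closed_preimage[OF cont closed_simplex[OF Ks] closed_atMost, of "1/4 * norm u"]
        by (simp add: vimage_def Int_def conj_commute)
      have ae: "AE x\<in>K in flat_lborel K. \<bar>onorm (\<lambda>w. orth_proj (tangent_space \<Gamma> (?p x)) w - ?P w)\<bar> \<le> C\<^sub>P * h"
        using K that(1) by (auto simp: approximating_surface_def surface_Linf_le_def)
      have "norm (D (?p x) u - ?P u) \<le> 1/4 * norm u"
        if "\<bar>onorm (\<lambda>w. orth_proj (tangent_space \<Gamma> (?p x)) w - ?P w)\<bar> \<le> C\<^sub>P * h" for x
      proof -
        have "linear (\<lambda>w. D (?p x) w - ?P w)"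
          by (intro linear_compose_sub projector_linear D_proj p_mem is_projector_orth_proj subspace_parallel_space)
        then have "norm (D (?p x) u - ?P u) \<le> onorm (\<lambda>w. D (?p x) w - ?P w) * norm u"
          by (intro onorm) (simp add: linear_conv_bounded_linear)
        also have "\<dots> \<le> 1/4 * norm u" using that \<eta>(4) tan[OF p_mem, of x] by (intro mult_right_mono) auto
        finally show ?thesis .
      qed
      with ae show "AE x\<in>K in flat_lborel K. norm (D (?p x) u - ?P u) \<le> 1/4 * norm u" by (auto elim!: eventually_mono)
    qed
  qed
  show "discrete_surface \<Gamma> ?p D r \<Lambda> d \<K> \<eta>"
  proof
    show "norm (x - ?p x) \<le> \<eta>" if "x \<in> \<Union>\<K>" for x using that dist_le \<eta>(3) by (force intro: order_trans)
  qed (use mesh \<eta> proj in auto)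
qed

theorem lemma8p6:
  fixes \<Gamma> :: "'a::euclidean_space set" and d :: nat and \<delta>\<^sub>0 \<sigma> \<tau> C\<^sub>\<rho> C\<^sub>P :: real
  assumes "embedded_submanifold d \<Gamma>" and "compact \<Gamma>" and "connected \<Gamma>" and "\<Gamma> \<noteq> {}"
    and "d < DIM('a)"
    and "0 < \<delta>\<^sub>0" and "smooth_closest_point_on_tube \<Gamma> \<delta>\<^sub>0"
  shows "\<exists>h\<^sub>0 C. 0 < h\<^sub>0 \<and> 0 < C \<and>
    (\<forall>h \<K> \<T>' \<T> v.
       0 < h \<longrightarrow> h \<le> h\<^sub>0 \<longrightarrow>
       approximating_surface d \<Gamma> \<delta>\<^sub>0 C\<^sub>\<rho> C\<^sub>P h \<K> \<longrightarrow>
       background_mesh \<sigma> \<tau> h (tube \<Gamma> \<delta>\<^sub>0) \<T>' \<longrightarrow>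
       \<T> = active_mesh \<T>' \<K> \<longrightarrow>
       compatible \<K> \<T> \<longrightarrow>
       v \<in> fe_space \<T> \<longrightarrow>
       h powi (- (int DIM('a) - int d)) * (bulk_L2_norm \<T> (\<lambda>x. v x - surface_average \<K> v))\<^sup>2
       \<le> C * ((surface_L2_norm \<K> (surface_gradient \<T> v))\<^sup>2
              + h powi (2 - (int DIM('a) - int d)) * (bulk_L2_norm \<T> (\<lambda>x. gradient v (at x)))\<^sup>2))"
proof -
  let ?p = "closest_point \<Gamma>"
  define D where "D x = frechet_derivative ?p (at x)" for x
  obtain r \<Lambda> where tub: "tubular \<Gamma> ?p D r \<Lambda>" and tan: "\<And>q. q \<in> \<Gamma> \<Longrightarrow> orth_proj (tangent_space \<Gamma> q) = D q"
    using tubular_exists[OF assms(2-4,6,7)] unfolding D_def[abs_def] by metis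
  interpret tubular \<Gamma> ?p D r \<Lambda> by fact
  \<comment> \<open>\<open>r / 2\<close> keeps the surface strictly inside the tube and
    \<open>1 / (4 * \<Lambda>)\<close> yields the bound 1/4. The bound \<open>\<eta> \<le> 1\<close>
    makes the distance to \<open>\<Gamma>\<close> at most \<open>h\<close> as well.\<close>
  define \<eta> where "\<eta> = min (r / 2) (1 / (4 * \<Lambda>))"
  have "1 / (4 * \<Lambda>) \<le> 1" using \<Lambda>_ge1 by (simp add: field_simps)
  then have "\<eta> \<le> 1" unfolding \<eta>_def by (rule min.coboundedI2)
  then have \<eta>: "0 < \<eta>" "\<eta> < r" "\<eta> \<le> 1" using r_pos \<Lambda>_ge1 by (auto simp: \<eta>_def)
  have "\<Lambda> * \<eta> \<le> \<Lambda> * (1 / (4 * \<Lambda>))" using \<Lambda>_ge1 by (intro mult_left_mono) (auto simp: \<eta>_def)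
  then have \<Lambda>\<eta>: "\<Lambda> * \<eta> \<le> 1/4" using \<Lambda>_ge1 by simp
  \<comment> \<open>The first two entries bound \<open>C\<^sub>\<rho> * h\<^sup>2\<close> by both
    \<open>\<eta>\<close> and \<open>h\<close>, the third bounds \<open>C\<^sub>P * h\<close> by
    1/4, the last is the size limit of \<open>section_measure\<close>. Absolute values and added
    ones admit constants of any sign.\<close>
  define h\<^sub>0 where "h\<^sub>0 = min (min 1 (\<eta> / (\<bar>C\<^sub>\<rho>\<bar> + 1))) (min (1 / (4 * (\<bar>C\<^sub>P\<bar> + 1))) (r / 6))"
  have h0: "0 < h\<^sub>0" using \<eta> r_pos by (auto simp: h\<^sub>0_def add_nonneg_pos)
  \<comment> \<open>The chain
    \<open>h \<le> \<tau> * diameter T \<le> \<tau> * \<sigma> * \<rho>\<close> gives the constant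
    for the inradius; the maxima enforce the lower bound 1.\<close>
  define \<sigma>' \<tau>' where "\<sigma>' = max 1 (\<tau> * \<sigma>)" and "\<tau>' = max 1 \<tau>"
  define n where "n = DIM('a) - d"
  have n: "int DIM('a) - int d = int n" using assms(5) by (simp add: n_def)
  define C where "C = 1 + \<bar>surface_factor d \<sigma>' \<tau>'\<bar> + \<bar>gradient_factor \<sigma>' \<tau>'\<bar>"
  have C: "0 < C" by (simp add: C_def add_pos_nonneg)
  show ?thesis unfolding n
  proof (rule exI[of _ h\<^sub>0], rule exI[of _ C], intro conjI h0 C allI impI)
    fix h \<K> \<T>' \<T> v
    assume h: "0 < h" "h \<le> h\<^sub>0" and K: "approximating_surface d \<Gamma> \<delta>\<^sub>0 C\<^sub>\<rho> C\<^sub>P h \<K>"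
      and bg: "background_mesh \<sigma> \<tau> h (tube \<Gamma> \<delta>\<^sub>0) \<T>'" and act: "\<T> = active_mesh \<T>' \<K>"
      and comp: "compatible \<K> \<T>" and v: "v \<in> fe_space \<T>"
    have h1: "h \<le> 1" "h \<le> \<eta> / (\<bar>C\<^sub>\<rho>\<bar> + 1)" "h \<le> 1 / (4 * (\<bar>C\<^sub>P\<bar> + 1))" "h \<le> r / 6" using h by (auto simp: h\<^sub>0_def)
    have "C\<^sub>\<rho> * h\<^sup>2 \<le> (\<bar>C\<^sub>\<rho>\<bar> + 1) * h * h" unfolding power2_eq_square using h by (simp add: mult.assoc[symmetric] mult_right_mono)
    also have "\<dots> \<le> \<eta> * h" using h1(2) h by (intro mult_right_mono) (auto simp: field_simps)
    finally have rho: "C\<^sub>\<rho> * h\<^sup>2 \<le> \<eta> * h" .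
    have rho1: "C\<^sub>\<rho> * h\<^sup>2 \<le> \<eta>" and rho2: "C\<^sub>\<rho> * h\<^sup>2 \<le> h"
      using rho h h1(1) \<eta> mult_left_le[of h \<eta>] mult_left_le_one_le[of h \<eta>] by linarith+
    have "C\<^sub>P * h \<le> (\<bar>C\<^sub>P\<bar> + 1) * h" using h by (intro mult_right_mono) auto
    also have "\<dots> \<le> 1/4" using h1(3) by (simp add: field_simps add_nonneg_pos)
    finally have P: "C\<^sub>P * h \<le> 1/4" .
    note disc = approximating_surface_discrete[OF tub tan K \<eta>(2) \<Lambda>\<eta> rho1 P]
    interpret S: discrete_surface \<Gamma> ?p D r \<Lambda> d \<K> \<eta> by (rule disc(1))
    obtain G b where Gb: "\<And>T x. T \<in> \<T> \<Longrightarrow> x \<in> T \<Longrightarrow> v x = G T \<bullet> x + b T" and vc: "continuous_on (\<Union>\<T>) v"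
    proof -
      have "\<forall>T\<in>\<T>. \<exists>g b. \<forall>x\<in>T. v x = g \<bullet> x + b" "continuous_on (\<Union>\<T>) v" using v by (auto simp: fe_space_def)
      then show ?thesis using that by metis
    qed
    have TT': "T \<in> \<T>'" "T \<inter> \<Union>\<K> \<noteq> {}" if "T \<in> \<T>" for T using that act by (auto simp: active_mesh_def)
    have Ts: "int DIM('a) simplex T" if "T \<in> \<T>" for T using bg TT'(1)[OF that] by (simp add: background_mesh_def)
    have Td: "h \<le> \<tau> * diameter T" "diameter T \<le> \<tau> * h" if "T \<in> \<T>" for T
      using bg TT'(1)[OF that] by (auto simp: background_mesh_def)
    \<comment> \<open>The sign of \<open>\<tau>\<close> follows from the existence of an element,
      since \<open>h\<close> is positive and diameters are nonnegative.\<close>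
    have \<tau>pos: "0 < \<tau>" if "T \<in> \<T>" for T
    proof -
      have "0 \<le> diameter T" by (rule diameter_ge_0) (use compact_simplex[OF Ts[OF that]] compact_imp_bounded in blast)
      moreover have "0 < \<tau> * diameter T" using Td(1)[OF that] h by linarith
      ultimately show ?thesis by (simp add: zero_less_mult_iff)
    qed
    interpret F: fe_setting \<Gamma> ?p D r \<Lambda> d \<K> \<eta> h \<sigma>' \<tau>' \<T> v G b
    proof
      show "0 < h" "h \<le> r / 6" "1 \<le> \<sigma>'" "1 \<le> \<tau>'" using h h1 by (auto simp: \<sigma>'_def \<tau>'_def)
      show "finite \<T>" using bg act by (simp add: background_mesh_def active_mesh_def)
      show "convex T" "compact T" if "T \<in> \<T>" for T using Ts[OF that] convex_simplex compact_simplex by auto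
      show "T \<inter> \<Union>\<K> \<noteq> {}" if "T \<in> \<T>" for T using TT'(2)[OF that] .
      show "interior T \<inter> interior T' = {}" if "T \<in> \<T>" "T' \<in> \<T>" "T \<noteq> T'" for T T'
        using bg TT'(1)[OF that(1)] TT'(1)[OF that(2)] that(3) by (auto simp: background_mesh_def pairwise_def)
      show "\<exists>x \<rho>. h \<le> \<sigma>' * \<rho> \<and> cball x \<rho> \<subseteq> T" if T: "T \<in> \<T>" for T
      proof -
        have "\<exists>x \<rho>. 0 < \<rho> \<and> cball x \<rho> \<subseteq> T \<and> diameter T \<le> \<sigma> * \<rho>"
          using bg TT'(1)[OF T] by (auto simp: background_mesh_def)
        then obtain x \<rho> where x: "0 < \<rho>" "cball x \<rho> \<subseteq> T" "diameter T \<le> \<sigma> * \<rho>" by blast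
        have "h \<le> \<tau> * (\<sigma> * \<rho>)" using Td(1)[OF T] mult_left_mono[OF x(3), of \<tau>] \<tau>pos[OF T] by linarith
        also have "\<dots> \<le> \<sigma>' * \<rho>" using x(1) by (simp add: \<sigma>'_def mult.assoc[symmetric] mult_right_mono)
        finally show ?thesis using x(2) by blast
      qed
      show "norm (x - y) \<le> \<tau>' * h" if T: "T \<in> \<T>" "x \<in> T" "y \<in> T" for T x y
      proof -
        have "norm (x - y) \<le> diameter T"
          using diameter_bounded_bound[OF compact_imp_bounded[OF compact_simplex[OF Ts[OF T(1)]]] T(2,3)] by (simp add: dist_norm)
        also have "\<dots> \<le> \<tau> * h" by (rule Td(2)[OF T(1)])
        also have "\<dots> \<le> \<tau>' * h" using h by (intro mult_right_mono) (auto simp: \<tau>'_def)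
        finally show ?thesis .
      qed
      show "\<exists>T\<in>\<T>. K \<subseteq> T" if KK: "K \<in> \<K>" for K
      proof -
        \<comment> \<open>A relative interior point lies in the covered tube, hence in some
          background element, which is thereby active; compatibility then puts all of
          \<open>K\<close> into that element.\<close>
        obtain z where z: "z \<in> rel_interior K"
          using S.K_props(1,5)[OF KK] rel_interior_eq_empty by blast
        then have zK: "z \<in> K" using rel_interior_subset by blast
        then have "z \<in> tube \<Gamma> \<delta>\<^sub>0" using K that by (auto simp: approximating_surface_def)
        then obtain T where T: "T \<in> \<T>'" "z \<in> T" using bg unfolding background_mesh_def by blast
        then have "T \<in> \<T>" using act zK that by (auto simp: active_mesh_def)
        moreover have "K \<subseteq> T" using comp that \<open>T \<in> \<T>\<close> z T(2) by (auto simp: compatible_def)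
        ultimately show ?thesis by blast
      qed
      show "norm (x - ?p x) \<le> h" if "x \<in> \<Union>\<K>" for x using disc(2)[rotated, OF that] rho2 by force
    qed (use vc Gb in auto)
    define X Y Z where "X = (bulk_L2_norm \<T> (\<lambda>x. v x - surface_average \<K> v))\<^sup>2"
      and "Y = (surface_L2_norm \<K> (surface_gradient \<T> v))\<^sup>2" and "Z = (bulk_L2_norm \<T> (\<lambda>x. gradient v (at x)))\<^sup>2"
    have YZ: "0 \<le> Y" "0 \<le> Z" by (auto simp: Y_def Z_def)
    have "X \<le> surface_factor d \<sigma>' \<tau>' * h ^ n * Y + gradient_factor \<sigma>' \<tau>' * h\<^sup>2 * Z"
      using F.bulk_estimate assms(5) by (simp add: X_def Y_def Z_def n_def)
    also have "\<dots> \<le> C * h ^ n * Y + C * h\<^sup>2 * Z"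
      using YZ h by (intro add_mono mult_right_mono) (auto simp: C_def)
    finally have le: "X \<le> C * h ^ n * Y + C * h\<^sup>2 * Z" .
    have "h powi (- int n) * X \<le> h powi (- int n) * (C * h ^ n * Y + C * h\<^sup>2 * Z)"
      using le h by (intro mult_left_mono) auto
    also have "\<dots> = C * (Y + h powi (2 - int n) * Z)"
      using h by (simp add: power_int_minus power_int_diff field_simps)
    finally show "h powi (- int n) * (bulk_L2_norm \<T> (\<lambda>x. v x - surface_average \<K> v))\<^sup>2
       \<le> C * ((surface_L2_norm \<K> (surface_gradient \<T> v))\<^sup>2 + h powi (2 - int n) * (bulk_L2_norm \<T> (\<lambda>x. gradient v (at x)))\<^sup>2)"
      by (simp add: X_def Y_def Z_def)
  qed
qed

end
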